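(* Let $a<b$ be coprime positive integers and let $\mathbf r=(r_1,\dots,r_a)$ be nonnegative integers with $\sum_{i=1}^a i r_i=a$; set $k=\sum_{i=1}^a r_i$. Let $X$ be the set of $\pi\in\mathsf{NC}(a,b)$ having exactly $r_i$ blocks of $a,b$-rank $i$ for each $1\le i\le a$, and let $C=\mathbb{Z}_{b-1}$ act on $X$ by rotation. Then $(X,C,X(q))$ exhibits the cyclic sieving phenomenon, where $$X(q)=\mathsf{Krew}_q(a,b,\mathbf r)=\frac{[b-1]_q!}{[r_1]_q!\,[r_2]_q!\cdots[r_a]_q!\,[b-k]_q!}.$$
   Context: Let $a<b$ be coprime positive integers and $[b-1]=\{1,\dots,b-1\}$. An $a,b$-Dyck path is a lattice path from $(0,0)$ to $(b,a)$ using unit north and east steps that stays weakly above the line $y=\frac{a}{b}x$. A valley of such a path $D$ is a lattice point of $D$ immediately preceded by an east step and immediately followed by a north step. From each valley $P$ fire the laser $\ell(P)$: the segment of slope $\frac ab$ from $P$ going northeast until it first meets $D$ again. Label the east endpoints of the first $b-1$ east steps of $D$ from left to right by $1,\dots,b-1$, each label regarded as sitting slightly below its lattice point. The set partition $\pi(D)$ of $[b-1]$ declares $i\sim j$ iff labels $i,j$ are not separated by any valley laser. $\mathsf{NC}(a,b)=\{\pi(D): D\text{ an }a,b\text{-Dyck path}\}$. Rotation: a generator of $\mathbb Z_{b-1}$ acts by $\mathtt{rot}$, the permutation $i\mapsto i+1$ ($i<b-1$), $b-1\mapsto1$, applied blockwise. Rank: for a noncrossing partition $\pi$ of $[b-1]$,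 order its blocks by $B'\preceq B$ iff $[\min B',\max B']\subseteq[\min B,\max B]$; the integers $\mathrm{rank}^{\pi}_{a,b}(B)$ are the unique integers with $\sum_{B'\preceq B}\mathrm{rank}^{\pi}_{a,b}(B')=\lceil(\max B-\min B+1)\frac ab\rceil$ for all blocks $B$. Notation: $[n]_q=1+q+\cdots+q^{n-1}$, $[n]_q!=[1]_q\cdots[n]_q$. Cyclic sieving: for a finite set $X$ acted on by a cyclic group $C=\langle c\rangle$ of order $n$ and a polynomial $X(q)$ with nonnegative integer coefficients, $(X,C,X(q))$ exhibits the cyclic sieving phenomenon if $X(\zeta^d)=|\{x\in X: c^d.x=x\}|$ for all $d\ge0$, where $\zeta$ is a primitive $n$-th root of unity. *)

theory Defs
  imports
    "HOL-Algebra.Group_Action"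
    "HOL-Algebra.Elementary_Groups"
    "HOL-Analysis.Analysis"
    "HOL-Computational_Algebra.Polynomial_Factorial"
begin

datatype step = North | East

definition vertex :: "step list \<Rightarrow> nat \<Rightarrow> real \<times> real" where
  "vertex D m = (real (count_list (take m D) East), real (count_list (take m D) North))"

definition path_trace :: "step list \<Rightarrow> (real \<times> real) set" where
  "path_trace D = (\<Union>m<length D. closed_segment (vertex D m) (vertex D (Suc m)))"

definition dyck_path :: "nat \<Rightarrow> nat \<Rightarrow> step list \<Rightarrow> bool" where
  "dyck_path a b D \<longleftrightarrow>
     count_list D North = a \<and> count_list D East = b \<and>
     (\<forall>(x, y) \<in> path_trace D. y \<ge> real a / real b * x)"

definition valleys :: "step list \<Rightarrow> (real \<times> real) set" where
  "valleys D = {vertex D (Suc m) | m. Suc m < length D \<and> D ! m = East \<and> D ! Suc m = North}"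

text \<open>The ray from \<open>P\<close> in direction \<open>(b, a)\<close>, followed up to and including its first
  return to the path.\<close>

definition laser :: "nat \<Rightarrow> nat \<Rightarrow> step list \<Rightarrow> real \<times> real \<Rightarrow> (real \<times> real) set" where
  "laser a b D P =
     {P + t *\<^sub>R (real b, real a) | t.
        0 \<le> t \<and> (\<forall>s. 0 < s \<and> s < t \<longrightarrow> P + s *\<^sub>R (real b, real a) \<notin> path_trace D)}"

definition east_ends :: "step list \<Rightarrow> (real \<times> real) list" where
  "east_ends D = map (\<lambda>m. vertex D (Suc m)) (filter (\<lambda>m. D ! m = East) [0..<length D])"

text \<open>Label \<open>i\<close>, placed at distance \<open>\<epsilon>\<close> below the east endpoint of the \<open>i\<close>-th east step
  (counted from 1).\<close>

definition label_point :: "step list \<Rightarrow> nat \<Rightarrow> real \<Rightarrow> real \<times> real" where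
  "label_point D i \<epsilon> = east_ends D ! (i - 1) - (0, \<epsilon>)"

text \<open>The path is an arc and does not disconnect the plane; the path together with the laser
  from a valley encloses one bounded region. Two labels are separated by the laser if they lie in
  different components of the complement, for all sufficiently small \<open>\<epsilon> > 0\<close>.\<close>

definition separated :: "nat \<Rightarrow> nat \<Rightarrow> step list \<Rightarrow> real \<times> real \<Rightarrow> nat \<Rightarrow> nat \<Rightarrow> bool" where
  "separated a b D P i j \<longleftrightarrow>
     (\<forall>\<^sub>F \<epsilon> in at_right 0.
        \<not> connected_component (- (path_trace D \<union> laser a b D P))
            (label_point D i \<epsilon>) (label_point D j \<epsilon>))"

definition dyck_partition :: "nat \<Rightarrow> nat \<Rightarrow> step list \<Rightarrow> nat set set" where
  "dyck_partition a b D =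
     {1..b - 1} // {(i, j). i \<in> {1..b - 1} \<and> j \<in> {1..b - 1} \<and>
                            (\<forall>P \<in> valleys D. \<not> separated a b D P i j)}"

definition NC :: "nat \<Rightarrow> nat \<Rightarrow> nat set set set" where
  "NC a b = {dyck_partition a b D | D. dyck_path a b D}"

definition rot :: "nat \<Rightarrow> nat \<Rightarrow> nat" where
  "rot n i = (if i < n then i + 1 else 1)"

definition rot_partition :: "nat \<Rightarrow> nat set set \<Rightarrow> nat set set" where
  "rot_partition n \<pi> = (\<lambda>B. rot n ` B) ` \<pi>"

text \<open>The residue \<open>g\<close> acts as the \<open>g\<close>-th power of rotation. The map is restricted to \<open>X\<close> because
  \<^const>\<open>BijGroup\<close> consists of extensional functions.\<close>

definition rot_action :: "nat \<Rightarrow> nat set set set \<Rightarrow> int \<Rightarrow> nat set set \<Rightarrow> nat set set" where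
  "rot_action n X g = restrict (rot_partition n ^^ nat g) X"

definition block_le :: "nat set \<Rightarrow> nat set \<Rightarrow> bool" where
  "block_le B' B \<longleftrightarrow> {Min B'..Max B'} \<subseteq> {Min B..Max B}"

definition rank_fun :: "nat \<Rightarrow> nat \<Rightarrow> nat set set \<Rightarrow> nat set \<Rightarrow> int" where
  "rank_fun a b \<pi> = (THE f. f \<in> extensional \<pi> \<and>
     (\<forall>B \<in> \<pi>. (\<Sum>B' | B' \<in> \<pi> \<and> block_le B' B. f B') =
               \<lceil>(real (Max B) - real (Min B) + 1) * (real a / real b)\<rceil>))"

definition NC_rank :: "nat \<Rightarrow> nat \<Rightarrow> (nat \<Rightarrow> nat) \<Rightarrow> nat set set set" where
  "NC_rank a b r =
     {\<pi> \<in> NC a b. \<forall>i \<in> {1..a}. card {B \<in> \<pi>. rank_fun a b \<pi> B = int i} = r i}"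

definition q_int :: "nat \<Rightarrow> int poly" where
  "q_int n = (\<Sum>i<n. monom 1 i)"

definition q_fact :: "nat \<Rightarrow> int poly" where
  "q_fact n = (\<Prod>m=1..n. q_int m)"

definition Krew_q :: "nat \<Rightarrow> nat \<Rightarrow> (nat \<Rightarrow> nat) \<Rightarrow> int poly fract" where
  "Krew_q a b r = to_fract (q_fact (b - 1)) /
     ((\<Prod>i=1..a. to_fract (q_fact (r i))) * to_fract (q_fact (b - (\<Sum>i=1..a. r i))))"

definition primitive_root_of_unity :: "nat \<Rightarrow> complex \<Rightarrow> bool" where
  "primitive_root_of_unity n \<zeta> \<longleftrightarrow> \<zeta> ^ n = 1 \<and> (\<forall>m. 0 < m \<and> m < n \<longrightarrow> \<zeta> ^ m \<noteq> 1)"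

definition cyclic_sieving ::
  "('x set) \<Rightarrow> ('g, 'm) monoid_scheme \<Rightarrow> 'g \<Rightarrow> ('g \<Rightarrow> 'x \<Rightarrow> 'x) \<Rightarrow> int poly \<Rightarrow> bool" where
  "cyclic_sieving X C c \<phi> p \<longleftrightarrow>
     finite X \<and> finite (carrier C) \<and> c \<in> carrier C \<and> generate C {c} = carrier C \<and>
     group_action C X \<phi> \<and>
     (\<forall>i. coeff p i \<ge> 0) \<and>
     (\<forall>\<zeta>. primitive_root_of_unity (Coset.order C) \<zeta> \<longrightarrow>
        (\<forall>d::nat. poly (map_poly of_int p) (\<zeta> ^ d) =
                  of_nat (card (invariants X \<phi> (c [^]\<^bsub>C\<^esub> d)))))"

end

theory Submission
  imports Defs "HOL-Combinatorics.Multiset_Permutations"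
begin

text \<open>
  Record a Dyck path by the word \<open>v\<^sub>0 \<dots> v\<^sub>b\<^sub>-\<^sub>1\<close> of its vertical runs, and let the \<^emph>\<open>level\<close> of the
  \<open>i\<close>-th label be \<open>b\<close> times its height minus \<open>a i\<close>. A laser runs along a fixed level, so the laser of
  the valley \<open>p\<close> encloses exactly the labels following \<open>p\<close> up to the first one of lower level.
  Hence two labels lie in the same block iff the nearest preceding label of lower level (their
  parent) is the same, the block of the children of \<open>p\<close> has rank \<open>v\<^sub>p\<close>, and rotation becomes an
  explicit operation (\<open>turn\<close>) on words. The number of words with given letters is found by the cycle
  lemma.

  Let \<open>n = b - 1 = d m\<close> with \<open>d \<ge> 2\<close>. A partition fixed by the \<open>m\<close>-th power of rotation has
  a unique centre, which is either a block of some rank \<open>c > 0\<close> or a gap between blocks (\<open>c = 0\<close>).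
  Reading off where the other blocks open as seen from the centre gives an \<open>m\<close>-periodic word
  with total \<open>a - c\<close>; conversely a periodic word determines the partition through the
  corresponding periodic walk of levels. So the fixed partitions are counted by a multinomial
  coefficient, which is the value of the \<open>q\<close>-multinomial quotient at a primitive \<open>d\<close>-th root of unity.

  The quotient is a polynomial because \<open>gcd(a, b) = 1\<close>. It has nonnegative coefficients
  because the \<open>q\<close>-multinomial coefficient is symmetric and unimodal, which follows from the action of
  \<open>sl\<^sub>2\<close> on exterior powers.
\<close>

subsection \<open>Unimodality of the Gaussian coefficients\<close>

text \<open>The formula dictates the encoding. Together with \<open>b - k\<close> zeros the numbers
  \<open>r i\<close> are the letter multiplicities of a word of length \<open>b\<close>, so the
  quotient is the \<open>q\<close>-multinomial coefficient of that word divided by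
  \<open>[b]\<close>. Coprimality makes the levels of any \<open>b\<close> consecutive positions
  distinct; this is what makes parents, minima and the landing steps of lasers unambiguous. The
  multiplicities sum to \<open>b = d m + 1\<close>, and at a primitive \<open>d\<close>-th root of
  unity the quotient vanishes unless one of them is 1 and all others are 0 modulo \<open>d\<close>.
  The exceptional letter is the rank \<open>c\<close> of the centre. A gap counts as the letter 0,
  so one parameter covers both kinds of centre. The obstacle is that a centre does not single out a
  starting label: every element of the central block serves equally well, and a gap can be cut at
  several places. Fixed words and periodic words are therefore compared by a relation through a
  common shift instead of an explicit map. Positivity after division by \<open>[b]\<close> comes
  with no combinatorial model of the coefficients; this is why unimodality is needed and not only
  nonnegativity of the \<open>q\<close>-multinomial coefficient.\<close>

lemma homogeneous_system:
  fixes M :: "'b \<Rightarrow> 'a \<Rightarrow> real"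
  assumes "finite B" "finite A" "card B < card A"
  shows "\<exists>f. (\<exists>x\<in>A. f x \<noteq> 0) \<and> (\<forall>y\<in>B. (\<Sum>x\<in>A. M y x * f x) = 0)"
  using assms
proof (induction B arbitrary: A M rule: finite_induct)
  case empty
  then obtain x where "x \<in> A" by fastforce
  then show ?case by (intro exI[of _ "\<lambda>_. 1"]) auto
next
  case (insert y B)
  show ?case
  proof (cases "\<forall>x\<in>A. M y x = 0")
    case True
    have "card B < card A" using insert by simp
    from insert.IH[OF insert.prems(1) this, of M] True show ?thesis by (auto intro: exI)
  next
    case False
    then obtain x0 where x0: "x0 \<in> A" "M y x0 \<noteq> 0" by blast
    let ?A = "A - {x0}"
    have "finite ?A" "card B < card ?A" using insert x0 by auto
    \<comment> \<open>Gaussian elimination: row \<open>y\<close> with pivot \<open>x0\<close> is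
      subtracted from the other rows, and \<open>c\<close> below is the value at \<open>x0\<close>
      that row \<open>y\<close> then forces.\<close>
    from insert.IH[OF this, of "\<lambda>z x. M z x - M z x0 * M y x / M y x0"]
    obtain f where f: "\<exists>x\<in>?A. f x \<noteq> 0"
      "\<And>z. z \<in> B \<Longrightarrow> (\<Sum>x\<in>?A. (M z x - M z x0 * M y x / M y x0) * f x) = 0" by blast
    define c where "c = - (\<Sum>x\<in>?A. M y x * f x) / M y x0"
    define g where "g = f(x0 := c)"
    have split: "(\<Sum>x\<in>A. M z x * g x) = M z x0 * c + (\<Sum>x\<in>?A. M z x * f x)" for z
    proof -
      have "(\<Sum>x\<in>A. M z x * g x) = M z x0 * g x0 + (\<Sum>x\<in>?A. M z x * g x)"
        using x0(1) insert.prems(1) by (rule sum.remove[rotated])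
      moreover have "(\<Sum>x\<in>?A. M z x * g x) = (\<Sum>x\<in>?A. M z x * f x)"
        by (rule sum.cong) (auto simp: g_def)
      ultimately show ?thesis by (simp add: g_def)
    qed
    have "(\<Sum>x\<in>A. M z x * g x) = 0" if "z \<in> insert y B" for z
    proof (cases "z = y")
      case True
      then show ?thesis using x0 by (simp add: split c_def)
    next
      case False
      hence "z \<in> B" using that by simp
      from f(2)[OF this]
      have "(\<Sum>x\<in>?A. M z x * f x) - (\<Sum>x\<in>?A. (M z x0 / M y x0) * (M y x * f x)) = 0"
        by (simp add: algebra_simps sum_subtractf)
      hence "(\<Sum>x\<in>?A. M z x * f x) = (M z x0 / M y x0) * (\<Sum>x\<in>?A. M y x * f x)"
        by (simp add: sum_distrib_left)
      then show ?thesis by (simp add: split c_def)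
    qed
    moreover have "\<exists>x\<in>A. g x \<noteq> 0" using f(1) by (auto simp: g_def)
    ultimately show ?thesis by blast
  qed
qed

text \<open>Coordinate form of the elementary matrix that sends the basis vector \<open>j\<close> to
  \<open>Suc j\<close>, acting on an exterior power: \<open>T\<close> is the target subset. No sign
  appears, because replacing \<open>j\<close> by its neighbour \<open>Suc j\<close> does not reorder
  the wedge product.\<close>

definition hop_up :: "nat \<Rightarrow> (nat set \<Rightarrow> real) \<Rightarrow> nat set \<Rightarrow> real" where
  "hop_up j f T = (if Suc j \<in> T \<and> j \<notin> T then f (insert j (T - {Suc j})) else 0)"

definition hop_down :: "nat \<Rightarrow> (nat set \<Rightarrow> real) \<Rightarrow> nat set \<Rightarrow> real" where
  "hop_down j f R = (if j \<in> R \<and> Suc j \<notin> R then f (insert (Suc j) (R - {j})) else 0)"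

lemma hop_commute:
  assumes "j \<noteq> l" shows "hop_down j (hop_up l f) R = hop_up l (hop_down j f) R"
proof -
  have "insert l (insert (Suc j) (R - {j}) - {Suc l}) = insert (Suc j) (insert l (R - {Suc l}) - {j})"
    if "j \<in> R" "Suc j \<notin> R" "Suc l \<in> R" "l \<notin> R"
    using that assms by auto
  thus ?thesis using assms by (auto simp: hop_down_def hop_up_def)
qed

text \<open>This is the commutator of two opposite elementary matrices, a difference of two diagonal
  ones. In the remaining cases (both or neither of \<open>j\<close>, \<open>Suc j\<close> in
  \<open>R\<close>) all terms vanish.\<close>

lemma hop_diag:
  "hop_down j (hop_up j f) R - hop_up j (hop_down j f) R
     = (of_bool (j \<in> R) - of_bool (Suc j \<in> R)) * f R"
proof -
  have "insert j (insert (Suc j) (R - {j}) - {Suc j}) = R" if "j \<in> R" "Suc j \<notin> R"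
    using that by auto
  moreover have "insert (Suc j) (insert j (R - {Suc j}) - {j}) = R" if "Suc j \<in> R" "j \<notin> R"
    using that by auto
  ultimately show ?thesis by (auto simp: hop_down_def hop_up_def)
qed

lemma hop_adjoint:
  assumes "Suc j < N"
  shows "(\<Sum>T\<in>Pow {..<N}. hop_up j f T * g T) = (\<Sum>R\<in>Pow {..<N}. f R * hop_down j g R)"
proof -
  have "(\<Sum>T\<in>Pow {..<N}. hop_up j f T * g T)
      = (\<Sum>T | T \<in> Pow {..<N} \<and> Suc j \<in> T \<and> j \<notin> T. f (insert j (T - {Suc j})) * g T)"
    by (rule sum.mono_neutral_cong_right) (auto simp: hop_up_def)
  also have "\<dots> = (\<Sum>R | R \<in> Pow {..<N} \<and> j \<in> R \<and> Suc j \<notin> R. f R * g (insert (Suc j) (R - {j})))"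
  proof (rule sum.reindex_bij_witness[where i = "\<lambda>R. insert (Suc j) (R - {j})"
        and j = "\<lambda>T. insert j (T - {Suc j})"])
  qed (use assms in \<open>auto simp: insert_absorb\<close>)
  also have "\<dots> = (\<Sum>R\<in>Pow {..<N}. f R * hop_down j g R)"
    by (rule sum.mono_neutral_cong_left) (auto simp: hop_down_def)
  finally show ?thesis .
qed

text \<open>Abel summation: the weights \<open>(j + 1) (N - 1 - j)\<close> have the differences
  \<open>N - 1 - 2 j\<close>, which are the weights of the irreducible representation.\<close>

lemma sum_telescope_indicator:
  fixes h :: "nat \<Rightarrow> real"
  shows "(\<Sum>j<M. real (Suc j) * (real N - 1 - real j) * (h j - h (Suc j)))
      = (\<Sum>j<M. (real N - 1 - 2 * real j) * h j) - real M * (real N - real M) * h M"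
  by (induction M) (auto simp: algebra_simps)

text \<open>The \<open>k\<close>-th exterior power of the \<open>N\<close>-dimensional irreducible representation of \<open>sl\<^sub>2\<close>, in an
  orthonormal weight basis indexed by subsets: \<open>raise\<close> and \<open>lower\<close> are adjoint and their commutator
  is diagonal.\<close>

definition hop_weight :: "nat \<Rightarrow> nat \<Rightarrow> real" where
  "hop_weight N j = sqrt (real (Suc j) * (real N - 1 - real j))"

definition raise :: "nat \<Rightarrow> (nat set \<Rightarrow> real) \<Rightarrow> nat set \<Rightarrow> real" where
  "raise N f T = (\<Sum>j<N - 1. hop_weight N j * hop_up j f T)"

definition lower :: "nat \<Rightarrow> (nat set \<Rightarrow> real) \<Rightarrow> nat set \<Rightarrow> real" where
  "lower N f T = (\<Sum>j<N - 1. hop_weight N j * hop_down j f T)"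

lemma raise_adjoint:
  "(\<Sum>T\<in>Pow {..<N}. raise N f T * g T) = (\<Sum>R\<in>Pow {..<N}. f R * lower N g R)"
proof -
  have "(\<Sum>T\<in>Pow {..<N}. raise N f T * g T)
      = (\<Sum>j<N - 1. hop_weight N j * (\<Sum>T\<in>Pow {..<N}. hop_up j f T * g T))"
    unfolding raise_def sum_distrib_right sum_distrib_left
    by (subst sum.swap) (simp add: mult.assoc)
  also have "\<dots> = (\<Sum>j<N - 1. hop_weight N j * (\<Sum>R\<in>Pow {..<N}. f R * hop_down j g R))"
    by (rule sum.cong) (auto simp: hop_adjoint)
  also have "\<dots> = (\<Sum>R\<in>Pow {..<N}. f R * lower N g R)"
    unfolding lower_def sum_distrib_right sum_distrib_left
    by (subst sum.swap) (simp add: mult.left_commute)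
  finally show ?thesis .
qed

text \<open>Hops at different places commute, so only the terms with \<open>l = j\<close> survive;
  there the squared weights telescope to the total weight of \<open>R\<close>.\<close>

lemma lower_raise:
  assumes R: "R \<subseteq> {..<N}"
  shows "lower N (raise N f) R - raise N (lower N f) R = (\<Sum>j\<in>R. real N - 1 - 2 * real j) * f R"
proof -
  let ?w = "hop_weight N" and ?J = "{..<N - 1}"
  have "lower N (raise N f) R = (\<Sum>j\<in>?J. \<Sum>l\<in>?J. ?w j * ?w l * hop_down j (hop_up l f) R)"
    unfolding lower_def raise_def
    by (intro sum.cong refl) (auto simp: hop_down_def sum_distrib_left mult.assoc)
  moreover have "raise N (lower N f) R = (\<Sum>l\<in>?J. \<Sum>j\<in>?J. ?w j * ?w l * hop_up l (hop_down j f) R)"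
    unfolding lower_def raise_def
    by (intro sum.cong refl) (auto simp: hop_up_def sum_distrib_left mult_ac)
  hence "raise N (lower N f) R = (\<Sum>j\<in>?J. \<Sum>l\<in>?J. ?w j * ?w l * hop_up l (hop_down j f) R)"
    by (subst sum.swap)
  ultimately have "lower N (raise N f) R - raise N (lower N f) R =
      (\<Sum>j\<in>?J. \<Sum>l\<in>?J. ?w j * ?w l * (hop_down j (hop_up l f) R - hop_up l (hop_down j f) R))"
    by (simp add: sum_subtractf right_diff_distrib)
  also have "\<dots> = (\<Sum>j\<in>?J. \<Sum>l\<in>?J. if l = j then ?w j * ?w j * (hop_down j (hop_up j f) R - hop_up j (hop_down j f) R) else 0)"
    by (intro sum.cong refl) (auto simp: hop_commute)
  also have "\<dots> = (\<Sum>j\<in>?J. (?w j)\<^sup>2 * ((of_bool (j \<in> R) - of_bool (Suc j \<in> R)) * f R))"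
    by (intro sum.cong refl) (auto simp: hop_diag power2_eq_square)
  also have "\<dots> = (\<Sum>j\<in>?J. real (Suc j) * (real N - 1 - real j) * (of_bool (j \<in> R) - of_bool (Suc j \<in> R))) * f R"
    unfolding sum_distrib_right hop_weight_def by (intro sum.cong refl) auto
  also have "(\<Sum>j\<in>?J. real (Suc j) * (real N - 1 - real j) * (of_bool (j \<in> R) - of_bool (Suc j \<in> R)))
     = (\<Sum>j<N. (real N - 1 - 2 * real j) * of_bool (j \<in> R))"
    unfolding sum_telescope_indicator[of N "\<lambda>j. of_bool (j \<in> R)" "N - 1"]
    by (cases N) (auto simp: algebra_simps)
  also have "\<dots> = (\<Sum>j\<in>R. real N - 1 - 2 * real j)"
    by (rule sum.mono_neutral_cong_right) (use R in auto)
  finally show ?thesis .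
qed

text \<open>Adjointness turns the commutator into an identity of norms. Where the diagonal weight is
  positive it makes \<open>raise\<close> injective.\<close>

lemma raise_norm:
  "(\<Sum>T\<in>Pow {..<N}. (raise N f T)\<^sup>2) = (\<Sum>T\<in>Pow {..<N}. (lower N f T)\<^sup>2)
     + (\<Sum>R\<in>Pow {..<N}. (\<Sum>j\<in>R. real N - 1 - 2 * real j) * (f R)\<^sup>2)"
proof -
  have "(\<Sum>T\<in>Pow {..<N}. (raise N f T)\<^sup>2) = (\<Sum>R\<in>Pow {..<N}. f R * lower N (raise N f) R)"
    using raise_adjoint[of N f "raise N f"] by (simp add: power2_eq_square)
  moreover have "(\<Sum>T\<in>Pow {..<N}. (lower N f T)\<^sup>2) = (\<Sum>R\<in>Pow {..<N}. raise N (lower N f) R * f R)"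
    using raise_adjoint[of N "lower N f" f] by (simp add: power2_eq_square)
  moreover have "(\<Sum>R\<in>Pow {..<N}. f R * lower N (raise N f) R) = (\<Sum>R\<in>Pow {..<N}. raise N (lower N f) R * f R)
     + (\<Sum>R\<in>Pow {..<N}. (\<Sum>j\<in>R. real N - 1 - 2 * real j) * (f R)\<^sup>2)"
    unfolding sum.distrib[symmetric]
  proof (intro sum.cong refl)
    fix R assume "R \<in> Pow {..<N}"
    hence "lower N (raise N f) R = raise N (lower N f) R + (\<Sum>j\<in>R. real N - 1 - 2 * real j) * f R"
      using lower_raise[of R N f] by auto
    thus "f R * lower N (raise N f) R = raise N (lower N f) R * f R + (\<Sum>j\<in>R. real N - 1 - 2 * real j) * (f R)\<^sup>2"
      by (simp add: algebra_simps power2_eq_square)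
  qed
  ultimately show ?thesis by simp
qed

definition weight_subsets :: "nat \<Rightarrow> nat \<Rightarrow> nat \<Rightarrow> nat set set" where
  "weight_subsets N k i = {S. S \<subseteq> {..<N} \<and> card S = k \<and> \<Sum>S = i}"

lemma finite_weight_subsets [simp]: "finite (weight_subsets N k i)"
  by (rule finite_subset[of _ "Pow {..<N}"]) (auto simp: weight_subsets_def)

lemma hop_weight_subsets:
  assumes "Suc j \<in> T" "j \<notin> T" "finite T" "insert j (T - {Suc j}) \<in> weight_subsets N k i" "Suc j < N"
  shows "T \<in> weight_subsets N k (Suc i)"
proof -
  have T: "T = insert (Suc j) (T - {Suc j})" using assms by auto
  have "card T = Suc (card (T - {Suc j}))" "\<Sum>T = Suc j + \<Sum>(T - {Suc j})"
    using assms(1,3) card.remove[of T "Suc j"] sum.remove[of T "Suc j" "\<lambda>x. x"] by auto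
  moreover have "card (insert j (T - {Suc j})) = Suc (card (T - {Suc j}))"
    "\<Sum>(insert j (T - {Suc j})) = j + \<Sum>(T - {Suc j})" using assms by auto
  moreover have "T \<subseteq> {..<N}" using assms by (auto simp: weight_subsets_def)
  ultimately show ?thesis using assms(4) by (auto simp: weight_subsets_def)
qed

text \<open>If there were fewer subsets of sum \<open>i + 1\<close> than of sum \<open>i\<close>,
  some nonzero \<open>f\<close> on the latter would be killed by \<open>raise\<close>. The norm
  identity then reads 0 = (norm of \<open>lower f\<close>) + (positive constant) (norm of
  \<open>f\<close>), a contradiction.\<close>

theorem weight_subsets_mono:
  assumes "2 * i < k * (N - 1)"
  shows "card (weight_subsets N k i) \<le> card (weight_subsets N k (Suc i))"
proof (rule ccontr)
  let ?P = "weight_subsets N k"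
  \<comment> \<open>The matrix of \<open>raise N\<close> from subsets of sum \<open>i\<close> to
    subsets of sum \<open>i + 1\<close>.\<close>
  let ?M = "\<lambda>T S. \<Sum>j<N - 1. if Suc j \<in> T \<and> j \<notin> T \<and> S = insert j (T - {Suc j}) then hop_weight N j else 0"
  assume "\<not> ?thesis"
  hence "card (?P (Suc i)) < card (?P i)" by simp
  from homogeneous_system[OF _ _ this, of ?M]
  obtain f0 where f0: "\<exists>S\<in>?P i. f0 S \<noteq> 0" "\<And>T. T \<in> ?P (Suc i) \<Longrightarrow> (\<Sum>S\<in>?P i. ?M T S * f0 S) = 0"
    by auto
  define f where "f S = (if S \<in> ?P i then f0 S else 0)" for S
  have zero: "raise N f T = 0" if T: "T \<in> Pow {..<N}" for T
  proof (cases "T \<in> ?P (Suc i)")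
    case True
    have "(\<Sum>S\<in>?P i. ?M T S * f0 S) =
        (\<Sum>j<N - 1. \<Sum>S\<in>?P i. if Suc j \<in> T \<and> j \<notin> T \<and> S = insert j (T - {Suc j}) then hop_weight N j * f0 S else 0)"
      unfolding sum_distrib_right by (subst sum.swap) (intro sum.cong refl, auto)
    also have "\<dots> = raise N f T"
      unfolding raise_def
    proof (intro sum.cong refl)
      fix j
      show "(\<Sum>S\<in>?P i. if Suc j \<in> T \<and> j \<notin> T \<and> S = insert j (T - {Suc j}) then hop_weight N j * f0 S else 0)
          = hop_weight N j * hop_up j f T"
        by (cases "Suc j \<in> T \<and> j \<notin> T") (auto simp: hop_up_def f_def)
    qed
    finally show ?thesis using f0(2)[OF True] by simp
  next
    case False
    have "finite T" using T finite_subset by auto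
    hence "hop_up j f T = 0" if "j < N - 1" for j
      using hop_weight_subsets[of j T N k i] False that less_diff_conv[of j N 1]
      by (auto simp: hop_up_def f_def)
    then show ?thesis by (simp add: raise_def)
  qed
  \<comment> \<open>The sum of \<open>N - 1 - 2 j\<close> over a subset of size \<open>k\<close> and
    sum \<open>i\<close>; it is positive exactly below the middle sum.\<close>
  let ?c = "real (k * (N - 1)) - 2 * real i"
  have "N > 0" using assms by (cases N) auto
  have "(\<Sum>R\<in>Pow {..<N}. (\<Sum>j\<in>R. real N - 1 - 2 * real j) * (f R)\<^sup>2) = (\<Sum>R\<in>Pow {..<N}. ?c * (f R)\<^sup>2)"
  proof (intro sum.cong refl)
    fix R
    show "(\<Sum>j\<in>R. real N - 1 - 2 * real j) * (f R)\<^sup>2 = ?c * (f R)\<^sup>2"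
    proof (cases "R \<in> ?P i")
      case True
      hence "card R = k" "(\<Sum>j\<in>R. real j) = real i" by (auto simp: weight_subsets_def simp flip: of_nat_sum)
      then show ?thesis using \<open>N > 0\<close> by (simp add: sum_subtractf sum_distrib_left[symmetric] of_nat_diff)
    qed (simp add: f_def)
  qed
  hence "0 = (\<Sum>T\<in>Pow {..<N}. (lower N f T)\<^sup>2) + ?c * (\<Sum>R\<in>Pow {..<N}. (f R)\<^sup>2)"
    using raise_norm[of N f] zero by (simp add: sum_distrib_left)
  moreover have "0 \<le> (\<Sum>T\<in>Pow {..<N}. (lower N f T)\<^sup>2)" by (simp add: sum_nonneg)
  moreover have "0 < (\<Sum>R\<in>Pow {..<N}. (f R)\<^sup>2)"
  proof -
    obtain S where S: "S \<in> ?P i" "f S \<noteq> 0" using f0(1) by (auto simp: f_def)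
    hence "S \<in> Pow {..<N}" by (auto simp: weight_subsets_def)
    thus ?thesis using S(2) by (intro sum_pos2[where i = S]) auto
  qed
  moreover have "0 < ?c" using assms by (metis diff_gt_0_iff_gt of_nat_less_iff of_nat_mult of_nat_numeral)
  ultimately show False by (smt (verit) mult_pos_pos)
qed

subsection \<open>Symmetric unimodal polynomials\<close>

text \<open>Coefficients with integer index, so that shifts and reflections need no case distinction
  at 0.\<close>

definition cf :: "int poly \<Rightarrow> int \<Rightarrow> int" where
  "cf f z = (if z < 0 then 0 else coeff f (nat z))"

text \<open>The centre of symmetry is \<open>D / 2\<close>; \<open>D\<close> may exceed the degree.
  The monotonicity clause compares any two indices whose midpoint is not beyond the centre, even if
  \<open>y\<close> is; this is the form in which multiplication by \<open>q_int m\<close> consumes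
  it.\<close>

definition sym_unimodal :: "int \<Rightarrow> int poly \<Rightarrow> bool" where
  "sym_unimodal D f \<longleftrightarrow> (\<forall>z. 0 \<le> cf f z) \<and> (\<forall>z. cf f (D - z) = cf f z) \<and>
     (\<forall>x y. x \<le> y \<and> x + y \<le> D \<longrightarrow> cf f x \<le> cf f y)"

lemma cf_of_nat [simp]: "cf f (int i) = coeff f i"
  by (simp add: cf_def)

lemma cf_0 [simp]: "cf 0 z = 0" and cf_add: "cf (f + g) z = cf f z + cf g z" and cf_smult: "cf (smult c f) z = c * cf f z"
  by (simp_all add: cf_def)

lemma cf_sum: "cf (\<Sum>x\<in>A. f x) z = (\<Sum>x\<in>A. cf (f x) z)"
  by (simp add: cf_def coeff_sum)

lemma cf_monom_mult: "cf (monom 1 j * f) z = cf f (z - int j)"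
  by (auto simp: cf_def coeff_monom_mult nat_diff_distrib nat_less_iff)

lemma cf_q_int_mult: "cf (q_int m * f) z = (\<Sum>l<m. cf f (z - int l))"
  by (simp add: q_int_def sum_distrib_right cf_sum cf_monom_mult)

text \<open>The coefficientwise form of \<open>(1 - q) [m] f = (1 - q^m) f\<close>.\<close>

lemma cf_q_int_mult_diff: "cf (q_int m * f) (z + 1) - cf (q_int m * f) z = cf f (z + 1) - cf f (z + 1 - int m)"
proof -
  have "cf (q_int m * f) (z + 1) - cf (q_int m * f) z = (\<Sum>l<m. cf f (z + 1 - int l) - cf f (z + 1 - int (Suc l)))"
    unfolding cf_q_int_mult sum_subtractf[symmetric] by simp
  also have "\<dots> = cf f (z + 1) - cf f (z + 1 - int m)"
    by (subst sum_lessThan_telescope') simp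
  finally show ?thesis .
qed

lemma sym_unimodalI:
  assumes nn: "\<And>z. 0 \<le> cf f z" and sym: "\<And>z. cf f (D - z) = cf f z"
    and step: "\<And>z. 2 * z + 1 \<le> D \<Longrightarrow> cf f z \<le> cf f (z + 1)"
  shows "sym_unimodal D f"
proof -
  have mono: "2 * y \<le> D + 1 \<longrightarrow> cf f x \<le> cf f y" if "x \<le> y" for x y
    using that
  proof (induction y rule: int_ge_induct)
    case (step y)
    then show ?case using assms(3)[of y] by auto
  qed simp
  have "cf f x \<le> cf f y" if "x \<le> y" "x + y \<le> D" for x y
  proof (cases "2 * y \<le> D + 1")
    case True
    then show ?thesis using mono[OF that(1)] by simp
  next
    case False
    then show ?thesis using mono[of x "D - y"] that sym[of y] by simp
  qed
  thus ?thesis using nn sym by (auto simp: sym_unimodal_def)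
qed

lemma sym_unimodal_0: "sym_unimodal D 0"
  by (simp add: sym_unimodal_def)

lemma sym_unimodal_add: "sym_unimodal D f \<Longrightarrow> sym_unimodal D g \<Longrightarrow> sym_unimodal D (f + g)"
  by (auto simp: sym_unimodal_def cf_add intro: add_mono)

lemma sym_unimodal_smult: "0 \<le> c \<Longrightarrow> sym_unimodal D f \<Longrightarrow> sym_unimodal D (smult c f)"
  by (auto simp: sym_unimodal_def cf_smult intro: mult_left_mono)

lemma sym_unimodal_sum: "(\<And>x. x \<in> A \<Longrightarrow> sym_unimodal D (f x)) \<Longrightarrow> sym_unimodal D (\<Sum>x\<in>A. f x)"
  by (induction A rule: infinite_finite_induct) (auto simp: sym_unimodal_0 sym_unimodal_add)

lemma sym_unimodal_monom_mult:
  assumes "sym_unimodal D f" shows "sym_unimodal (D + 2 * int j) (monom 1 j * f)"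
proof -
  have "cf f (D + 2 * int j - z - int j) = cf f (z - int j)" for z
  proof -
    have "D + 2 * int j - z - int j = D - (z - int j)" by simp
    thus ?thesis using assms unfolding sym_unimodal_def by metis
  qed
  thus ?thesis using assms by (auto simp: sym_unimodal_def cf_monom_mult)
qed

lemma sym_unimodal_q_int_mult:
  assumes f: "sym_unimodal D f" and m: "0 < m"
  shows "sym_unimodal (D + int m - 1) (q_int m * f)"
proof (rule sym_unimodalI)
  show "0 \<le> cf (q_int m * f) z" for z
    using f by (auto simp: cf_q_int_mult sym_unimodal_def intro: sum_nonneg)
  show "cf (q_int m * f) (D + int m - 1 - z) = cf (q_int m * f) z" for z
  proof -
    have "cf (q_int m * f) (D + int m - 1 - z) = (\<Sum>l<m. cf f (D + int m - 1 - z - int l))"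
      by (rule cf_q_int_mult)
    also have "\<dots> = (\<Sum>l<m. cf f (z - int (m - Suc l)))"
    proof (rule sum.cong[OF refl])
      fix l assume "l \<in> {..<m}"
      hence "D + int m - 1 - z - int l = D - (z - int (m - Suc l))" by (simp add: of_nat_diff)
      thus "cf f (D + int m - 1 - z - int l) = cf f (z - int (m - Suc l))"
        using f unfolding sym_unimodal_def by metis
    qed
    also have "\<dots> = cf (q_int m * f) z"
      unfolding cf_q_int_mult by (rule sum.nat_diff_reindex)
    finally show ?thesis .
  qed
  show "cf (q_int m * f) z \<le> cf (q_int m * f) (z + 1)" if "2 * z + 1 \<le> D + int m - 1" for z
  proof -
    have "cf f (z + 1 - int m) \<le> cf f (z + 1)"
      using f that unfolding sym_unimodal_def by (elim conjE allE[of _ "z + 1 - int m"] allE[of _ "z + 1"]) auto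
    thus ?thesis using cf_q_int_mult_diff[of m f z] by simp
  qed
qed

lemma coeff_q_int: "coeff (q_int m) i = (if i < m then 1 else 0)"
  by (simp add: q_int_def coeff_sum coeff_monom)

text \<open>The blocks \<open>q^j [e + 1 - 2 j]\<close> are the intervals of ones centred at
  \<open>e / 2\<close>. By unimodality the coefficients, the increments of \<open>g\<close> up to
  the centre, are nonnegative, so products reduce to multiplication by single
  \<open>q_int\<close>.\<close>

lemma sym_unimodal_decomp:
  assumes g: "sym_unimodal (int e) g"
  shows "g = (\<Sum>j\<le>e div 2. smult (cf g (int j) - cf g (int j - 1)) (monom 1 j * q_int (e + 1 - 2 * j)))"
proof (rule poly_eqI)
  fix i
  let ?c = "\<lambda>j. cf g (int j) - cf g (int j - 1)"
  have sym: "cf g (int e - z) = cf g z" for z using g by (simp add: sym_unimodal_def)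
  have "coeff (\<Sum>j\<le>e div 2. smult (?c j) (monom 1 j * q_int (e + 1 - 2 * j))) i
      = (\<Sum>j\<le>e div 2. if j \<le> i \<and> i + j \<le> e then ?c j else 0)"
    unfolding coeff_sum by (rule sum.cong) (auto simp: coeff_monom_mult coeff_q_int)
  also have "\<dots> = coeff g i"
  proof (cases "i \<le> e")
    case True
    \<comment> \<open>The centred interval starting at \<open>j\<close> contains \<open>i\<close>
      exactly for \<open>j\<close> up to \<open>t\<close>, so the increments telescope to the value
      at \<open>t\<close>, the mirror image of \<open>i\<close> or \<open>i\<close> itself.\<close>
    define t where "t = min i (e - i)"
    have "(\<Sum>j\<le>e div 2. if j \<le> i \<and> i + j \<le> e then ?c j else 0) = (\<Sum>j\<le>t. ?c j)"
      using True by (intro sum.mono_neutral_cong_right) (auto simp: t_def)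
    also have "\<dots> = cf g (int t)"
    proof (induction t)
      case 0
      then show ?case by (simp add: cf_def)
    next
      case (Suc t)
      have "int (Suc t) - 1 = int t" by simp
      then show ?case using Suc unfolding sum.atMost_Suc by simp
    qed
    also have "\<dots> = coeff g i"
      using sym[of "int i"] True by (auto simp: t_def min_def of_nat_diff simp flip: cf_of_nat)
    finally show ?thesis .
  next
    case False
    have "coeff g i = cf g (int e - int i)" using sym[of "int i"] by simp
    also have "\<dots> = 0" using False by (simp add: cf_def)
    finally show ?thesis using False by (simp add: sum.neutral)
  qed
  finally show "coeff g i = coeff (\<Sum>j\<le>e div 2. smult (?c j) (monom 1 j * q_int (e + 1 - 2 * j))) i" by simp
qed

lemma sym_unimodal_mult:
  assumes f: "sym_unimodal D f" and g: "sym_unimodal (int e) g"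
  shows "sym_unimodal (D + int e) (f * g)"
proof -
  let ?c = "\<lambda>j. cf g (int j) - cf g (int j - 1)"
  have "f * g = (\<Sum>j\<le>e div 2. smult (?c j) (monom 1 j * (q_int (e + 1 - 2 * j) * f)))"
    by (subst sym_unimodal_decomp[OF g]) (simp add: sum_distrib_left mult_ac)
  moreover have "sym_unimodal (D + int e) (smult (?c j) (monom 1 j * (q_int (e + 1 - 2 * j) * f)))" if "j \<le> e div 2" for j
  proof (rule sym_unimodal_smult)
    have "int j - 1 \<le> int j \<and> int j - 1 + int j \<le> int e" using that by linarith
    thus "0 \<le> ?c j" using g unfolding sym_unimodal_def by (metis diff_ge_0_iff_ge)
    have "sym_unimodal (D + int (e + 1 - 2 * j) - 1 + 2 * int j) (monom 1 j * (q_int (e + 1 - 2 * j) * f))"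
      using that by (intro sym_unimodal_monom_mult sym_unimodal_q_int_mult f) auto
    moreover have "D + int (e + 1 - 2 * j) - 1 + 2 * int j = D + int e" using that by linarith
    ultimately show "sym_unimodal (D + int e) (monom 1 j * (q_int (e + 1 - 2 * j) * f))" by simp
  qed
  ultimately show ?thesis by (metis (mono_tags, lifting) atMost_iff sym_unimodal_sum)
qed

text \<open>If \<open>f\<close> is symmetric unimodal then the first half of the coefficients of \<open>(1 - q) f\<close> is
  nonnegative, hence so is the first half of the symmetric quotient by \<open>1 - q\<^sup>b\<close>.\<close>

lemma sym_unimodal_quotient_nonneg:
  assumes f: "sym_unimodal D f" and h: "f = q_int b * h" and b: "0 < b"
  shows "0 \<le> coeff h i"
proof -
  \<comment> \<open>Twice the centre of symmetry that the quotient must have, since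
    \<open>[b]\<close> is symmetric about \<open>(b - 1) / 2\<close>.\<close>
  define E where "E = D - int b + 1"
  have sym: "cf f (D - z) = cf f z" for z using f by (simp add: sym_unimodal_def)
  have diff: "cf f (z + 1) - cf f z = cf h (z + 1) - cf h (z + 1 - int b)" for z
    using cf_q_int_mult_diff[of b h z] h by simp
  \<comment> \<open>The defect of symmetry of \<open>h\<close> is periodic with period
    \<open>b\<close>. It vanishes far outside the support of \<open>h\<close>, hence
    everywhere.\<close>
  have per: "cf h (E - z) - cf h z = cf h (E - (z - int b)) - cf h (z - int b)" for z
  proof -
    have "cf h (E - (z - int b)) - cf h (E - z) = cf f (D - z + 1) - cf f (D - z)"
      using diff[of "D - z"] by (simp add: E_def algebra_simps)
    also have "\<dots> = cf f (z - 1) - cf f z" using sym[of "z - 1"] sym[of z] by (simp add: algebra_simps)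
    also have "\<dots> = cf h (z - int b) - cf h z" using diff[of "z - 1"] by simp
    finally show ?thesis by simp
  qed
  have per_mult: "cf h (E - z) - cf h z = cf h (E - (z - int k * int b)) - cf h (z - int k * int b)" for z k
  proof (induction k)
    case (Suc k)
    then show ?case using per[of "z - int k * int b"] by (simp add: algebra_simps)
  qed simp
  have h_sym: "cf h (E - z) = cf h z" for z
  proof -
    define k where "k = nat (\<bar>z\<bar> + \<bar>E\<bar> + int (degree h) + 1)"
    have "int k * 1 \<le> int k * int b" using b by (intro mult_left_mono) auto
    hence k: "\<bar>z\<bar> + \<bar>E\<bar> + int (degree h) + 1 \<le> int k * int b" by (simp add: k_def)
    have "cf h (z - int k * int b) = 0" using k by (simp add: cf_def)
    moreover have "cf h (E - (z - int k * int b)) = 0"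
      using k by (auto simp: cf_def intro!: coeff_eq_0)
    ultimately show ?thesis using per_mult[of z k] by simp
  qed
  \<comment> \<open>Below the centre \<open>f\<close> does not decrease, so \<open>h\<close> does
    not decrease along steps of \<open>b\<close>, starting from the value 0 at negative
    indices.\<close>
  have low: "0 \<le> cf h (int t)" if "2 * int t \<le> E" for t
    using that
  proof (induction t rule: less_induct)
    case (less t)
    have "cf f (int t - 1) \<le> cf f (int t)"
      using f less.prems b unfolding sym_unimodal_def E_def
      by (elim conjE allE[of _ "int t - 1"] allE[of _ "int t"]) auto
    hence "cf h (int t - int b) \<le> cf h (int t)" using diff[of "int t - 1"] by simp
    moreover have "0 \<le> cf h (int t - int b)"
    proof (cases "b \<le> t")
      case True
      then show ?thesis using less.IH[of "t - b"] less.prems b by (simp add: of_nat_diff del: cf_of_nat)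
    qed (simp add: cf_def)
    ultimately show ?case by simp
  qed
  have low': "0 \<le> cf h z" if "2 * z \<le> E" for z
    using low[of "nat z"] that by (cases "z < 0") (auto simp: cf_def)
  show ?thesis
    using low'[of "int i"] low'[of "E - int i"] h_sym[of "int i"] by (cases "2 * int i \<le> E") auto
qed

subsection \<open>Gaussian coefficients\<close>

text \<open>The Gaussian coefficient times \<open>q^(k (k - 1) / 2)\<close>. In this shifted form
  its coefficients count subsets by their sum, which is what \<open>weight_subsets_mono\<close>
  compares.\<close>

definition subset_poly :: "nat \<Rightarrow> nat \<Rightarrow> int poly" where
  "subset_poly N k = (\<Sum>S | S \<subseteq> {..<N} \<and> card S = k. monom 1 (\<Sum>S))"

lemma finite_card_subsets [simp]: "finite {S. S \<subseteq> {..<N :: nat} \<and> card S = k}"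
  by (rule finite_subset[of _ "Pow {..<N}"]) auto

lemma coeff_subset_poly: "coeff (subset_poly N k) i = int (card (weight_subsets N k i))"
proof -
  have "coeff (subset_poly N k) i = (\<Sum>S | S \<subseteq> {..<N} \<and> card S = k. if \<Sum>S = i then 1 else 0)"
    by (simp add: subset_poly_def coeff_sum coeff_monom)
  also have "\<dots> = (\<Sum>S\<in>weight_subsets N k i. 1)"
    by (rule sum.mono_neutral_cong_right) (auto simp: weight_subsets_def)
  finally show ?thesis by simp
qed

text \<open>Reflecting \<open>{..<N}\<close> by \<open>x\<close> to \<open>N - 1 - x\<close>
  replaces the sum \<open>i\<close> by \<open>k (N - 1) - i\<close>.\<close>

lemma card_weight_subsets_sym:
  assumes "i \<le> k * (N - 1)"
  shows "card (weight_subsets N k (k * (N - 1) - i)) = card (weight_subsets N k i)"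
proof -
  have refl_sum: "\<Sum>((\<lambda>x. N - 1 - x) ` S) + \<Sum>S = card S * (N - 1)" and refl_card: "card ((\<lambda>x. N - 1 - x) ` S) = card S"
    and refl_refl: "(\<lambda>x. N - 1 - x) ` (\<lambda>x. N - 1 - x) ` S = S"
    if "S \<subseteq> {..<N}" for S
  proof -
    have inj: "inj_on (\<lambda>x. N - 1 - x) S" 
    proof (rule inj_onI)
      fix x y assume xy: "x \<in> S" "y \<in> S" "N - 1 - x = N - 1 - y"
      hence "x < N" "y < N" using that by auto
      thus "x = y" using xy(3) by linarith
    qed
    have "\<Sum>((\<lambda>x. N - 1 - x) ` S) + \<Sum>S = (\<Sum>x\<in>S. (N - 1 - x) + x)"
      using inj by (simp add: sum.reindex sum.distrib)
    also have "\<dots> = (\<Sum>x\<in>S. N - 1)" by (rule sum.cong) (use that in auto)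
    finally show "\<Sum>((\<lambda>x. N - 1 - x) ` S) + \<Sum>S = card S * (N - 1)" by simp
    show "card ((\<lambda>x. N - 1 - x) ` S) = card S" by (rule card_image[OF inj])
    have "(\<lambda>x. N - 1 - (N - 1 - x)) ` S = (\<lambda>x. x) ` S" by (rule image_cong) (use that in auto)
    thus "(\<lambda>x. N - 1 - x) ` (\<lambda>x. N - 1 - x) ` S = S" by (simp add: image_image)
  qed
  have mem: "(\<lambda>x. N - 1 - x) ` S \<in> weight_subsets N k (k * (N - 1) - j)" if "S \<in> weight_subsets N k j" for S j
  proof -
    have S: "S \<subseteq> {..<N}" "card S = k" "\<Sum>S = j" using that by (auto simp: weight_subsets_def)
    have "(\<lambda>x. N - 1 - x) ` S \<subseteq> {..<N}" using S(1) by auto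
    thus ?thesis using S refl_sum[OF S(1)] refl_card[OF S(1)] by (auto simp: weight_subsets_def)
  qed
  have "bij_betw (\<lambda>S. (\<lambda>x. N - 1 - x) ` S) (weight_subsets N k (k * (N - 1) - i)) (weight_subsets N k i)"
  proof (rule bij_betwI[where g = "\<lambda>S. (\<lambda>x. N - 1 - x) ` S"])
    show "(\<lambda>S. (\<lambda>x. N - 1 - x) ` S) \<in> weight_subsets N k (k * (N - 1) - i) \<rightarrow> weight_subsets N k i"
      using mem[of _ "k * (N - 1) - i"] assms by auto
    show "(\<lambda>S. (\<lambda>x. N - 1 - x) ` S) \<in> weight_subsets N k i \<rightarrow> weight_subsets N k (k * (N - 1) - i)"
      using mem[of _ i] by auto
    show "(\<lambda>x. N - 1 - x) ` (\<lambda>x. N - 1 - x) ` S = S" if "S \<in> weight_subsets N k j" for S j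
      using that by (intro refl_refl) (simp add: weight_subsets_def)
    thus "(\<lambda>x. N - 1 - x) ` (\<lambda>x. N - 1 - x) ` S = S" if "S \<in> weight_subsets N k i" for S using that by blast
  qed
  thus ?thesis by (rule bij_betw_same_card)
qed

lemma sym_unimodal_subset_poly: "sym_unimodal (int (k * (N - 1))) (subset_poly N k)"
proof (rule sym_unimodalI)
  show "0 \<le> cf (subset_poly N k) z" for z by (simp add: cf_def coeff_subset_poly)
  have big: "coeff (subset_poly N k) i = 0" if "k * (N - 1) < i" for i
  proof -
    have le: "\<Sum>S \<le> k * (N - 1)" if S: "S \<subseteq> {..<N}" "card S = k" for S
    proof -
      have "\<Sum>S \<le> of_nat (card S) * (N - 1)" by (rule sum_bounded_above) (use S in auto)
      thus ?thesis using S by simp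
    qed
    have "S \<notin> weight_subsets N k i" for S using le[of S] that unfolding weight_subsets_def by (metis (mono_tags, lifting) leD mem_Collect_eq)
    hence "weight_subsets N k i = {}" by blast
    thus ?thesis by (simp add: coeff_subset_poly)
  qed
  show "cf (subset_poly N k) (int (k * (N - 1)) - z) = cf (subset_poly N k) z" for z
  proof -
    consider "z < 0" | "z > int (k * (N - 1))" | "0 \<le> z" "z \<le> int (k * (N - 1))" by linarith
    thus ?thesis
    proof cases
      case 1
      hence "k * (N - 1) < nat (int (k * (N - 1)) - z)" by linarith
      then show ?thesis using 1 big by (simp add: cf_def)
    next
      case 2
      hence "k * (N - 1) < nat z" by linarith
      then show ?thesis using 2 big by (simp add: cf_def)
    next
      case 3
      define i where "i = nat z"
      have i: "z = int i" "i \<le> k * (N - 1)" using 3 by (simp_all only: i_def nat_le_iff int_nat_eq if_True)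
      hence "int (k * (N - 1)) - z = int (k * (N - 1) - i)" by (simp only: of_nat_diff)
      then show ?thesis using i by (simp only: cf_of_nat coeff_subset_poly card_weight_subsets_sym)
    qed
  qed
  show "cf (subset_poly N k) z \<le> cf (subset_poly N k) (z + 1)" if "2 * z + 1 \<le> int (k * (N - 1))" for z
  proof (cases "z < 0")
    case True
    then show ?thesis by (simp add: cf_def coeff_subset_poly)
  next
    case False
    define i where "i = nat z"
    have z: "z = int i" "z + 1 = int (Suc i)" using False by (auto simp: i_def)
    have "2 * i < k * (N - 1)" using that unfolding z by linarith
    then show ?thesis using weight_subsets_mono[of i k N] unfolding z(2) unfolding z(1) cf_of_nat coeff_subset_poly by simp
  qed
qed

text \<open>The \<open>q\<close>-Pascal rule in the version that matches splitting subsets of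
  \<open>{..<Suc N}\<close> by whether they contain \<open>N\<close>.\<close>

fun qbin :: "nat \<Rightarrow> nat \<Rightarrow> int poly" where
  "qbin N 0 = 1"
| "qbin 0 (Suc k) = 0"
| "qbin (Suc N) (Suc k) = qbin N (Suc k) + monom 1 (N - k) * qbin N k"

lemma qbin_eq_0: "N < k \<Longrightarrow> qbin N k = 0"
  by (induction N k rule: qbin.induct) auto

lemma subset_poly_0: "subset_poly N 0 = 1"
proof -
  have "{S. S \<subseteq> {..<N} \<and> card S = 0} = {{}}" using finite_subset[of _ "{..<N}"] by auto
  thus ?thesis by (simp add: subset_poly_def)
qed

lemma subset_poly_Suc: "subset_poly (Suc N) (Suc k) = subset_poly N (Suc k) + monom 1 N * subset_poly N k"
proof -
  let ?A = "{S. S \<subseteq> {..<N} \<and> card S = Suc k}" and ?B = "{S. S \<subseteq> {..<N} \<and> card S = k}"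
  have "{S. S \<subseteq> {..<Suc N} \<and> card S = Suc k} = ?A \<union> insert N ` ?B"
  proof (intro equalityI subsetI)
    fix S assume S: "S \<in> {S. S \<subseteq> {..<Suc N} \<and> card S = Suc k}"
    hence "finite S" using finite_subset by blast
    show "S \<in> ?A \<union> insert N ` ?B"
    proof (cases "N \<in> S")
      case True
      hence "S = insert N (S - {N})" "S - {N} \<subseteq> {..<N}" "card (S - {N}) = k"
        using S \<open>finite S\<close> by (auto simp: less_Suc_eq)
      then show ?thesis by blast
    next
      case False
      then show ?thesis using S by (auto simp: less_Suc_eq)
    qed
  next
    fix S assume "S \<in> ?A \<union> insert N ` ?B"
    then show "S \<in> {S. S \<subseteq> {..<Suc N} \<and> card S = Suc k}"
    proof
      assume "S \<in> insert N ` ?B"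
      then obtain T where T: "S = insert N T" "T \<subseteq> {..<N}" "card T = k" by auto
      have "finite T" "N \<notin> T" using T(2) finite_subset by auto
      then show ?thesis using T by auto
    qed auto
  qed
  moreover have "?A \<inter> insert N ` ?B = {}" by auto
  ultimately have "subset_poly (Suc N) (Suc k) = subset_poly N (Suc k) + (\<Sum>S\<in>insert N ` ?B. monom 1 (\<Sum>S))"
    unfolding subset_poly_def by (simp add: sum.union_disjoint)
  also have "(\<Sum>S\<in>insert N ` ?B. monom 1 (\<Sum>S)) = (\<Sum>S\<in>?B. monom 1 (\<Sum>(insert N S)))"
  proof (rule sum.reindex_cong[OF _ refl])
    show "inj_on (insert N) ?B"
    proof (rule inj_onI)
      fix S T assume "S \<in> ?B" "T \<in> ?B" "insert N S = insert N T"
      moreover have "N \<notin> S" "N \<notin> T" using \<open>S \<in> ?B\<close> \<open>T \<in> ?B\<close> by auto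
      ultimately show "S = T" by (metis insert_ident)
    qed
  qed simp
  also have "\<dots> = (\<Sum>S\<in>?B. monom 1 N * monom (1::int) (\<Sum>S))"
  proof (rule sum.cong[OF refl])
    fix S assume "S \<in> ?B"
    hence "finite S" "N \<notin> S" using finite_subset by auto
    thus "monom 1 (\<Sum>(insert N S)) = monom 1 N * monom (1::int) (\<Sum>S)" by (simp add: mult_monom)
  qed
  finally show ?thesis by (simp add: subset_poly_def sum_distrib_left)
qed

lemma subset_poly_qbin: "subset_poly N k = monom 1 (\<Sum>{..<k}) * qbin N k"
proof (induction N k rule: qbin.induct)
  case (1 N)
  then show ?case by (simp add: subset_poly_0)
next
  case (2 k)
  have "{S. S \<subseteq> {..<0::nat} \<and> card S = Suc k} = {}" by auto
  then show ?case by (simp only: subset_poly_def sum.empty qbin.simps mult_zero_right)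
next
  case (3 N k)
  have "monom 1 N * (monom 1 (\<Sum>{..<k}) * qbin N k) = monom 1 (\<Sum>{..<Suc k}) * (monom 1 (N - k) * qbin N k)"
  proof (cases "k \<le> N")
    case True
    have "N + \<Sum>{..<k} = \<Sum>{..<Suc k} + (N - k)" using True by (simp add: lessThan_Suc)
    hence "monom 1 N * monom 1 (\<Sum>{..<k}) = monom 1 (\<Sum>{..<Suc k}) * monom (1::int) (N - k)"
      by (simp only: mult_monom mult_1)
    then show ?thesis by (simp only: mult.assoc[symmetric])
  qed (simp add: qbin_eq_0)
  then show ?case unfolding subset_poly_Suc 3 qbin.simps distrib_left by (simp only:)
qed

section \<open>\<open>q\<close>-factorials and the \<open>q\<close>-multinomial quotient\<close>

lemma q_int_add: "q_int (m + k) = q_int m + monom 1 m * q_int k"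
  by (rule poly_eqI) (auto simp: coeff_q_int coeff_monom_mult)

lemma q_fact_0 [simp]: "q_fact 0 = 1" and q_fact_Suc: "q_fact (Suc m) = q_fact m * q_int (Suc m)"
  by (simp_all add: q_fact_def)

text \<open>After clearing denominators the recursion becomes
  \<open>[N - k] + q^(N - k) [k + 1] = [N + 1]\<close>.\<close>

lemma q_fact_qbin: "k \<le> N \<Longrightarrow> q_fact N = qbin N k * q_fact k * q_fact (N - k)"
proof (induction N k rule: qbin.induct)
  case (3 N k)
  have k: "k \<le> N" using 3 by simp
  have 1: "qbin N (Suc k) * q_fact (Suc k) * q_fact (N - k) = q_fact N * q_int (N - k)"
  proof (cases "k = N")
    case True
    then show ?thesis by (simp add: qbin_eq_0 q_int_def)
  next
    case False
    hence "N - k = Suc (N - Suc k)" "Suc k \<le> N" using k by auto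
    hence "q_fact N = qbin N (Suc k) * q_fact (Suc k) * q_fact (N - Suc k)" using 3 by blast
    moreover have "q_fact (N - k) = q_fact (N - Suc k) * q_int (N - k)"
      using q_fact_Suc[of "N - Suc k"] \<open>N - k = Suc (N - Suc k)\<close> by simp
    ultimately show ?thesis by (simp only: mult_ac)
  qed
  have 2: "qbin N k * q_fact (Suc k) * q_fact (N - k) = q_fact N * q_int (Suc k)"
    unfolding 3(2)[OF k] by (simp only: q_fact_Suc mult_ac)
  have "qbin (Suc N) (Suc k) * q_fact (Suc k) * q_fact (Suc N - Suc k)
      = q_fact N * q_int (N - k) + monom 1 (N - k) * (q_fact N * q_int (Suc k))"
    using 1 2 by (simp add: algebra_simps)
  also have "\<dots> = q_fact N * q_int ((N - k) + Suc k)" unfolding q_int_add by (simp add: algebra_simps)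
  also have "(N - k) + Suc k = Suc N" using k by simp
  finally show ?case by (simp add: q_fact_Suc)
qed auto

text \<open>Splitting off one \<open>r x\<close> at a time writes \<open>M\<close> as a product of
  Gaussian coefficients. The factor \<open>q^s\<close> collects the shifts that turn them into
  \<open>subset_poly\<close>.\<close>

lemma q_multinomial:
  assumes "finite I" "sum r I \<le> N"
  shows "\<exists>M s e. q_fact N = M * ((\<Prod>i\<in>I. q_fact (r i)) * q_fact (N - sum r I)) \<and>
    sym_unimodal (int e) (monom 1 s * M)"
  using assms
proof (induction I rule: finite_induct)
  case empty
  have "sym_unimodal 0 (1 :: int poly)" by (rule sym_unimodalI) (auto simp: cf_def)
  thus ?case by (intro exI[of _ 1] exI[of _ "0::nat"]) auto
next
  case (insert x I)
  then obtain M s e where M: "q_fact N = M * ((\<Prod>i\<in>I. q_fact (r i)) * q_fact (N - sum r I))"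
    "sym_unimodal (int e) (monom 1 s * M)" by auto
  let ?L = "N - sum r I"
  have le: "r x \<le> ?L" using insert by simp
  have "q_fact ?L = qbin ?L (r x) * q_fact (r x) * q_fact (?L - r x)" by (rule q_fact_qbin[OF le])
  moreover have "?L - r x = N - sum r (insert x I)" using insert by simp
  ultimately have eq: "q_fact N = (M * qbin ?L (r x)) * ((\<Prod>i\<in>insert x I. q_fact (r i)) * q_fact (N - sum r (insert x I)))"
    using M(1) insert by (simp add: mult_ac)
  have "sym_unimodal (int e + int (r x * (?L - 1))) ((monom 1 s * M) * subset_poly ?L (r x))"
    by (rule sym_unimodal_mult[OF M(2) sym_unimodal_subset_poly])
  moreover have "(monom 1 s * M) * subset_poly ?L (r x) = monom 1 (s + \<Sum>{..<r x}) * (M * qbin ?L (r x))"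
    using mult_monom[of "1::int" s 1 "\<Sum>{..<r x}"] by (simp add: subset_poly_qbin mult_ac)
  ultimately have "sym_unimodal (int (e + r x * (?L - 1))) (monom 1 (s + \<Sum>{..<r x}) * (M * qbin ?L (r x)))" by simp
  with eq show ?case by blast
qed

lemma q_int_neq_0: "0 < m \<Longrightarrow> q_int m \<noteq> 0"
  using coeff_q_int[of m 0] by (metis coeff_0 zero_neq_one)

lemma q_fact_neq_0: "q_fact m \<noteq> 0"
  by (auto simp: q_fact_def q_int_neq_0)

text \<open>The numbers \<open>m\<close> for which \<open>[b]\<close> divides \<open>[m] M\<close>
  are closed under addition. They contain \<open>b\<close> and every \<open>r x\<close>, hence the
  coprime numbers \<open>b\<close> and \<open>\<Sum>i\<in>I. c i * r i\<close>, and by Bezout also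
  1; so \<open>[b]\<close> divides \<open>M\<close> itself.\<close>

lemma q_kreweras_polynomial:
  assumes "finite I" and sum_b: "sum r I \<le> b" and "0 < b" and cop: "coprime (\<Sum>i\<in>I. c i * r i) b"
    and pos: "0 < (\<Sum>i\<in>I. c i * r i)"
  shows "\<exists>p. p * ((\<Prod>i\<in>I. q_fact (r i)) * q_fact (b - sum r I)) = q_fact (b - 1) \<and> (\<forall>i. 0 \<le> coeff p i)"
proof -
  let ?Den = "(\<Prod>i\<in>I. q_fact (r i)) * q_fact (b - sum r I)"
  obtain M s e where M: "q_fact b = M * ?Den" and su: "sym_unimodal (int e) (monom 1 s * M)"
    using q_multinomial[OF assms(1,2)] by blast
  have fb: "q_fact b = q_int b * q_fact (b - 1)" using q_fact_Suc[of "b - 1"] \<open>0 < b\<close> by simp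
  have nz: "?Den \<noteq> 0" using assms(1) by (simp add: q_fact_neq_0)
  define dv where "dv m \<longleftrightarrow> q_int b dvd q_int m * M" for m
  have dv_add: "dv (m + k)" if "dv m" "dv k" for m k
    using that unfolding dv_def q_int_add distrib_right by (intro dvd_add) (auto simp: mult.assoc)
  have dv_0: "dv 0" by (simp add: dv_def q_int_def)
  have dv_mult: "dv (k * m)" if "dv m" for k m
    by (induction k) (auto simp: dv_0 dv_add that)
  have dv_r: "dv (r x)" if x: "x \<in> I" for x
  proof (cases "r x = 0")
    case True
    then show ?thesis by (simp add: dv_0)
  next
    case False
    \<comment> \<open>\<open>[r x] M\<close> equals \<open>[b]\<close> times the multinomial
      coefficient of \<open>b - 1\<close> in which one letter \<open>x\<close> has been
      removed.\<close>
    define r' where "r' = r(x := r x - 1)"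
    have sr: "sum r I = r x + sum r (I - {x})" "sum r' I = (r x - 1) + sum r' (I - {x})"
      using assms(1) x by (auto simp: sum.remove r'_def)
    have "sum r' (I - {x}) = sum r (I - {x})" by (rule sum.cong) (auto simp: r'_def)
    hence s': "sum r' I = sum r I - 1" "0 < sum r I" using sr False by auto
    have le': "sum r' I \<le> b - 1" using s' sum_b by linarith
    obtain M' where M': "q_fact (b - 1) = M' * ((\<Prod>i\<in>I. q_fact (r' i)) * q_fact (b - 1 - sum r' I))"
      using q_multinomial[OF assms(1) le'] by blast
    have e: "b - 1 - sum r' I = b - sum r I" using s' by simp
    have "(\<Prod>i\<in>I. q_fact (r i)) = q_fact (r x) * (\<Prod>i\<in>I - {x}. q_fact (r i))"
      "(\<Prod>i\<in>I. q_fact (r' i)) = q_fact (r x - 1) * (\<Prod>i\<in>I - {x}. q_fact (r' i))"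
      using assms(1) x by (auto simp: prod.remove r'_def)
    moreover have "(\<Prod>i\<in>I - {x}. q_fact (r' i)) = (\<Prod>i\<in>I - {x}. q_fact (r i))" by (rule prod.cong) (auto simp: r'_def)
    moreover have "q_fact (r x) = q_fact (r x - 1) * q_int (r x)" using q_fact_Suc[of "r x - 1"] False by simp
    ultimately have den: "(\<Prod>i\<in>I. q_fact (r i)) = q_int (r x) * (\<Prod>i\<in>I. q_fact (r' i))" by (simp add: mult_ac)
    let ?Den' = "(\<Prod>i\<in>I. q_fact (r' i)) * q_fact (b - sum r I)"
    have "(q_int (r x) * M) * ?Den' = (q_int b * M') * ?Den'"
    proof -
      have "(q_int (r x) * M) * ?Den' = M * ?Den" unfolding den by (simp only: mult_ac)
      also have "\<dots> = q_int b * q_fact (b - 1)" using M fb by simp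
      also have "\<dots> = (q_int b * M') * ?Den'" using M' unfolding e by (simp only: mult_ac)
      finally show ?thesis .
    qed
    moreover have "?Den' \<noteq> 0" using assms(1) by (simp add: q_fact_neq_0)
    ultimately have "q_int (r x) * M = q_int b * M'" using mult_right_cancel by blast
    thus ?thesis by (simp add: dv_def)
  qed
  have "dv (\<Sum>i\<in>J. c i * r i)" if "J \<subseteq> I" "finite J" for J
    using that(2,1) by (induction J rule: finite_induct) (auto simp: dv_0 dv_add dv_mult dv_r)
  hence dv_a: "dv (\<Sum>i\<in>I. c i * r i)" using assms(1) by blast
  have dv_b: "dv b" by (simp add: dv_def)
  obtain x y where xy: "(\<Sum>i\<in>I. c i * r i) * x = b * y + 1"
    using bezout_add_strong_nat[of "\<Sum>i\<in>I. c i * r i" b] cop pos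
    by (metis coprime_iff_gcd_eq_1 gcd_unique_nat not_gr_zero bot_nat_0.not_eq_extremum gcd_greatest nat_dvd_1_iff_1)
  \<comment> \<open>Since \<open>[1 + y b] = [1] + q [y b]\<close>, divisibility for
    \<open>1 + y b\<close> and for \<open>y b\<close> leaves divisibility for 1.\<close>
  have "dv (1 + y * b)" using dv_mult[OF dv_a, of x] xy by (simp add: mult.commute add.commute)
  moreover have "dv (y * b)" by (rule dv_mult[OF dv_b])
  ultimately have "q_int b dvd q_int 1 * M + monom 1 1 * (q_int (y * b) * M)" "q_int b dvd monom 1 1 * (q_int (y * b) * M)"
    unfolding dv_def q_int_add distrib_right mult.assoc by auto
  hence "q_int b dvd q_int 1 * M" using dvd_add_left_iff by blast
  moreover have "q_int 1 = 1" by (simp add: q_int_def)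
  ultimately obtain p where p: "M = q_int b * p" by auto
  have "q_int b * (p * ?Den) = M * ?Den" unfolding p by (simp only: mult.assoc)
  hence "q_int b * (p * ?Den) = q_int b * q_fact (b - 1)" using M fb by simp
  hence eq: "p * ?Den = q_fact (b - 1)" using q_int_neq_0[OF \<open>0 < b\<close>] mult_left_cancel by blast
  have "0 \<le> coeff (monom 1 s * p) (i + s)" for i
    by (rule sym_unimodal_quotient_nonneg[OF su _ \<open>0 < b\<close>]) (simp add: p mult_ac)
  hence "0 \<le> coeff p i" for i by (simp add: coeff_monom_mult)
  with eq show ?thesis by blast
qed

subsection \<open>Values at roots of unity\<close>

definition ev :: "complex \<Rightarrow> int poly \<Rightarrow> complex" where
  "ev w p = poly (map_poly of_int p) w"

lemma ev_mult [simp]: "ev w (p * q) = ev w p * ev w q"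
proof -
  have "map_poly (of_int :: int \<Rightarrow> complex) (p * q) = map_poly of_int p * map_poly of_int q"
    by (rule poly_eqI) (simp add: coeff_map_poly coeff_mult)
  thus ?thesis by (simp add: ev_def)
qed

lemma ev_add [simp]: "ev w (p + q) = ev w p + ev w q"
proof -
  have "map_poly (of_int :: int \<Rightarrow> complex) (p + q) = map_poly of_int p + map_poly of_int q"
    by (rule poly_eqI) (simp add: coeff_map_poly)
  thus ?thesis by (simp add: ev_def)
qed

lemma ev_0 [simp]: "ev w 0 = 0" and ev_1 [simp]: "ev w 1 = 1"
  by (simp_all add: ev_def)

lemma ev_monom [simp]: "ev w (monom 1 i) = w ^ i"
  by (simp add: ev_def map_poly_monom poly_monom)

lemma ev_sum: "ev w (\<Sum>x\<in>A. f x) = (\<Sum>x\<in>A. ev w (f x))"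
  by (induction A rule: infinite_finite_induct) auto

lemma ev_prod: "ev w (\<Prod>x\<in>A. f x) = (\<Prod>x\<in>A. ev w (f x))"
  by (induction A rule: infinite_finite_induct) auto

lemma ev_power [simp]: "ev w (p ^ k) = ev w p ^ k"
  by (induction k) auto

lemma ev_q_int: "ev w (q_int m) = (\<Sum>i<m. w ^ i)"
  by (simp add: q_int_def ev_sum)

lemma ev_q_fact_1: "ev 1 (q_fact m) = fact m"
  by (induction m) (simp_all add: q_fact_Suc ev_q_int)

lemma ev_q_int_eq_0_iff:
  assumes "w \<noteq> 1" shows "ev w (q_int m) = 0 \<longleftrightarrow> w ^ m = 1"
  using assms by (simp add: ev_q_int sum_gp_strict)

text \<open>Only the factors \<open>[d j]\<close> of the factorial vanish at \<open>w\<close>. Each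
  is \<open>[d]\<close> times a sum of powers of \<open>q^d\<close> with value \<open>j\<close> at
  \<open>w\<close>, and the value of any other factor depends on its index modulo \<open>d\<close>
  alone. So all zeros sit in the power of \<open>[d]\<close>.\<close>

lemma q_fact_root_of_unity:
  assumes d: "2 \<le> d" and w: "primitive_root_of_unity d w"
  shows "\<exists>G. q_fact N = q_int d ^ (N div d) * G \<and>
    ev w G = fact (N div d) * (\<Prod>l=1..<d. ev w (q_int l)) ^ (N div d) * (\<Prod>l=1..N mod d. ev w (q_int l))"
proof (induction N)
  case 0
  then show ?case by (intro exI[of _ 1]) auto
next
  case (Suc N)
  let ?u = "\<Prod>l=1..<d. ev w (q_int l)"
  have wd: "w ^ d = 1" and w1: "w \<noteq> 1"
    using w d unfolding primitive_root_of_unity_def by (auto dest: spec[of _ 1])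
  obtain G where G: "q_fact N = q_int d ^ (N div d) * G"
    "ev w G = fact (N div d) * ?u ^ (N div d) * (\<Prod>l=1..N mod d. ev w (q_int l))" using Suc by blast
  show ?case
  proof (cases "Suc N mod d = 0")
    case True
    define j where "j = N div d"
    have j: "N div d = j" "N mod d = d - 1" "Suc N div d = Suc j"
      using True d by (auto simp: j_def mod_Suc div_Suc split: if_splits)
    have SN: "Suc N = d * Suc j" using True j(3) div_mult_mod_eq[of "Suc N" d] by (simp only: mult.commute add_0_right)
    define B where "B = (\<Sum>i<Suc j. monom (1::int) (d * i))"
    have "q_int (d * k) = q_int d * (\<Sum>i<k. monom 1 (d * i))" for k
    proof (induction k)
      case 0
      show ?case by (simp add: q_int_def)
    next
      case (Suc k)
      have "q_int (d * Suc k) = q_int (d * k) + monom 1 (d * k) * q_int d"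
        using q_int_add[of "d * k" d] by (simp add: add.commute)
      thus ?case using Suc by (simp add: algebra_simps)
    qed
    hence qB: "q_int (Suc N) = q_int d * B" unfolding SN B_def by blast
    have "ev w B = of_nat (Suc j)" by (simp add: B_def ev_sum power_mult wd del: sum.lessThan_Suc)
    moreover have "{1..d - 1} = {1..<d}" using d by auto
    ultimately have "ev w (G * B) = fact (Suc j) * ?u ^ Suc j" using G(2) by (simp add: j algebra_simps)
    moreover have "q_fact (Suc N) = q_int d ^ Suc j * (G * B)"
      unfolding q_fact_Suc G(1) qB j by (simp add: mult_ac)
    ultimately show ?thesis using True by (intro exI[of _ "G * B"]) (simp only: j, simp)
  next
    case False
    have j: "Suc N div d = N div d" "Suc N mod d = Suc (N mod d)"
      using False by (auto simp: mod_Suc div_Suc)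
    have "Suc N = Suc N mod d + d * (Suc N div d)" by simp
    hence "ev w (q_int (Suc N)) = ev w (q_int (Suc N mod d)) + w ^ (Suc N mod d) * ev w (q_int (d * (Suc N div d)))"
      by (metis ev_add ev_monom ev_mult q_int_add)
    moreover have "ev w (q_int (d * (Suc N div d))) = 0"
      using w1 wd by (simp add: ev_q_int_eq_0_iff power_mult)
    ultimately have "ev w (q_int (Suc N)) = ev w (q_int (Suc (N mod d)))" by (simp add: j)
    then show ?thesis using G by (intro exI[of _ "G * q_int (Suc N)"]) (auto simp: q_fact_Suc j mult_ac)
  qed
qed

text \<open>Numerator and denominator contain \<open>[d]\<close> to the powers \<open>m\<close> and
  \<open>K\<close>, the sum of the \<open>s i div d\<close>. As the \<open>s i\<close> sum to
  \<open>d m + 1\<close>, the powers agree exactly when the remainders sum to 1; the values of the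
  cofactors then reduce to ordinary factorials. Otherwise a factor \<open>[d]\<close> survives and
  the value is 0.\<close>

lemma q_quotient_root_of_unity:
  assumes d: "2 \<le> d" and w: "primitive_root_of_unity d w" and n: "n = d * m" and J: "finite J"
    and s: "sum s J = Suc n" and p: "p * (\<Prod>i\<in>J. q_fact (s i)) = q_fact n"
  shows "if \<exists>c\<in>J. s c mod d = 1 \<and> (\<forall>i\<in>J - {c}. s i mod d = 0)
    then ev w p * (\<Prod>i\<in>J. fact (s i div d)) = fact m else ev w p = 0"
proof -
  define u where "u = (\<Prod>l=1..<d. ev w (q_int l))"
  define K where "K = (\<Sum>i\<in>J. s i div d)"
  have wl: "w ^ l \<noteq> 1" if "0 < l" "l < d" for l using w that by (simp add: primitive_root_of_unity_def)
  have w1: "w \<noteq> 1" using wl[of 1] d by simp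
  have wd: "w ^ d = 1" using w by (simp add: primitive_root_of_unity_def)
  have nz: "ev w (q_int l) \<noteq> 0" if "0 < l" "l < d" for l using wl[OF that] w1 by (simp add: ev_q_int_eq_0_iff)
  have u: "u \<noteq> 0" unfolding u_def using nz by auto
  obtain G where G: "\<And>N. q_fact N = q_int d ^ (N div d) * G N"
    "\<And>N. ev w (G N) = fact (N div d) * u ^ (N div d) * (\<Prod>l=1..N mod d. ev w (q_int l))"
    using q_fact_root_of_unity[OF d w] unfolding u_def by metis
  have Gnz: "ev w (G N) \<noteq> 0" for N
  proof -
    have "N mod d < d" using d by simp
    hence "(\<Prod>l=1..N mod d. ev w (q_int l)) \<noteq> 0" using nz by auto
    thus ?thesis using u by (simp add: G(2))
  qed
  have split: "Suc n = d * K + (\<Sum>i\<in>J. s i mod d)"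
    unfolding s[symmetric] K_def sum_distrib_left sum.distrib[symmetric] by simp
  have Km: "K \<le> m"
  proof (rule ccontr)
    assume "\<not> K \<le> m"
    hence "d * Suc m \<le> d * K" by (intro mult_left_mono) auto
    thus False using split n d by simp
  qed
  have "p * (q_int d ^ K * (\<Prod>i\<in>J. G (s i))) = q_int d ^ m * G n"
  proof -
    have "(\<Prod>i\<in>J. q_fact (s i)) = q_int d ^ K * (\<Prod>i\<in>J. G (s i))"
      by (subst G(1)) (simp add: prod.distrib K_def power_sum)
    moreover have "q_fact n = q_int d ^ m * G n" using G(1)[of n] n d by simp
    ultimately show ?thesis using p by simp
  qed
  moreover have "q_int d ^ m = q_int d ^ K * q_int d ^ (m - K)" using Km by (simp flip: power_add)
  ultimately have "q_int d ^ K * (p * (\<Prod>i\<in>J. G (s i))) = q_int d ^ K * (q_int d ^ (m - K) * G n)"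
    by (simp only: mult_ac)
  moreover have "q_int d ^ K \<noteq> 0" using q_int_neq_0[of d] d by simp
  ultimately have "p * (\<Prod>i\<in>J. G (s i)) = q_int d ^ (m - K) * G n" using mult_left_cancel by blast
  from arg_cong[OF this, of "ev w"]
  have main: "ev w p * (\<Prod>i\<in>J. ev w (G (s i))) = 0 ^ (m - K) * ev w (G n)"
    using w1 wd by (simp add: ev_prod ev_q_int_eq_0_iff[THEN iffD2])
  show ?thesis
  proof (cases "\<exists>c\<in>J. s c mod d = 1 \<and> (\<forall>i\<in>J - {c}. s i mod d = 0)")
    case True
    then obtain c where c: "c \<in> J" "s c mod d = 1" "\<And>i. i \<in> J - {c} \<Longrightarrow> s i mod d = 0" by blast
    have "(\<Sum>i\<in>J. s i mod d) = s c mod d + (\<Sum>i\<in>J - {c}. s i mod d)" using J c(1) by (simp add: sum.remove)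
    also have "\<dots> = 1" using c by simp
    finally have "d * K = d * m" using split n by linarith
    hence Keq: "K = m" using d by simp
    have "ev w (G (s i)) = fact (s i div d) * u ^ (s i div d)" if "i \<in> J" for i
    proof -
      have "s i mod d = 0 \<or> s i mod d = 1" using c that by blast
      moreover have "ev w (q_int 1) = 1" by (simp add: ev_q_int)
      ultimately have "(\<Prod>l=1..s i mod d. ev w (q_int l)) = 1" by auto
      thus ?thesis by (simp add: G(2))
    qed
    hence "(\<Prod>i\<in>J. ev w (G (s i))) = (\<Prod>i\<in>J. fact (s i div d)) * u ^ K"
      by (simp add: prod.distrib K_def power_sum)
    moreover have "ev w (G n) = fact m * u ^ m" using n d by (simp add: G(2))
    ultimately have "(ev w p * (\<Prod>i\<in>J. fact (s i div d))) * u ^ m = fact m * u ^ m"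
      using main by (simp add: Keq mult_ac)
    thus ?thesis using True u by simp
  next
    case False
    have "K \<noteq> m"
    proof
      assume "K = m"
      hence one: "(\<Sum>i\<in>J. s i mod d) = 1" using split n by simp
      then obtain c where c: "c \<in> J" "s c mod d \<noteq> 0" using sum.not_neutral_contains_not_neutral[of "\<lambda>i. s i mod d" J] by auto
      have "s c mod d + (\<Sum>i\<in>J - {c}. s i mod d) = 1" using J c(1) one by (simp add: sum.remove)
      hence "s c mod d = 1" "(\<Sum>i\<in>J - {c}. s i mod d) = 0" using c(2) by linarith+
      moreover from this(2) have "\<forall>i\<in>J - {c}. s i mod d = 0" using J by simp
      ultimately show False using False c(1) by blast
    qed
    hence "0 < m - K" using Km by simp
    hence "ev w p * (\<Prod>i\<in>J. ev w (G (s i))) = 0" using main by simp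
    moreover have "(\<Prod>i\<in>J. ev w (G (s i))) \<noteq> 0" using J Gnz by simp
    ultimately show ?thesis using False by simp
  qed
qed

subsection \<open>Dyck words and their rotation\<close>

locale coprime_pair =
  fixes a b n :: nat
  assumes a_pos: "0 < a" and a_less: "a < b" and coprime_ab: "coprime a b" and b_eq: "b = Suc n"
begin

lemma n_pos: "0 < n"
  using a_pos a_less b_eq by simp

lemma b_bounds: "b \<le> Suc n" "Suc n \<le> b"
  by (simp_all add: b_eq)

text \<open>The height is taken on arrival at abscissa \<open>s\<close>, before the vertical run
  \<open>v ! s\<close>, so index \<open>s\<close> refers at once to the label \<open>s\<close> and
  to the possible valley there.\<close>

definition level :: "nat list \<Rightarrow> nat \<Rightarrow> int" where
  "level v s = int b * (\<Sum>i<s. int (v ! i)) - int a * int s"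

definition dyck_word :: "nat list \<Rightarrow> bool" where
  "dyck_word v \<longleftrightarrow> length v = b \<and> sum_list v = a \<and> (\<forall>s\<le>b. 0 \<le> level v s)"

lemma level_0 [simp]: "level v 0 = 0"
  by (simp add: level_def)

lemma level_Suc: "level v (Suc s) = level v s + int b * int (v ! s) - int a"
  by (simp add: level_def algebra_simps)

text \<open>Equality would make \<open>b\<close> divide \<open>a (t - s)\<close>, hence
  \<open>t - s\<close> by coprimality, which is too small.\<close>

lemma level_inj:
  assumes "s < t" "t < s + b"
  shows "level v s \<noteq> level v t"
proof
  assume eq: "level v s = level v t"
  have "(\<Sum>i<t. int (v ! i)) = (\<Sum>i<s. int (v ! i)) + (\<Sum>i=s..<t. int (v ! i))"
    using assms(1) by (simp add: lessThan_atLeast0 sum.atLeastLessThan_concat)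
  with eq have "int a * (int t - int s) = int b * (\<Sum>i=s..<t. int (v ! i))"
    by (simp add: level_def algebra_simps)
  hence "int b dvd int a * (int t - int s)" by simp
  moreover have "coprime (int b) (int a)" using coprime_ab by (simp add: coprime_commute)
  ultimately have "int b dvd int t - int s" using coprime_dvd_mult_right_iff by blast
  hence "int b \<le> int t - int s" using assms(1) by (intro zdvd_imp_le) auto
  thus False using assms(2) by linarith
qed

lemma level_end:
  assumes "dyck_word v" shows "level v b = 0"
proof -
  have "(\<Sum>i<b. v ! i) = a"
    using assms unfolding dyck_word_def lessThan_atLeast0 by (metis sum_list_sum_nth)
  hence "(\<Sum>i<b. int (v ! i)) = int a" by (metis of_nat_sum)
  thus ?thesis by (simp add: level_def)
qed

lemma level_pos:
  assumes "dyck_word v" "0 < t" "t < b" shows "0 < level v t"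
proof -
  have "0 \<le> level v t" using assms by (simp add: dyck_word_def)
  moreover have "level v t \<noteq> 0" using level_inj[of 0 t v] assms by simp
  ultimately show ?thesis by simp
qed

lemma last_zero:
  assumes "dyck_word v" shows "v ! n = 0"
proof (rule ccontr)
  assume "v ! n \<noteq> 0"
  hence "int b * 1 \<le> int b * int (v ! n)" by (intro mult_left_mono) auto
  moreover have "level v n + int b * int (v ! n) - int a = 0"
    using level_end[OF assms] level_Suc[of v n] b_eq[symmetric] by simp
  moreover have "0 \<le> level v n" using assms b_bounds by (simp add: dyck_word_def)
  ultimately show False using a_less by linarith
qed

lemma level_n: assumes "dyck_word v" shows "level v n = int a"
  using level_end[OF assms] level_Suc[of v n] last_zero[OF assms] b_eq[symmetric] by simp

lemma level_less_Suc:
  assumes "0 < v ! p" shows "level v p < level v (Suc p)"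
proof -
  have "int b * 1 \<le> int b * int (v ! p)" using assms by (intro mult_left_mono) auto
  thus ?thesis using a_less unfolding level_Suc by linarith
qed

lemma level_Suc_less_iff: "level v p < level v (Suc p) \<longleftrightarrow> 0 < v ! p"
  using level_less_Suc[of v p] a_pos by (cases "v ! p") (auto simp: level_Suc)

section \<open>Parents of labels\<close>

definition par :: "nat list \<Rightarrow> nat \<Rightarrow> nat" where
  "par v t = Max {p. p < t \<and> level v p < level v t}"

lemma par_eqI:
  assumes "p < t" "level v p < level v t" "\<And>s. p < s \<Longrightarrow> s < t \<Longrightarrow> level v t \<le> level v s"
  shows "par v t = p"
  unfolding par_def
proof (rule Max_eqI)
  show "finite {p. p < t \<and> level v p < level v t}" by simp
  show "q \<le> p" if "q \<in> {p. p < t \<and> level v p < level v t}" for q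
    using that assms(3)[of q] by (cases "p < q") auto
qed (use assms in auto)

lemma par_props:
  assumes "dyck_word v" "0 < t" "t < b"
  shows par_less: "par v t < t" and level_par: "level v (par v t) < level v t"
    and par_between: "\<And>s. par v t < s \<Longrightarrow> s < t \<Longrightarrow> level v t < level v s"
proof -
  let ?S = "{p. p < t \<and> level v p < level v t}"
  have "0 \<in> ?S" using level_pos[OF assms] assms(2) by simp
  hence "par v t \<in> ?S" unfolding par_def by (intro Max_in) auto
  thus "par v t < t" "level v (par v t) < level v t" by auto
  fix s assume s: "par v t < s" "s < t"
  have "finite ?S" by simp
  hence "s \<notin> ?S" using s Max_ge[of ?S s] unfolding par_def by linarith
  moreover have "level v s \<noteq> level v t" using s assms by (intro level_inj) auto
  ultimately show "level v t < level v s" using s by auto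
qed

lemma par_Suc:
  assumes "0 < v ! p" shows "par v (Suc p) = p"
  by (rule par_eqI) (use assms level_less_Suc in auto)

text \<open>Every position after the parent up to the label has a higher level, so the step leaving
  the parent goes up; such a step needs a positive run.\<close>

lemma nonleaf_par:
  assumes "dyck_word v" "0 < t" "t < b"
  shows "0 < v ! par v t"
proof -
  have "level v (par v t) < level v (Suc (par v t))"
    using par_props[OF assms] by (metis Suc_lessI less_Suc_eq order.strict_trans)
  thus ?thesis by (simp add: level_Suc_less_iff)
qed

lemma level_between:
  assumes "dyck_word v" "0 < t" "t < b" "par v t < s" "s \<le> t"
  shows "level v (par v t) < level v s"
  using par_props[OF assms(1-3)] assms(4,5) by (metis le_neq_implies_less order.strict_trans)

section \<open>The inverse rotation on words\<close>

definition t0 :: "nat list \<Rightarrow> nat" where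
  "t0 v = (LEAST t. 1 < t \<and> level v t < level v 1)"

lemma t0_props:
  assumes "dyck_word v"
  shows t0_gt: "1 < t0 v" and t0_le: "t0 v \<le> b" and level_t0: "level v (t0 v) < level v 1"
    and before_t0: "\<And>s. 1 \<le> s \<Longrightarrow> s < t0 v \<Longrightarrow> level v 1 \<le> level v s"
    and leaf_t0: "v ! (t0 v - 1) = 0"
proof -
  have ex: "1 < b \<and> level v b < level v 1"
    using level_pos[OF assms, of 1] level_end[OF assms] a_pos a_less by simp
  from LeastI[of "\<lambda>t. 1 < t \<and> level v t < level v 1", OF ex]
  show *: "1 < t0 v" "level v (t0 v) < level v 1" by (auto simp: t0_def)
  show "t0 v \<le> b" unfolding t0_def using ex by (rule Least_le)
  show B: "level v 1 \<le> level v s" if "1 \<le> s" "s < t0 v" for s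
    using not_less_Least[of s "\<lambda>t. 1 < t \<and> level v t < level v 1"] that
    by (cases "s = 1") (auto simp: t0_def)
  have "level v 1 \<le> level v (t0 v - 1)" by (rule B) (use * in auto)
  moreover have "Suc (t0 v - 1) = t0 v" using * by simp
  ultimately have "\<not> level v (t0 v - 1) < level v (Suc (t0 v - 1))" using * by simp
  thus "v ! (t0 v - 1) = 0" by (simp add: level_Suc_less_iff)
qed

text \<open>The inverse rotation sends label 1 to \<open>n\<close>. The block of 1 then opens before its next element
  \<open>t0 v\<close> (before \<open>n\<close> if it is a singleton, where \<open>t0 v = b\<close>), and all other blocks move down by one.\<close>

definition turn :: "nat list \<Rightarrow> nat list" where
  "turn v = rotate1 (v[0 := v ! (t0 v - 1), t0 v - 1 := v ! 0])"

lemma mset_turn: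
  assumes "dyck_word v" shows "mset (turn v) = mset v"
proof -
  have "t0 v - 1 < length v" "0 < length v"
    using t0_props[OF assms] assms by (auto simp: dyck_word_def)
  hence "mset (v[0 := v ! (t0 v - 1), t0 v - 1 := v ! 0]) = mset v" by (intro mset_swap)
  moreover have "mset (rotate1 xs) = mset xs" for xs :: "nat list" by (cases xs) auto
  ultimately show ?thesis by (simp add: turn_def)
qed

lemma nth_turn:
  assumes "dyck_word v" "p < n"
  shows "turn v ! p = (if p = t0 v - 2 then v ! 0 else v ! Suc p)"
proof -
  have l: "length v = b" "1 < t0 v" "t0 v \<le> b" using t0_props[OF assms(1)] assms(1) by (auto simp: dyck_word_def)
  have sp: "Suc p < b" using assms(2) b_eq by simp
  have "turn v ! p = v[0 := v ! (t0 v - 1), t0 v - 1 := v ! 0] ! Suc p"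
    using sp l(1) by (simp add: turn_def nth_rotate1)
  thus ?thesis using l sp by (auto simp: nth_list_update)
qed

text \<open>The run \<open>v ! 0\<close> is exchanged with the zero run before \<open>t0 v\<close>,
  and the exchanged word loses the step at its front. Until the run is restored the levels miss
  \<open>level v 1 = b v_0 - a\<close>; afterwards only the \<open>a\<close> of the dropped east
  step remains.\<close>

lemma level_turn:
  assumes "dyck_word v" "s \<le> n"
  shows "level (turn v) s = (if Suc s < t0 v then level v (Suc s) - level v 1 else level v (Suc s) + int a)"
  using assms(2)
proof (induction s)
  case 0
  then show ?case using t0_gt[OF assms(1)] by simp
next
  case (Suc s)
  have l1: "level v 1 = int b * int (v ! 0) - int a" using level_Suc[of v 0] by simp
  have nt: "turn v ! s = (if s = t0 v - 2 then v ! 0 else v ! Suc s)"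
    using Suc.prems by (intro nth_turn[OF assms(1)]) auto
  consider "Suc (Suc s) < t0 v" | "Suc (Suc s) = t0 v" | "t0 v < Suc (Suc s)" by linarith
  then show ?case
  proof cases
    case 1
    then show ?thesis using Suc nt by (auto simp: level_Suc[of _ s] level_Suc[of _ "Suc s"])
  next
    case 2
    hence "v ! Suc s = 0" using leaf_t0[OF assms(1)] by (metis diff_Suc_1)
    moreover have "s = t0 v - 2" "Suc s < t0 v" using 2 by auto
    ultimately show ?thesis using Suc nt 2 l1 level_Suc[of "turn v" s] level_Suc[of v "Suc s"]
      by simp
  next
    case 3
    hence "s \<noteq> t0 v - 2" using t0_gt[OF assms(1)] by linarith
    then show ?thesis using Suc nt 3 by (auto simp: level_Suc[of _ s] level_Suc[of _ "Suc s"])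
  qed
qed

lemma dyck_turn:
  assumes "dyck_word v" shows "dyck_word (turn v)"
proof -
  have len: "length (turn v) = b" and sm: "sum_list (turn v) = a"
    using mset_turn[OF assms] assms by (metis dyck_word_def mset_eq_length, metis dyck_word_def sum_mset_sum_list)
  have "0 \<le> level (turn v) s" if "s \<le> n" for s
  proof -
    have "0 \<le> level v (Suc s)" using assms that b_bounds by (simp add: dyck_word_def)
    thus ?thesis using that before_t0[OF assms, of "Suc s"] by (auto simp: level_turn[OF assms])
  qed
  moreover have "level (turn v) b = 0"
  proof -
    have "(\<Sum>i<b. turn v ! i) = a"
      using len sm by (simp add: sum_list_sum_nth lessThan_atLeast0)
    hence "(\<Sum>i<b. int (turn v ! i)) = int a" by (metis of_nat_sum)
    thus ?thesis by (simp add: level_def)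
  qed
  moreover have "s \<le> n \<or> s = b" if "s \<le> b" for s using that b_eq by linarith
  ultimately have "0 \<le> level (turn v) s" if "s \<le> b" for s using that by (metis order_refl)
  thus ?thesis using len sm by (simp add: dyck_word_def)
qed

definition turn_label :: "nat \<Rightarrow> nat" where
  "turn_label t = (if t = 1 then n else t - 1)"

text \<open>Where the block of the children of \<open>p\<close> opens after \<open>turn\<close>. The
  block of label 1, with \<open>p = 0\<close>, reopens one place before the new label of its next
  element.\<close>

definition turn_node :: "nat list \<Rightarrow> nat \<Rightarrow> nat" where
  "turn_node v p = (if p = 0 then t0 v - 2 else p - 1)"

lemma par_turn:
  assumes dw: "dyck_word v" and t: "0 < t" "t < b"
  shows "par (turn v) (turn_label t) = turn_node v (par v t)"
proof -
  note L = level_turn[OF dw]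
  note T = t0_props[OF dw]
  note P = par_props[OF dw t]
  have l1: "level v 1 = int b * int (v ! 0) - int a" using level_Suc[of v 0] by simp
  \<comment> \<open>The reopening position lies below \<open>a\<close>, whereas every position from
    it on up to label \<open>n\<close> has received the shift \<open>+ a\<close>; hence it qualifies
    as parent.\<close>
  have low: "level (turn v) (t0 v - 2) < int a"
  proof -
    have "level v (t0 v) = level v (t0 v - 1) + int b * int (v ! (t0 v - 1)) - int a"
      using level_Suc[of v "t0 v - 1"] T(1) by simp
    moreover have "Suc (t0 v - 2) = t0 v - 1" "t0 v - 1 < t0 v" using T(1) by auto
    ultimately show ?thesis using L[of "t0 v - 2"] T(1,2,3,5) b_bounds l1 by auto
  qed
  \<comment> \<open>The cases are label 1 itself; labels before the next element of its block, whose
    parents also lie before it; later labels of other blocks, whose parents are at least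
    \<open>t0 v\<close>; and later labels of the block of 1. In the second and third case label and
    parent receive the same shift of level.\<close>
  consider "t = 1" | "1 < t" "t < t0 v" | "t0 v \<le> t" "0 < par v t" | "t0 v \<le> t" "par v t = 0"
    using t by linarith
  then show ?thesis
  proof cases
    case 1
    have p0: "par v t = 0" using P(1) 1 by simp
    have "par (turn v) n = t0 v - 2"
    proof (rule par_eqI)
      have "level (turn v) n = int a" by (rule level_n[OF dyck_turn[OF dw]])
      show "t0 v - 2 < n" using T b_bounds by linarith
      show "level (turn v) (t0 v - 2) < level (turn v) n"
        using low \<open>level (turn v) n = int a\<close> by simp
      fix s assume s: "t0 v - 2 < s" "s < n"
      hence "0 < level v (Suc s)" using b_bounds by (intro level_pos[OF dw]) auto
      then show "level (turn v) n \<le> level (turn v) s"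
        using s \<open>level (turn v) n = int a\<close> L[of s] by auto
    qed
    then show ?thesis using 1 p0 by (simp add: turn_label_def turn_node_def)
  next
    case 2
    have "1 \<le> par v t"
    proof (rule ccontr)
      assume "\<not> 1 \<le> par v t"
      hence "level v t < level v 1" using P(3)[of 1] 2 by simp
      thus False using T(4)[of t] 2 by simp
    qed
    hence "par (turn v) (t - 1) = par v t - 1"
    proof (intro par_eqI)
      assume ge: "1 \<le> par v t"
      show "par v t - 1 < t - 1" using ge P(1) by simp
      show "level (turn v) (par v t - 1) < level (turn v) (t - 1)"
        using ge P 2 t b_bounds L[of "t - 1"] L[of "par v t - 1"] by simp
      fix s assume s: "par v t - 1 < s" "s < t - 1"
      hence "level v t < level v (Suc s)" using ge by (intro P(3)) auto
      moreover have x: "Suc s < t0 v" "s \<le> n" "t - 1 \<le> n" using s 2 t b_bounds by linarith+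
      ultimately show "level (turn v) (t - 1) \<le> level (turn v) s"
        using 2 L[of "t - 1"] L[of s] by simp
    qed
    then show ?thesis using 2 \<open>1 \<le> par v t\<close> by (simp add: turn_label_def turn_node_def)
  next
    case 3
    have ge: "t0 v \<le> par v t"
    proof (rule ccontr)
      assume lt: "\<not> t0 v \<le> par v t"
      hence "level v 1 \<le> level v (par v t)" using 3 by (intro T(4)) auto
      moreover have "level v t \<le> level v (t0 v)"
        using P(3)[of "t0 v"] lt 3 by (cases "t0 v = t") auto
      ultimately show False using P(2) T(3) by linarith
    qed
    hence "par (turn v) (t - 1) = par v t - 1"
    proof (intro par_eqI)
      show "par v t - 1 < t - 1" using 3 P(1) by simp
      show "level (turn v) (par v t - 1) < level (turn v) (t - 1)"
        using ge P 3 t b_bounds L[of "t - 1"] L[of "par v t - 1"] by simp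
      fix s assume s: "par v t - 1 < s" "s < t - 1"
      hence "level v t < level v (Suc s)" using ge by (intro P(3)) auto
      moreover have "\<not> Suc s < t0 v" "s \<le> n" "t - 1 \<le> n" using s 3 ge t b_bounds by linarith+
      ultimately show "level (turn v) (t - 1) \<le> level (turn v) s"
        using 3 t L[of "t - 1"] L[of s] by simp
    qed
    then show ?thesis using 3 T(1) by (simp add: turn_label_def turn_node_def)
  next
    case 4
    have lt: "level (turn v) (t - 1) = level v t + int a" using 4 t T(1) b_bounds L[of "t - 1"] by auto
    have "par (turn v) (t - 1) = t0 v - 2"
    proof (rule par_eqI)
      show "t0 v - 2 < t - 1" using 4 T(1) by linarith
      show "level (turn v) (t0 v - 2) < level (turn v) (t - 1)"
        using low lt level_pos[OF dw t] by linarith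
      fix s assume s: "t0 v - 2 < s" "s < t - 1"
      hence "level v t < level v (Suc s)" using 4 by (intro P(3)) auto
      thus "level (turn v) (t - 1) \<le> level (turn v) s"
        using s lt t b_bounds L[of s] by auto
    qed
    then show ?thesis using 4 T(1) by (auto simp: turn_label_def turn_node_def)
  qed
qed

lemma nth_turn_node:
  assumes "dyck_word v" "p < n" "0 < v ! p"
  shows "turn v ! turn_node v p = v ! p"
proof -
  have "p \<noteq> t0 v - 1" using assms leaf_t0 by (metis less_numeral_extra(3))
  moreover have "t0 v - 2 < n" "1 < t0 v" using t0_props[OF assms(1)] b_bounds by linarith+
  ultimately show ?thesis using assms(2) nth_turn[OF assms(1)]
    by (auto simp: turn_node_def)
qed

lemma turn_node_inj:
  assumes "dyck_word v" "0 < v ! p" "0 < v ! q" "turn_node v p = turn_node v q"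
  shows "p = q"
proof -
  have "p \<noteq> t0 v - 1" "q \<noteq> t0 v - 1" using assms leaf_t0 by (metis less_numeral_extra(3))+
  thus ?thesis using assms(4) t0_gt[OF assms(1)] by (auto simp: turn_node_def split: if_splits)
qed

text \<open>Reading labels modulo \<open>n\<close> turns rotation into a shift of the integers.\<close>

definition lab :: "int \<Rightarrow> nat" where
  "lab t = nat ((t - 1) mod int n) + 1"

lemma lab_range: "0 < lab t" "lab t < b" "lab t \<le> n"
proof -
  have "nat ((t - 1) mod int n) < n" using n_pos by (simp add: nat_less_iff)
  thus "0 < lab t" "lab t < b" "lab t \<le> n" using b_bounds by (auto simp: lab_def)
qed

lemma lab_id: "1 \<le> t \<Longrightarrow> t \<le> int n \<Longrightarrow> lab t = nat t"
  by (simp add: lab_def nat_diff_distrib)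

lemma lab_add_mult: "lab (t + z * int n) = lab t"
proof -
  have "t + z * int n - 1 = (t - 1) + z * int n" by simp
  thus ?thesis unfolding lab_def by (metis mod_mult_self1)
qed

lemma lab_add_n: "lab (t + int n) = lab t"
  using lab_add_mult[of t 1] by simp

lemma turn_label_lab: "turn_label (lab (t + 1)) = lab t"
proof -
  have m: "(t - 1) mod int n = (t mod int n - 1) mod int n" by (simp add: mod_diff_left_eq)
  show ?thesis
  proof (cases "t mod int n = 0")
    case True
    hence "(t - 1) mod int n = int n - 1" using m n_pos zmod_minus1[of "int n"] by simp
    thus ?thesis using True n_pos by (simp add: lab_def turn_label_def nat_diff_distrib)
  next
    case False
    have "0 \<le> t mod int n" "t mod int n < int n" using n_pos by auto
    hence "(t - 1) mod int n = t mod int n - 1" using m False by simp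
    thus ?thesis using False \<open>0 \<le> t mod int n\<close> by (simp add: lab_def turn_label_def nat_diff_distrib)
  qed
qed

definition sib :: "nat list \<Rightarrow> int \<Rightarrow> int \<Rightarrow> bool" where
  "sib v s t \<longleftrightarrow> par v (lab s) = par v (lab t)"

definition rk :: "nat list \<Rightarrow> int \<Rightarrow> nat" where
  "rk v t = v ! par v (lab t)"

lemma sib_refl: "sib v s s" and sib_sym: "sib v s t \<Longrightarrow> sib v t s"
  and sib_trans: "sib v s t \<Longrightarrow> sib v t u \<Longrightarrow> sib v s u"
  by (auto simp: sib_def)

lemma sib_add_n [simp]: "sib v (s + int n) t \<longleftrightarrow> sib v s t" "sib v s (t + int n) \<longleftrightarrow> sib v s t"
  by (auto simp: sib_def lab_add_n)

lemma par_lab_nonleaf: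
  assumes "dyck_word v" shows "par v (lab t) < n" "0 < v ! par v (lab t)"
  using par_less[OF assms lab_range(1,2)] nonleaf_par[OF assms lab_range(1,2)] lab_range(3)[of t]
  by (auto intro: less_le_trans)

lemma sib_turn:
  assumes "dyck_word v"
  shows "sib (turn v) s t \<longleftrightarrow> sib v (s + 1) (t + 1)"
proof -
  have "par (turn v) (lab s) = turn_node v (par v (lab (s + 1)))" for s
    using par_turn[OF assms lab_range(1,2), of "s + 1"] by (simp add: turn_label_lab)
  thus ?thesis
    using turn_node_inj[OF assms] par_lab_nonleaf[OF assms] by (auto simp: sib_def)
qed

lemma rk_turn:
  assumes "dyck_word v" shows "rk (turn v) t = rk v (t + 1)"
  using par_turn[OF assms lab_range(1,2), of "t + 1"] nth_turn_node[OF assms] par_lab_nonleaf[OF assms]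
  by (simp add: rk_def turn_label_lab)

lemma turn_pow:
  assumes "dyck_word v"
  shows dyck_turn_pow: "dyck_word ((turn ^^ j) v)" and mset_turn_pow: "mset ((turn ^^ j) v) = mset v"
    and sib_turn_pow: "sib ((turn ^^ j) v) s t \<longleftrightarrow> sib v (s + int j) (t + int j)"
    and rk_turn_pow: "rk ((turn ^^ j) v) t = rk v (t + int j)"
proof -
  have "dyck_word ((turn ^^ j) v) \<and> mset ((turn ^^ j) v) = mset v \<and>
     (\<forall>s t. sib ((turn ^^ j) v) s t \<longleftrightarrow> sib v (s + int j) (t + int j)) \<and>
     (\<forall>t. rk ((turn ^^ j) v) t = rk v (t + int j))"
    by (induction j) (use assms in \<open>auto simp: dyck_turn mset_turn sib_turn rk_turn algebra_simps\<close>)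
  thus "dyck_word ((turn ^^ j) v)" "mset ((turn ^^ j) v) = mset v"
    "sib ((turn ^^ j) v) s t \<longleftrightarrow> sib v (s + int j) (t + int j)"
    "rk ((turn ^^ j) v) t = rk v (t + int j)" by auto
qed

text \<open>A run is nonzero exactly when the next label is the smallest of its block, and then it
  is the rank of that block. So a word is determined by \<open>sib\<close> and \<open>rk\<close>,
  the two data that \<open>turn\<close> simply shifts.\<close>

lemma nth_eq_rk:
  assumes dw: "dyck_word v" and p: "p < n"
  shows "v ! p = (if \<exists>k. 1 \<le> k \<and> k \<le> int p \<and> sib v k (int p + 1) then 0 else rk v (int p + 1))"
proof (cases "0 < v ! p")
  case True
  have lp: "lab (int p + 1) = Suc p" using p by (subst lab_id) auto
  have "\<not> sib v k (int p + 1)" if "1 \<le> k" "k \<le> int p" for k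
  proof -
    have "lab k = nat k" using that p by (intro lab_id) auto
    moreover have "par v (nat k) < nat k" using that p b_bounds by (intro par_less[OF dw]) auto
    ultimately show ?thesis using that lp par_Suc[of v p] True by (auto simp: sib_def)
  qed
  thus ?thesis using True par_Suc[of v p] lp by (auto simp: rk_def)
next
  case False
  have lp: "lab (int p + 1) = Suc p" using p by (subst lab_id) auto
  have r: "0 < Suc p" "Suc p < b" using p b_bounds by auto
  define q where "q = par v (Suc p)"
  have q: "q < Suc p" "0 < v ! q" using par_less[OF dw r] nonleaf_par[OF dw r] by (auto simp: q_def)
  with False have "q < p" by (metis less_antisym)
  hence "sib v (int q + 1) (int p + 1)"
    using lp lab_id[of "int q + 1"] p par_Suc[of v q] q by (simp add: sib_def q_def nat_add_distrib)
  moreover have "1 \<le> int q + 1" "int q + 1 \<le> int p" using \<open>q < p\<close> by auto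
  ultimately show ?thesis using False by auto
qed

lemma dyck_word_eqI:
  assumes "dyck_word v" "dyck_word u" "\<And>s t. sib v s t = sib u s t" "\<And>t. rk v t = rk u t"
  shows "v = u"
proof (rule nth_equalityI)
  show "length v = length u" using assms by (simp add: dyck_word_def)
  fix i assume "i < length v"
  hence "i < n \<or> i = n" using assms(1) b_bounds by (auto simp: dyck_word_def)
  thus "v ! i = u ! i" using nth_eq_rk[OF assms(1)] nth_eq_rk[OF assms(2)] assms(3,4)
    last_zero assms(1,2) by auto
qed

lemma rk_add_n [simp]: "rk v (t + int n) = rk v t"
  by (simp add: rk_def lab_add_n)

lemma turn_pow_n: assumes "dyck_word v" shows "(turn ^^ n) v = v"
  by (rule dyck_word_eqI) (use assms in \<open>auto simp: turn_pow\<close>)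

lemma turn_pow_nmult: assumes "dyck_word v" shows "(turn ^^ (n * k)) v = v"
  by (induction k) (use assms in \<open>auto simp: turn_pow_n funpow_add\<close>)

lemma turn_pow_inj:
  assumes "dyck_word v" "dyck_word u" "(turn ^^ j) v = (turn ^^ j) u"
  shows "v = u"
proof -
  have "j \<le> n * j" using n_pos by simp
  hence "(turn ^^ (n * j)) x = (turn ^^ (n * j - j)) ((turn ^^ j) x)" for x
    by (metis comp_apply funpow_add le_add_diff_inverse2)
  thus ?thesis using assms turn_pow_nmult by metis
qed

lemma turn_pow_surj:
  assumes "dyck_word v" obtains u where "dyck_word u" "mset u = mset v" "(turn ^^ j) u = v"
proof -
  have "j \<le> n * j" using n_pos by simp
  hence "(turn ^^ j) ((turn ^^ (n * j - j)) v) = v"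
    by (metis comp_apply funpow_add le_add_diff_inverse turn_pow_nmult[OF assms])
  thus ?thesis using that turn_pow[OF assms] by blast
qed

text \<open>Rotating \<open>i\<close> to label 1 makes the parent of \<open>K\<close> equal to 0. If
  the common parent of \<open>J\<close> and \<open>L\<close> were positive, it would lie below
  \<open>K\<close> because \<open>K\<close> is between it and \<open>L\<close>, and above
  \<open>K\<close> because it is between 0 and \<open>K\<close>.\<close>

lemma noncrossing:
  assumes dw: "dyck_word v" and "i < j" "j < k" "k < l" "l < i + int n" "sib v i k" "sib v j l"
  shows "sib v i j"
proof -
  define m where "m = nat ((i - 1) mod int n)"
  define z where "z = (i - 1) div int n"
  have "int m = (i - 1) mod int n" using n_pos by (simp add: m_def)
  hence im: "i = 1 + int m + z * int n"
    using div_mult_mod_eq[of "i - 1" "int n"] by (simp add: z_def)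
  define u where "u = (turn ^^ m) v"
  have du: "dyck_word u" unfolding u_def by (rule turn_pow[OF dw])
  have tr: "sib v x y \<longleftrightarrow> sib u (x - i + 1) (y - i + 1)" for x y
  proof -
    have "sib u (x - i + 1) (y - i + 1) \<longleftrightarrow> sib v (x + (- z) * int n) (y + (- z) * int n)"
      unfolding u_def turn_pow(3)[OF dw] by (simp add: im algebra_simps)
    thus ?thesis unfolding sib_def lab_add_mult by simp
  qed
  define J K L where "J = nat (j - i + 1)" and "K = nat (k - i + 1)" and "L = nat (l - i + 1)"
  have ord: "1 < J" "J < K" "K < L" "L \<le> n" using assms by (auto simp: J_def K_def L_def)
  have lb: "lab (j - i + 1) = J" "lab (k - i + 1) = K" "lab (l - i + 1) = L" "lab 1 = 1"
    using assms n_pos by (auto simp: J_def K_def L_def lab_id)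
  have p1: "par u 1 = 0" using par_less[OF du, of 1] n_pos b_bounds by simp
  have "par u K = 0" using assms(6) tr[of i k] lb p1 by (simp add: sib_def)
  have JL: "par u J = par u L" using assms(7) tr[of j l] lb by (simp add: sib_def)
  have "par u J < J" using ord b_bounds by (intro par_less[OF du]) auto
  have "par u J = 0"
  proof (rule ccontr)
    assume ne: "par u J \<noteq> 0"
    have "level u (par u L) < level u K"
      using ord b_bounds \<open>par u J < J\<close> JL by (intro level_between[OF du]) auto
    moreover have "level u K < level u (par u J)"
      using par_between[OF du, of K "par u J"] ne \<open>par u K = 0\<close> ord b_bounds \<open>par u J < J\<close> by auto
    ultimately show False using JL by simp
  qed
  thus ?thesis using tr[of i j] lb p1 by (simp add: sib_def)
qed

section \<open>Levels of infinite and periodic letter sequences\<close>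

definition walk :: "(nat \<Rightarrow> nat) \<Rightarrow> nat \<Rightarrow> int" where
  "walk f s = (\<Sum>i<s. int b * int (f i) - int a)"

lemma walk_0 [simp]: "walk f 0 = 0" and walk_Suc: "walk f (Suc s) = walk f s + int b * int (f s) - int a"
  by (simp_all add: walk_def)

lemma level_walk: "level v s = walk (\<lambda>i. v ! i) s"
  by (simp add: walk_def level_def sum_subtractf sum_distrib_left algebra_simps)

lemma walk_cong: "(\<And>i. i < s \<Longrightarrow> f i = g i) \<Longrightarrow> walk f s = walk g s"
  by (simp add: walk_def)

lemma walk_shift: "walk (\<lambda>i. f (i + j)) s = walk f (s + j) - walk f j"
  by (induction s) (auto simp: walk_Suc)

lemma walk_add_period:
  assumes "\<And>i. f (i + P) = f i" shows "walk f (s + P) = walk f s + walk f P"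
  using walk_shift[of f P s] assms by simp

lemma walk_add_mult_period:
  assumes "\<And>i. f (i + P) = f i" shows "walk f (s + k * P) = walk f s + int k * walk f P"
proof (induction k)
  case (Suc k)
  have "walk f (s + Suc k * P) = walk f ((s + k * P) + P)" by (simp add: algebra_simps)
  also have "\<dots> = walk f (s + k * P) + walk f P" by (rule walk_add_period) (rule assms)
  finally show ?case using Suc by (simp add: algebra_simps)
qed simp

lemma periodic_mult:
  fixes f :: "nat \<Rightarrow> 'a"
  assumes "\<And>i. f (i + P) = f i" shows "f (i + k * P) = f i"
proof (induction k)
  case (Suc k)
  have "f (i + Suc k * P) = f ((i + k * P) + P)" by (simp add: algebra_simps)
  then show ?case using Suc assms by simp
qed simp

lemma periodic_mod:
  fixes f :: "nat \<Rightarrow> 'a"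
  assumes "\<And>i. f (i + P) = f i" shows "f (i mod P) = f i"
  using periodic_mult[of f P "i mod P" "i div P", OF assms] by (simp add: add.commute)

lemma walk_inj:
  assumes "s < t" "t < s + b" shows "walk f s \<noteq> walk f t"
proof -
  have "walk (\<lambda>i. map f [0..<t] ! i) x = walk f x" if "x \<le> t" for x
    using that by (intro walk_cong) auto
  thus ?thesis using level_inj[OF assms, of "map f [0..<t]"] assms(1) by (simp add: level_walk)
qed

lemma walk_sum: "walk f s = int b * int (\<Sum>i<s. f i) - int a * int s"
  by (simp add: walk_def sum_subtractf sum_distrib_left)

lemma level_rotate:
  assumes "length u = b" "s \<le> b"
  shows "level (rotate j u) s = walk (\<lambda>i. u ! (i mod b)) (s + j) - walk (\<lambda>i. u ! (i mod b)) j"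
proof -
  have "level (rotate j u) s = walk (\<lambda>i. u ! ((i + j) mod b)) s"
    unfolding level_walk by (rule walk_cong) (use assms in \<open>auto simp: nth_rotate add.commute\<close>)
  thus ?thesis using walk_shift[of "\<lambda>i. u ! (i mod b)" j s] by simp
qed

lemma mset_rotate_list: "mset (rotate j xs) = mset xs"
proof -
  have "mset (rotate1 xs) = mset xs" for xs :: "'a list" by (cases xs) auto
  thus ?thesis by (induction j) auto
qed

lemma sum_list_rotate: "sum_list (rotate j xs) = sum_list (xs :: nat list)"
  using mset_rotate_list[of j xs] by (metis sum_mset_sum_list)

lemma rotate_inverse: "j \<le> length xs \<Longrightarrow> rotate (length xs - j) (rotate j xs) = xs"
  by (simp add: rotate_rotate)

definition dyck_words :: "nat multiset \<Rightarrow> nat list set" where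
  "dyck_words M = {v. dyck_word v \<and> mset v = M}"

lemma finite_dyck_words: "finite (dyck_words M)"
  by (rule finite_subset[of _ "permutations_of_multiset M"])
    (auto simp: dyck_words_def intro: permutations_of_multisetI)

text \<open>Cycle lemma: the levels of a word of length \<open>b\<close> and sum \<open>a\<close> are pairwise distinct modulo \<open>b\<close>,
  hence exactly one rotation starts at the lowest level.\<close>

lemma card_dyck_words:
  assumes "size M = b" "sum_mset M = a"
  shows "card (dyck_words M) * b = card (permutations_of_multiset M)"
proof -
  have zero: "walk (\<lambda>i. u ! (i mod b)) b = 0" if "length u = b" "sum_list u = a" for u
  proof -
    have "(\<Sum>i<b. u ! (i mod b)) = sum_list u"
      using that by (simp add: sum_list_sum_nth lessThan_atLeast0)
    thus ?thesis using that by (simp add: walk_sum)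
  qed
  have red: "walk (\<lambda>i. u ! (i mod b)) (x mod b) = walk (\<lambda>i. u ! (i mod b)) x"
    if "length u = b" "sum_list u = a" for u x
    using walk_add_mult_period[of "\<lambda>i. u ! (i mod b)" b "x mod b" "x div b"] zero[OF that]
    by (simp add: add.commute)
  have bpos: "0 < b" using a_less by simp
  have min: "walk (\<lambda>i. u ! (i mod b)) j \<le> walk (\<lambda>i. u ! (i mod b)) x"
    if d: "dyck_word (rotate j u)" "length u = b" "sum_list u = a" for u j x
  proof -
    let ?f = "\<lambda>i. u ! (i mod b)"
    \<comment> \<open>Chosen so that \<open>s + j\<close> is congruent to \<open>x\<close> modulo
      \<open>b\<close>: nonnegative levels of the rotated word say that \<open>j\<close> minimises
      the periodic walk.\<close>
    define s where "s = (x + (b - 1) * j) mod b"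
    have "s \<le> b" using bpos by (simp add: s_def less_imp_le)
    hence "walk ?f j \<le> walk ?f (s + j)"
      using d level_rotate[of u s j] by (auto simp: dyck_word_def)
    also have "walk ?f (s + j) = walk ?f ((s + j) mod b)" using red d by simp
    also have "(s + j) mod b = (x + b * j) mod b"
    proof -
      have "x + (b - 1) * j + j = x + b * j" using bpos by (cases b) auto
      thus ?thesis unfolding s_def by (metis mod_add_left_eq)
    qed
    also have "\<dots> = x mod b" by simp
    also have "walk ?f (x mod b) = walk ?f x" using red d by simp
    finally show ?thesis .
  qed
  have "bij_betw (\<lambda>(v, j). rotate j v) (dyck_words M \<times> {..<b}) (permutations_of_multiset M)"
  proof (rule bij_betwI')
    fix x y assume x: "x \<in> dyck_words M \<times> {..<b}" and y: "y \<in> dyck_words M \<times> {..<b}"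
    obtain v j w k where xy: "x = (v, j)" "y = (w, k)" by fastforce
    have vw: "dyck_word v" "dyck_word w" "mset v = M" "mset w = M" "j < b" "k < b"
      using x y xy by (auto simp: dyck_words_def)
    have "v = w \<and> j = k" if eq: "rotate j v = rotate k w"
    proof -
      define u where "u = rotate j v"
      let ?f = "\<lambda>i. u ! (i mod b)"
      have u: "length u = b" "sum_list u = a"
        using vw by (auto simp: u_def dyck_word_def sum_list_rotate)
      have v: "rotate (b - j) u = v" "rotate (b - k) u = w"
        using vw eq rotate_inverse[of j v] rotate_inverse[of k w] by (auto simp: u_def dyck_word_def)
      \<comment> \<open>Both positions start a Dyck word, so both are minima of the same periodic
        walk.\<close>
      have "walk ?f (b - j) = walk ?f (b - k)"
        using min[of "b - j" u] min[of "b - k" u] vw v u by (intro antisym) auto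
      moreover have "b - j < (b - k) + b" "b - k < (b - j) + b" using vw by linarith+
      ultimately have "b - j = b - k"
        using walk_inj[of "b - j" "b - k" ?f] walk_inj[of "b - k" "b - j" ?f] vw
        by (cases "b - j" "b - k" rule: linorder_cases) auto
      hence "j = k" using vw by simp
      thus ?thesis using v by simp
    qed
    thus "((\<lambda>(v, j). rotate j v) x = (\<lambda>(v, j). rotate j v) y) = (x = y)" by (auto simp: xy)
  next
    fix x assume "x \<in> dyck_words M \<times> {..<b}"
    then show "(\<lambda>(v, j). rotate j v) x \<in> permutations_of_multiset M"
      by (auto simp: dyck_words_def permutations_of_multiset_def mset_rotate_list)
  next
    fix u assume "u \<in> permutations_of_multiset M"
    hence um: "mset u = M" by (simp add: permutations_of_multiset_def)
    have u: "length u = b" "sum_list u = a" using um assms by (metis size_mset, metis sum_mset_sum_list)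
    let ?f = "\<lambda>i. u ! (i mod b)"
    have "\<exists>j\<in>{..<b}. \<forall>x\<in>{..<b}. walk ?f j \<le> walk ?f x"
    proof -
      have fin: "finite (walk ?f ` {..<b})" "walk ?f ` {..<b} \<noteq> {}" using bpos by auto
      from Min_in[OF fin] obtain j where "j < b" "walk ?f j = Min (walk ?f ` {..<b})" by auto
      thus ?thesis using Min_le[OF fin(1)] by (intro bexI[of _ j]) auto
    qed
    then obtain j where j: "j < b" "\<And>x. x < b \<Longrightarrow> walk ?f j \<le> walk ?f x" by auto
    have "0 \<le> level (rotate j u) s" if "s \<le> b" for s
      using level_rotate[OF u(1) that, of j] j(2)[of "(s + j) mod b"] red[OF u, of "s + j"] bpos by simp
    hence "rotate j u \<in> dyck_words M"
      using u um by (auto simp: dyck_words_def dyck_word_def sum_list_rotate mset_rotate_list)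
    moreover have "rotate ((b - j) mod b) (rotate j u) = u"
    proof -
      have "rotate ((b - j) mod b) (rotate j u) = rotate (b - j) (rotate j u)"
        using u(1) rotate_conv_mod[of "b - j" "rotate j u"] by simp
      also have "\<dots> = u" using u(1) j(1) by (simp add: rotate_rotate)
      finally show ?thesis .
    qed
    ultimately show "\<exists>x\<in>dyck_words M \<times> {..<b}. u = (\<lambda>(v, j). rotate j v) x"
      using bpos by (intro bexI[of _ "(rotate j u, (b - j) mod b)"]) auto
  qed
  from bij_betw_same_card[OF this] show ?thesis by (simp add: card_cartesian_product)
qed

text \<open>Seen from a central block of rank \<open>c > 0\<close> the other blocks open at the positions given by \<open>f\<close>,
  and the central block is put first; if the centre is a gap (\<open>c = 0\<close>) the circle is cut there.\<close>

definition insert_letter :: "nat \<Rightarrow> (nat \<Rightarrow> nat) \<Rightarrow> nat list" where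
  "insert_letter c f = map (\<lambda>p. if p = n then 0 else if p = 0 \<and> 0 < c then c else f p) [0..<b]"

lemma length_insert_letter [simp]: "length (insert_letter c f) = b"
  by (simp add: insert_letter_def)

lemma nth_insert_letter:
  "p < n \<Longrightarrow> insert_letter c f ! p = (if p = 0 \<and> 0 < c then c else f p)"
  "insert_letter c f ! n = 0"
proof -
  have "n < b" by (simp add: b_eq)
  thus "p < n \<Longrightarrow> insert_letter c f ! p = (if p = 0 \<and> 0 < c then c else f p)"
    "insert_letter c f ! n = 0" unfolding insert_letter_def by auto
qed

lemma sum_insert_letter:
  "sum_list (insert_letter c f) + (if 0 < c then f 0 else 0) = c + (\<Sum>i<n. f i)"
proof -
  have "sum_list (insert_letter c f) = (\<Sum>i<Suc n. insert_letter c f ! i)"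
    unfolding sum_list_sum_nth length_insert_letter lessThan_atLeast0 b_eq[symmetric] by simp
  also have "\<dots> = (\<Sum>i<n. if i = 0 \<and> 0 < c then c else f i)"
    by (simp add: nth_insert_letter)
  finally have e: "sum_list (insert_letter c f) = (\<Sum>i<n. if i = 0 \<and> 0 < c then c else f i)" .
  have "n = Suc (n - 1)" using n_pos by simp
  then obtain n' where n': "n = Suc n'" by blast
  show ?thesis unfolding e unfolding n' by (auto simp: sum.lessThan_Suc_shift simp del: sum.lessThan_Suc)
qed

lemma mset_insert_letter:
  assumes "0 < c \<Longrightarrow> f 0 = 0"
  shows "mset (insert_letter c f) = mset (map f [0..<n]) + {#c#}"
proof -
  have "n = Suc (n - 1)" using n_pos by simp
  then obtain n' where n': "n = Suc n'" by blast
  have "[0..<b] = 0 # map Suc [0..<n'] @ [Suc n']"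
    unfolding b_eq n' by (simp add: map_Suc_upt upt_conv_Cons del: upt_Suc) (simp add: upt_conv_Cons)
  moreover have "[0..<n] = 0 # map Suc [0..<n']"
    unfolding n' by (simp add: map_Suc_upt upt_conv_Cons del: upt_Suc)
  moreover have "map (\<lambda>p. if p = n then 0 else if p = 0 \<and> 0 < c then c else f p) (map Suc [0..<n'])
     = map f (map Suc [0..<n'])" by (auto simp: n')
  ultimately have "insert_letter c f = (if 0 < c then c else f 0) # map f (map Suc [0..<n']) @ [0]"
    "map f [0..<n] = f 0 # map f (map Suc [0..<n'])"
    unfolding insert_letter_def by (simp_all add: n')
  thus ?thesis using assms by auto
qed

lemma level_insert_letter:
  assumes "k \<le> n"
  shows "level (insert_letter c f) k = (if 0 < c \<and> 0 < k then int b * int c - int a + walk f k - walk f 1 else walk f k)"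
  using assms
proof (induction k)
  case (Suc k)
  then show ?case by (auto simp: level_Suc walk_Suc nth_insert_letter)
qed simp

text \<open>The drift gives \<open>c\<close> plus the sum of \<open>f\<close> over a period as
  \<open>a\<close>, which is also the sum of the Dyck word. So the letter overwritten by
  \<open>c\<close> must have been 0.\<close>

lemma insert_letter_first:
  assumes "dyck_word (insert_letter c f)" "walk f n = int a - int b * int c" "0 < c"
  shows "f 0 = 0"
proof -
  have "int b * int (\<Sum>i<n. f i) - int a * int n = int a - int b * int c" using assms(2) by (simp add: walk_sum)
  hence "int b * int (\<Sum>i<n. f i) = int b * (int a - int c)" using b_eq by (simp add: algebra_simps)
  hence "int (\<Sum>i<n. f i) = int a - int c" using a_less by simp
  moreover have "a + f 0 = c + (\<Sum>i<n. f i)" using sum_insert_letter[of c f] assms by (simp add: dyck_word_def)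
  ultimately show ?thesis by linarith
qed

section \<open>Rotating a word between starting points at its centre\<close>

text \<open>Labels 1 and \<open>1 + j\<close> share a block, so by \<open>noncrossing\<close> every
  other block stays on one side of \<open>1 + j\<close> and opens at the same place whichever of the
  two starts the reading. The word is shifted cyclically, except that the central letter stays in
  front and its shifted place becomes 0.\<close>

lemma turn_pow_central:
  assumes dw: "dyck_word v" and j: "j < n" and s: "sib v 1 (1 + int j)" and p: "p < n"
  shows "(turn ^^ j) v ! p = (if p = 0 then v ! 0 else if (p + j) mod n = 0 then 0 else v ! ((p + j) mod n))"
proof -
  define q where "q = (p + j) mod n"
  have qn: "q < n" using n_pos by (simp add: q_def)
  have u: "(turn ^^ j) v ! p = (if \<exists>k. 1 \<le> k \<and> k \<le> int p \<and> sib v (k + int j) (int p + 1 + int j) then 0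
      else rk v (int p + 1 + int j))"
    using nth_eq_rk[OF dyck_turn_pow[OF dw, of j] p] unfolding sib_turn_pow[OF dw] rk_turn_pow[OF dw] .
  have w: "v ! q = (if \<exists>k. 1 \<le> k \<and> k \<le> int q \<and> sib v k (int q + 1) then 0 else rk v (int q + 1))"
    by (rule nth_eq_rk[OF dw qn])
  show ?thesis
  proof (cases "p = 0")
    case True
    have "rk v (1 + int j) = rk v 1" using s by (simp add: rk_def sib_def)
    also have "\<dots> = v ! 0" using nth_eq_rk[OF dw n_pos] by auto
    finally show ?thesis using u True by (auto simp: add.commute)
  next
    case False
    show ?thesis
    proof (cases "p + j < n")
      case True
      hence q: "q = p + j" by (simp add: q_def)
      have "(\<exists>k. 1 \<le> k \<and> k \<le> int p \<and> sib v (k + int j) (int q + 1)) \<longleftrightarrow> (\<exists>k. 1 \<le> k \<and> k \<le> int q \<and> sib v k (int q + 1))"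
      proof
        assume "\<exists>k. 1 \<le> k \<and> k \<le> int p \<and> sib v (k + int j) (int q + 1)"
        then obtain k where "1 \<le> k \<and> k \<le> int p \<and> sib v (k + int j) (int q + 1)" by blast
        thus "\<exists>k. 1 \<le> k \<and> k \<le> int q \<and> sib v k (int q + 1)" using q by (intro exI[of _ "k + int j"]) auto
      next
        assume "\<exists>k. 1 \<le> k \<and> k \<le> int q \<and> sib v k (int q + 1)"
        then obtain k where k: "1 \<le> k" "k \<le> int q" "sib v k (int q + 1)" by blast
        \<comment> \<open>An earlier sibling on the other side of \<open>1 + j\<close> would cross
          the central block and hence belong to it; for the central block itself
          \<open>1 + j\<close> is an earlier sibling.\<close>
        consider "k > int j" | "k \<le> int j" "sib v 1 (int q + 1)" | "k \<le> int j" "\<not> sib v 1 (int q + 1)" by linarith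
        thus "\<exists>k. 1 \<le> k \<and> k \<le> int p \<and> sib v (k + int j) (int q + 1)"
        proof cases
          case 1
          then show ?thesis using k q by (intro exI[of _ "k - int j"]) auto
        next
          case 2
          then show ?thesis using s False by (intro exI[of _ 1]) (auto simp: sib_def)
        next
          case 3
          have "k \<noteq> 1" using 3 k by auto
          hence "sib v 1 k" using 3 k False q qn
            by (intro noncrossing[OF dw, of 1 k "1 + int j" "int q + 1"]) (auto simp: s)
          thus ?thesis using 3 k sib_trans by blast
        qed
      qed
      moreover have e: "int p + 1 + int j = int q + 1" using q by simp
      ultimately show ?thesis using u w False q unfolding e by (simp add: q_def[symmetric])
    next
      case ge: False
      have q: "int q = int p + int j - int n" "q < j" "q = p + j - n"
        using ge p j by (auto simp: q_def le_mod_geq mod_if)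
      have "int p + 1 + int j = (int q + 1) + int n" using q(1) by linarith
      hence lq: "lab (int p + 1 + int j) = lab (int q + 1)" by (simp only: lab_add_n)
      have sq: "sib v x (int p + 1 + int j) \<longleftrightarrow> sib v x (int q + 1)" for x by (simp add: sib_def lq)
      have rq: "rk v (int p + 1 + int j) = rk v (int q + 1)" by (simp add: rk_def lq)
      show ?thesis
      proof (cases "q = 0")
        case True
        have "\<exists>k. 1 \<le> k \<and> k \<le> int p \<and> sib v (k + int j) (int p + 1 + int j)"
          unfolding sq using s False True by (intro exI[of _ 1]) (auto simp: sib_def)
        thus ?thesis using u True False by (simp add: q_def)
      next
        case q0: False
        have "(\<exists>k. 1 \<le> k \<and> k \<le> int p \<and> sib v (k + int j) (int q + 1)) \<longleftrightarrow> (\<exists>k. 1 \<le> k \<and> k \<le> int q \<and> sib v k (int q + 1))"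
        proof
          assume "\<exists>k. 1 \<le> k \<and> k \<le> int q \<and> sib v k (int q + 1)"
          then obtain k where k: "1 \<le> k" "k \<le> int q" "sib v k (int q + 1)" by blast
          thus "\<exists>k. 1 \<le> k \<and> k \<le> int p \<and> sib v (k + int j) (int q + 1)"
            using q j by (intro exI[of _ "k + int n - int j"]) auto
        next
          assume "\<exists>k. 1 \<le> k \<and> k \<le> int p \<and> sib v (k + int j) (int q + 1)"
          then obtain k where k: "1 \<le> k" "k \<le> int p" "sib v (k + int j) (int q + 1)" by blast
          consider "k + int j > int n" | "sib v 1 (int q + 1)" | "k + int j \<le> int n" "\<not> sib v 1 (int q + 1)" by linarith
          thus "\<exists>k. 1 \<le> k \<and> k \<le> int q \<and> sib v k (int q + 1)"
          proof cases
            case 1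
            have "sib v (k + int j - int n) (int q + 1)"
              using k(3) sib_add_n(1)[of v "k + int j - int n"] by simp
            then show ?thesis using 1 k q by (intro exI[of _ "k + int j - int n"]) auto
          next
            case 2
            then show ?thesis using q0 by (intro exI[of _ 1]) auto
          next
            case 3
            have "k \<noteq> 1" using 3 k s sib_trans[of v 1 "1 + int j" "int q + 1"] by auto
            hence "sib v 1 (int q + 1)" using 3 k q0 q
              by (intro noncrossing[OF dw, of 1 "int q + 1" "1 + int j" "k + int j"]) (auto simp: s sib_sym)
            thus ?thesis using 3 by blast
          qed
        qed
        thus ?thesis using u w q0 False unfolding sq rq by (simp add: q_def[symmetric])
      qed
    qed
  qed
qed

text \<open>No block meets both \<open>{1..j}\<close> and \<open>{j+1..n}\<close>, so reading from
  \<open>1 + j\<close> leaves the first element of every block unchanged.\<close>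

lemma turn_pow_cut:
  assumes dw: "dyck_word v" and j: "j < n" and p: "p < n"
    and s: "\<And>x y. 1 \<le> x \<Longrightarrow> x \<le> int j \<Longrightarrow> int j < y \<Longrightarrow> y \<le> int n \<Longrightarrow> \<not> sib v x y"
  shows "(turn ^^ j) v ! p = v ! ((p + j) mod n)"
proof -
  define q where "q = (p + j) mod n"
  have qn: "q < n" using n_pos by (simp add: q_def)
  have u: "(turn ^^ j) v ! p = (if \<exists>k. 1 \<le> k \<and> k \<le> int p \<and> sib v (k + int j) (int p + 1 + int j) then 0
      else rk v (int p + 1 + int j))"
    using nth_eq_rk[OF dyck_turn_pow[OF dw, of j] p] unfolding sib_turn_pow[OF dw] rk_turn_pow[OF dw] .
  have w: "v ! q = (if \<exists>k. 1 \<le> k \<and> k \<le> int q \<and> sib v k (int q + 1) then 0 else rk v (int q + 1))"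
    by (rule nth_eq_rk[OF dw qn])
  show ?thesis
  proof (cases "p + j < n")
    case True
    hence q: "q = p + j" by (simp add: q_def)
    have "(\<exists>k. 1 \<le> k \<and> k \<le> int p \<and> sib v (k + int j) (int q + 1)) \<longleftrightarrow> (\<exists>k. 1 \<le> k \<and> k \<le> int q \<and> sib v k (int q + 1))"
    proof
      assume "\<exists>k. 1 \<le> k \<and> k \<le> int p \<and> sib v (k + int j) (int q + 1)"
      then obtain k where "1 \<le> k \<and> k \<le> int p \<and> sib v (k + int j) (int q + 1)" by blast
      thus "\<exists>k. 1 \<le> k \<and> k \<le> int q \<and> sib v k (int q + 1)" using q by (intro exI[of _ "k + int j"]) auto
    next
      assume "\<exists>k. 1 \<le> k \<and> k \<le> int q \<and> sib v k (int q + 1)"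
      then obtain k where k: "1 \<le> k" "k \<le> int q" "sib v k (int q + 1)" by blast
      have "int j < k" using s[of k "int q + 1"] k q qn by fastforce
      thus "\<exists>k. 1 \<le> k \<and> k \<le> int p \<and> sib v (k + int j) (int q + 1)"
        using k q by (intro exI[of _ "k - int j"]) auto
    qed
    moreover have e: "int p + 1 + int j = int q + 1" using q by simp
    ultimately show ?thesis using u w unfolding e by (simp add: q_def[symmetric])
  next
    case ge: False
    have q: "int q = int p + int j - int n" "q < j" "q = p + j - n"
      using ge p j by (auto simp: q_def le_mod_geq mod_if)
    have "int p + 1 + int j = (int q + 1) + int n" using q(1) by linarith
    hence lq: "lab (int p + 1 + int j) = lab (int q + 1)" by (simp only: lab_add_n)
    have sq: "sib v x (int p + 1 + int j) \<longleftrightarrow> sib v x (int q + 1)" for x by (simp add: sib_def lq)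
    have rq: "rk v (int p + 1 + int j) = rk v (int q + 1)" by (simp add: rk_def lq)
    have "(\<exists>k. 1 \<le> k \<and> k \<le> int p \<and> sib v (k + int j) (int q + 1)) \<longleftrightarrow> (\<exists>k. 1 \<le> k \<and> k \<le> int q \<and> sib v k (int q + 1))"
    proof
      assume "\<exists>k. 1 \<le> k \<and> k \<le> int q \<and> sib v k (int q + 1)"
      then obtain k where k: "1 \<le> k" "k \<le> int q" "sib v k (int q + 1)" by blast
      thus "\<exists>k. 1 \<le> k \<and> k \<le> int p \<and> sib v (k + int j) (int q + 1)"
        using q j by (intro exI[of _ "k + int n - int j"]) auto
    next
      assume "\<exists>k. 1 \<le> k \<and> k \<le> int p \<and> sib v (k + int j) (int q + 1)"
      then obtain k where k: "1 \<le> k" "k \<le> int p" "sib v (k + int j) (int q + 1)" by blast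
      have "int n < k + int j"
        using s[of "int q + 1" "k + int j"] k q(2) sib_sym by fastforce
      moreover have "sib v (k + int j - int n) (int q + 1)"
        using k(3) sib_add_n(1)[of v "k + int j - int n"] by simp
      ultimately show "\<exists>k. 1 \<le> k \<and> k \<le> int q \<and> sib v k (int q + 1)"
        using k q by (intro exI[of _ "k + int j - int n"]) auto
    qed
    thus ?thesis using u w unfolding sq rq by (simp add: q_def[symmetric])
  qed
qed

section \<open>Different starting points of one periodic sequence\<close>

lemma sib_1_iff:
  assumes "dyck_word v" "j < n"
  shows "sib v 1 (1 + int j) \<longleftrightarrow> (\<forall>s. 1 \<le> s \<and> s \<le> j \<longrightarrow> level v (Suc j) < level v s)"
proof -
  have l: "lab 1 = 1" "lab (1 + int j) = Suc j" using assms(2) by (auto simp: lab_id)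
  have p1: "par v 1 = 0" using par_less[OF assms(1), of 1] n_pos b_eq by simp
  have r: "0 < Suc j" "Suc j < b" using assms(2) b_eq by auto
  show ?thesis
  proof
    assume "sib v 1 (1 + int j)"
    hence "par v (Suc j) = 0" using l p1 by (simp add: sib_def)
    thus "\<forall>s. 1 \<le> s \<and> s \<le> j \<longrightarrow> level v (Suc j) < level v s"
      using par_between[OF assms(1) r] by auto
  next
    assume *: "\<forall>s. 1 \<le> s \<and> s \<le> j \<longrightarrow> level v (Suc j) < level v s"
    have "par v (Suc j) = 0"
      by (rule par_eqI) (use * level_pos[OF assms(1) r] in \<open>auto simp: order.strict_implies_order\<close>)
    thus "sib v 1 (1 + int j)" using l p1 by (simp add: sib_def)
  qed
qed

text \<open>The Dyck condition for the start \<open>j\<close>, applied to position \<open>s\<close>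
  one period later, compares \<open>walk f s\<close> plus the drift \<open>a - b c\<close> with
  \<open>walk f (Suc j)\<close>. The constant \<open>b c - a\<close> of the central letter cancels
  the drift, so \<open>Suc j\<close> is a strict record minimum, that is, a child of 0.\<close>

lemma insert_letter_central:
  assumes per: "\<And>i. f (i + n) = f i" and tot: "walk f n = int a - int b * int c" and c: "0 < c"
    and v: "dyck_word (insert_letter c f)" and v': "dyck_word (insert_letter c (\<lambda>i. f (i + j)))"
    and j: "j < n"
  shows "sib (insert_letter c f) 1 (1 + int j)"
  unfolding sib_1_iff[OF v j]
proof (intro allI impI)
  fix s assume s: "1 \<le> s \<and> s \<le> j"
  define k where "k = s + n - j"
  have k: "0 < k" "k \<le> n" "k + j = s + n" using s j by (auto simp: k_def)
  have "0 < level (insert_letter c (\<lambda>i. f (i + j))) k" using k b_eq by (intro level_pos[OF v']) auto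
  also have "level (insert_letter c (\<lambda>i. f (i + j))) k
      = int b * int c - int a + walk (\<lambda>i. f (i + j)) k - walk (\<lambda>i. f (i + j)) 1"
    using k c by (simp add: level_insert_letter)
  also have "\<dots> = int b * int c - int a + walk f (s + n) - walk f (Suc j)"
    using walk_shift[of f j k] walk_shift[of f j 1] k by simp
  also have "walk f (s + n) = walk f s + (int a - int b * int c)"
    using walk_add_period[of f n s] per tot by simp
  finally have "walk f (Suc j) < walk f s" by simp
  thus "level (insert_letter c f) (Suc j) < level (insert_letter c f) s"
    using s j c by (simp add: level_insert_letter)
qed

text \<open>Being a Dyck start, \<open>j\<close> lies below every later position up to
  \<open>n\<close>. Parents of labels beyond \<open>j\<close> are thus at least \<open>j\<close>,
  while those of labels up to \<open>j\<close> are smaller.\<close>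

lemma insert_letter_cut:
  assumes v: "dyck_word (insert_letter 0 f)" and v': "dyck_word (insert_letter 0 (\<lambda>i. f (i + j)))"
    and j: "j < n" and xy: "1 \<le> x" "x \<le> int j" "int j < y" "y \<le> int n"
  shows "\<not> sib (insert_letter 0 f) x y"
proof
  let ?v = "insert_letter 0 f"
  assume s: "sib ?v x y"
  have l: "lab x = nat x" "lab y = nat y" using xy j by (auto simp: lab_id)
  have rx: "0 < nat x" "nat x < b" "0 < nat y" "nat y < b" using xy j b_eq by auto
  have "0 < level (insert_letter 0 (\<lambda>i. f (i + j))) (nat y - j)"
    using xy b_eq by (intro level_pos[OF v']) auto
  moreover have "nat y - j \<le> n" "nat y - j + j = nat y" "nat y \<le> n" "j \<le> n" using xy j by auto
  ultimately have "level ?v j < level ?v (nat y)"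
    using walk_shift[of f j "nat y - j"] by (simp add: level_insert_letter)
  hence "j \<le> par ?v (nat y)"
    using par_between[OF v rx(3,4), of j] xy by fastforce
  moreover have "par ?v (nat x) < nat x" by (rule par_less[OF v rx(1,2)])
  ultimately show False using s l xy by (simp add: sib_def)
qed

lemma turn_insert_letter_central:
  assumes per: "\<And>i. f (i + n) = f i" and tot: "walk f n = int a - int b * int c" and c: "0 < c"
    and v: "dyck_word (insert_letter c f)" and j: "j < n" and s: "sib (insert_letter c f) 1 (1 + int j)"
  shows "(turn ^^ j) (insert_letter c f) = insert_letter c (\<lambda>i. f (i + j))"
proof (rule nth_equalityI)
  note du = dyck_turn_pow[OF v, of j]
  show "length ((turn ^^ j) (insert_letter c f)) = length (insert_letter c (\<lambda>i. f (i + j)))"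
    using du by (simp add: dyck_word_def)
  fix p assume "p < length ((turn ^^ j) (insert_letter c f))"
  hence "p < b" using du by (simp add: dyck_word_def)
  hence "p < n \<or> p = n" using b_eq by linarith
  moreover have "(turn ^^ j) (insert_letter c f) ! p = insert_letter c (\<lambda>i. f (i + j)) ! p" if p: "p < n"
  proof -
    have "f 0 = 0" by (rule insert_letter_first[OF v tot c])
    moreover have "f ((p + j) mod n) = f (p + j)" by (rule periodic_mod) (rule per)
    ultimately show ?thesis
      using turn_pow_central[OF v j s p] p c n_pos
      by (cases "(p + j) mod n = 0") (auto simp: nth_insert_letter)
  qed
  ultimately show "(turn ^^ j) (insert_letter c f) ! p = insert_letter c (\<lambda>i. f (i + j)) ! p"
    using last_zero[OF du] nth_insert_letter(2) by auto
qed

lemma turn_insert_letter_cut: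
  assumes per: "\<And>i. f (i + n) = f i"
    and v: "dyck_word (insert_letter 0 f)" and j: "j < n"
    and s: "\<And>x y. 1 \<le> x \<Longrightarrow> x \<le> int j \<Longrightarrow> int j < y \<Longrightarrow> y \<le> int n \<Longrightarrow> \<not> sib (insert_letter 0 f) x y"
  shows "(turn ^^ j) (insert_letter 0 f) = insert_letter 0 (\<lambda>i. f (i + j))"
proof (rule nth_equalityI)
  note du = dyck_turn_pow[OF v, of j]
  show "length ((turn ^^ j) (insert_letter 0 f)) = length (insert_letter 0 (\<lambda>i. f (i + j)))"
    using du by (simp add: dyck_word_def)
  fix p assume "p < length ((turn ^^ j) (insert_letter 0 f))"
  hence "p < b" using du by (simp add: dyck_word_def)
  hence "p < n \<or> p = n" using b_eq by linarith
  moreover have "(turn ^^ j) (insert_letter 0 f) ! p = insert_letter 0 (\<lambda>i. f (i + j)) ! p" if p: "p < n"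
  proof -
    have "f ((p + j) mod n) = f (p + j)" by (rule periodic_mod) (rule per)
    thus ?thesis
      using turn_pow_cut[OF v j p s] p n_pos by (simp add: nth_insert_letter)
  qed
  ultimately show "(turn ^^ j) (insert_letter 0 f) ! p = insert_letter 0 (\<lambda>i. f (i + j)) ! p"
    using last_zero[OF du] nth_insert_letter(2) by auto
qed

text \<open>Whenever two starting points of the same periodic sequence both give Dyck words, these
  words are rotations of each other. Only \<open>j\<close> modulo \<open>n\<close> matters, on both
  sides.\<close>

lemma turn_insert_letter:
  assumes per: "\<And>i. f (i + n) = f i" and tot: "walk f n = int a - int b * int c"
    and v: "dyck_word (insert_letter c f)" and v': "dyck_word (insert_letter c (\<lambda>i. f (i + j)))"
  shows "(turn ^^ j) (insert_letter c f) = insert_letter c (\<lambda>i. f (i + j))"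
proof -
  define r where "r = j mod n"
  have r: "r < n" using n_pos by (simp add: r_def)
  have "j = r + n * (j div n)" by (simp add: r_def)
  hence t: "(turn ^^ j) (insert_letter c f) = (turn ^^ r) (insert_letter c f)"
    using turn_pow_nmult[OF v] by (metis comp_apply funpow_add)
  have "(i + j) mod n = (i + r) mod n" for i by (simp add: r_def mod_add_right_eq)
  hence f: "(\<lambda>i. f (i + j)) = (\<lambda>i. f (i + r))"
    using periodic_mod[of f n, OF per] by metis
  show ?thesis
  proof (cases "0 < c")
    case True
    then show ?thesis
      unfolding t f using insert_letter_central[OF per tot True v, of r] v' r
      by (intro turn_insert_letter_central[OF per tot True v r]) (auto simp: f)
  next
    case False
    hence c: "c = 0" by simp
    show ?thesis unfolding t f unfolding c
      by (rule turn_insert_letter_cut) (use per v v' r insert_letter_cut[of f r] in \<open>auto simp: c f\<close>)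
  qed
qed

lemma dyck_insert_letterI:
  assumes tot: "walk f n = int a - int b * int c" and c0: "0 < c \<Longrightarrow> f 0 = 0"
    and pos: "\<And>k. 0 < k \<Longrightarrow> k \<le> n \<Longrightarrow> 0 \<le> level (insert_letter c f) k"
  shows "dyck_word (insert_letter c f)"
proof -
  let ?v = "insert_letter c f"
  have "int b * int (\<Sum>i<n. f i) - int a * int n = int a - int b * int c" using tot by (simp add: walk_sum)
  hence "int b * int (\<Sum>i<n. f i) = int b * (int a - int c)" using b_eq by (simp add: algebra_simps)
  hence "int (\<Sum>i<n. f i) = int a - int c" using a_less by simp
  moreover have "sum_list ?v = c + (\<Sum>i<n. f i)" using sum_insert_letter[of c f] c0 by (simp split: if_splits)
  ultimately have sm: "sum_list ?v = a" by linarith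
  have "(\<Sum>i<b. ?v ! i) = a" using sm by (simp add: sum_list_sum_nth lessThan_atLeast0)
  hence "(\<Sum>i<b. int (?v ! i)) = int a" by (metis of_nat_sum)
  hence "level ?v b = 0" by (simp add: level_def)
  moreover have "s = 0 \<or> 0 < s \<and> s \<le> n \<or> s = b" if "s \<le> b" for s using that b_eq by linarith
  ultimately have "0 \<le> level ?v s" if "s \<le> b" for s using that pos by (metis level_0 order_refl)
  thus ?thesis using sm by (simp add: dyck_word_def)
qed

text \<open>The starting point is a strict record of the periodic walk: a new minimum if the drift is
  negative, the last visit below a given height if it is positive.\<close>

lemma ex_dyck_insert_letter:
  assumes per: "\<And>i. f (i + n) = f i" and tot: "walk f n = int a - int b * int c"
  shows "\<exists>j. dyck_word (insert_letter c (\<lambda>i. f (i + j)))"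
proof (cases "0 < c")
  case True
  have neg: "walk f n < 0"
  proof -
    have "int b * 1 \<le> int b * int c" using True by (intro mult_left_mono) auto
    thus ?thesis using tot a_less by linarith
  qed
  define \<mu> where "\<mu> = Min (walk f ` {..n})"
  have mu: "\<mu> \<le> walk f s" if "s \<le> n" for s unfolding \<mu>_def using that by (intro Min_le) auto
  have "\<mu> \<in> walk f ` {..n}" unfolding \<mu>_def by (intro Min_in) auto
  then obtain s0 where "walk f s0 = \<mu>" by auto
  hence ex: "walk f (s0 + n) < \<mu>" using neg walk_add_period[of f n s0] per by simp
  \<comment> \<open>The first value below the minimum over a whole period is a strict record with a
    full period before it; the central letter is placed on the step leading down to it.\<close>
  define t where "t = (LEAST t. walk f t < \<mu>)"
  have t: "walk f t < \<mu>" unfolding t_def by (rule LeastI[of "\<lambda>t. walk f t < \<mu>", OF ex])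
  have lt: "\<mu> \<le> walk f s" if "s < t" for s using not_less_Least[of s "\<lambda>t. walk f t < \<mu>"] that by (auto simp: t_def)
  have tn: "n < t" using t mu by (meson leD leI)
  define j where "j = t - 1"
  have j: "t = Suc j" "n \<le> j" using tn by (auto simp: j_def)
  \<comment> \<open>As \<open>a < b\<close>, only a zero letter lets the walk descend, so position
    \<open>j\<close> is free for the letter \<open>c\<close>.\<close>
  have fj: "f j = 0"
  proof (rule ccontr)
    assume "f j \<noteq> 0"
    hence "int b * 1 \<le> int b * int (f j)" by (intro mult_left_mono) auto
    hence "walk f j < walk f t" using a_less unfolding j(1) walk_Suc by linarith
    thus False using t lt[of j] j by simp
  qed
  have tot': "walk (\<lambda>i. f (i + j)) n = int a - int b * int c"
    using walk_shift[of f j n] walk_add_period[of f n j] per tot by (simp add: add.commute)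
  have "dyck_word (insert_letter c (\<lambda>i. f (i + j)))"
  proof (rule dyck_insert_letterI[OF tot'])
    show "f (0 + j) = 0" using fj by simp
    fix k assume k: "0 < k" "k \<le> n"
    define q where "q = k + j - n"
    have q: "k + j = q + n" "q < t" using j k by (auto simp: q_def)
    have "walk f (k + j) = walk f q + (int a - int b * int c)"
      unfolding q(1) using walk_add_period[of f n q] per tot by simp
    moreover have "walk f t \<le> walk f q" using lt[OF q(2)] t by simp
    ultimately show "0 \<le> level (insert_letter c (\<lambda>i. f (i + j))) k"
      using k True walk_shift[of f j k] walk_shift[of f j 1] by (simp add: level_insert_letter j)
  qed
  then show ?thesis by blast
next
  case False
  hence c: "c = 0" by simp
  have tot0: "walk f n = int a" using tot c by simp
  \<comment> \<open>The drift \<open>a\<close> per period is positive, so the walk is eventually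
    positive and the \<open>GREATEST\<close> below is meaningful.\<close>
  have bound: "0 < walk f s" if s: "s > n * nat (\<bar>Min (walk f ` {..<n})\<bar> + 1)" for s
  proof -
    let ?K = "nat (\<bar>Min (walk f ` {..<n})\<bar> + 1)"
    have "walk f s = walk f (s mod n) + int (s div n) * walk f n"
      using walk_add_mult_period[of f n "s mod n" "s div n"] per by (simp add: add.commute)
    moreover have "Min (walk f ` {..<n}) \<le> walk f (s mod n)" using n_pos by (intro Min_le) auto
    moreover have "?K \<le> s div n" using s n_pos by (simp add: less_eq_div_iff_mult_less_eq mult.commute)
    moreover have "int (s div n) * 1 \<le> int (s div n) * walk f n" using tot0 a_pos by (intro mult_left_mono) auto
    ultimately show ?thesis by linarith
  qed
  let ?P = "\<lambda>t. walk f t \<le> 0"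
  define j where "j = (GREATEST t. ?P t)"
  have j: "?P j" unfolding j_def by (rule GreatestI_nat[of ?P 0]) (use bound in \<open>auto simp: not_less[symmetric]\<close>)
  have gt: "0 < walk f s" if "j < s" for s
    using Greatest_le_nat[of ?P s] bound that unfolding j_def by (meson leD leI)
  have tot': "walk (\<lambda>i. f (i + j)) n = int a - int b * int c"
    using walk_shift[of f j n] walk_add_period[of f n j] per tot by (simp add: add.commute)
  have "dyck_word (insert_letter c (\<lambda>i. f (i + j)))"
  proof (rule dyck_insert_letterI[OF tot'])
    fix k assume k: "0 < k" "k \<le> n"
    have "0 < walk f (k + j)" using k by (intro gt) auto
    thus "0 \<le> level (insert_letter c (\<lambda>i. f (i + j))) k"
      using k c walk_shift[of f j k] j by (simp add: level_insert_letter)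
  qed (use c in auto)
  then show ?thesis by blast
qed

end

subsection \<open>Words fixed by a power of the rotation\<close>

text \<open>Multiplicities modulo \<open>d\<close> reveal the single extra letter. Thus the letters
  of a fixed word determine the rank of its centre and the letters of one period.\<close>

lemma repeat_mset_add_single_eqD:
  assumes "repeat_mset d A + {#x#} = repeat_mset d B + {#y#}" "2 \<le> d"
  shows "A = B \<and> x = y"
proof -
  have c: "d * count A z + (if z = x then 1 else 0) = d * count B z + (if z = y then 1 else 0)" for z
    using arg_cong[OF assms(1), of "\<lambda>M. count M z"] by (auto split: if_splits)
  have "x = y"
  proof (rule ccontr)
    assume "x \<noteq> y"
    hence "d * count A x + 1 = d * count B x" using c[of x] by simp
    hence "d dvd 1" by (metis dvd_add_right_iff dvd_triv_left)
    thus False using assms(2) by simp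
  qed
  moreover have "count A z = count B z" for z using c[of z] \<open>x = y\<close> assms(2) by auto
  ultimately show ?thesis by (simp add: multiset_eqI)
qed

lemma mset_map_periodic:
  assumes "length u = m"
  shows "mset (map (\<lambda>i. u ! (i mod m)) [0..<d * m]) = repeat_mset d (mset u)"
proof (induction d)
  case (Suc d)
  have "[0..<Suc d * m] = [0..<d * m] @ map (\<lambda>i. i + d * m) [0..<m]"
    using upt_add_eq_append[of 0 "d * m" m] map_add_upt[of "d * m" m] by (simp add: add.commute)
  moreover have "map (\<lambda>i. u ! (i mod m)) (map (\<lambda>i. i + d * m) [0..<m]) = u"
    using assms by (auto simp: list_eq_iff_nth_eq)
  ultimately have "mset (map (\<lambda>i. u ! (i mod m)) [0..<Suc d * m]) = mset (map (\<lambda>i. u ! (i mod m)) [0..<d * m]) + mset u"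
    by (simp del: map_map)
  then show ?case using Suc by simp
qed simp

text \<open>A bijection given only as a relation, for correspondences whose definition involves a
  non-canonical choice.\<close>

lemma card_eq_by_relation:
  assumes "finite B"
    and "\<And>x. x \<in> A \<Longrightarrow> \<exists>y\<in>B. Q x y" and "\<And>y. y \<in> B \<Longrightarrow> \<exists>x\<in>A. Q x y"
    and "\<And>x y y'. x \<in> A \<Longrightarrow> y \<in> B \<Longrightarrow> y' \<in> B \<Longrightarrow> Q x y \<Longrightarrow> Q x y' \<Longrightarrow> y = y'"
    and "\<And>x x' y. x \<in> A \<Longrightarrow> x' \<in> A \<Longrightarrow> y \<in> B \<Longrightarrow> Q x y \<Longrightarrow> Q x' y \<Longrightarrow> x = x'"
  shows "card A = card B"
proof -
  define g where "g x = (SOME y. y \<in> B \<and> Q x y)" for x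
  have g: "g x \<in> B \<and> Q x (g x)" if "x \<in> A" for x
    unfolding g_def by (rule someI_ex) (use assms(2)[OF that] in blast)
  have "bij_betw g A B"
    unfolding bij_betw_def inj_on_def using g assms(3-5) by (auto simp: image_iff) metis+
  thus ?thesis by (rule bij_betw_same_card)
qed

locale periodic_words = coprime_pair +
  fixes m d :: nat
  assumes n_eq: "n = d * m" and d_ge: "2 \<le> d"
begin

section \<open>The centre of a partition invariant under the shift by \<open>m\<close>\<close>

lemma m_bounds: "0 < m" "2 * m \<le> n" "m < n"
proof -
  show "0 < m" using n_pos n_eq by (cases m) auto
  show "2 * m \<le> n" unfolding n_eq using d_ge by (intro mult_right_mono) auto
  thus "m < n" using \<open>0 < m\<close> by linarith
qed

text \<open>First and last element of a block on the unrolled circle, for a block that fits into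
  fewer than \<open>m\<close> consecutive positions.\<close>

definition arc :: "nat list \<Rightarrow> int \<Rightarrow> int \<Rightarrow> bool" where
  "arc v f l \<longleftrightarrow> f \<le> l \<and> l < f + int m \<and> sib v f l \<and> (\<forall>x. l < x \<and> x < f + int n \<longrightarrow> \<not> sib v x f)"

lemma sib_shift_mult:
  assumes "\<And>x y. sib v (x + int m) (y + int m) = sib v x y"
  shows "sib v (x + int k * int m) (y + int k * int m) = sib v x y"
proof (induction k)
  case (Suc k)
  have "sib v (x + int (Suc k) * int m) (y + int (Suc k) * int m) =
     sib v ((x + int k * int m) + int m) ((y + int k * int m) + int m)" by (simp add: algebra_simps)
  also have "\<dots> = sib v (x + int k * int m) (y + int k * int m)" by (rule assms)
  finally show ?case using Suc by simp
qed simp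

text \<open>A block different from its translate by \<open>m\<close> must be short: spread over a
  longer stretch it would cross that translate.\<close>

lemma ex_arc:
  assumes dw: "dyck_word v" and inv: "\<And>x y. sib v (x + int m) (y + int m) = sib v x y"
    and i: "\<not> sib v i (i + int m)"
  shows "\<exists>f l. arc v f l \<and> sib v f i"
proof -
  define c where "c = Max {x. i \<le> x \<and> x \<le> i + int m \<and> sib v x i}"
  have fin: "finite {x. i \<le> x \<and> x \<le> i + int m \<and> sib v x i}"
    by (rule finite_subset[of _ "{i..i + int m}"]) auto
  have "c \<in> {x. i \<le> x \<and> x \<le> i + int m \<and> sib v x i}"
    unfolding c_def by (rule Max_in[OF fin]) (auto simp: sib_refl intro: exI[of _ i])
  hence c: "i \<le> c" "c \<le> i + int m" "sib v c i" by auto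
  have cmax: "\<not> sib v x i" if "c < x" "x \<le> i + int m" for x
    using Max_ge[OF fin, of x] that c unfolding c_def[symmetric] by fastforce
  have ig: "c < i + int m" using c i sib_sym by (metis order_le_imp_less_or_eq)
  \<comment> \<open>A further element \<open>x\<close> would give
    \<open>c < i + m < x < x + m\<close> with \<open>c\<close>, \<open>x\<close> in the block and
    \<open>i + m\<close>, \<open>x + m\<close> in its translate.\<close>
  have gap: "\<not> sib v x i" if x: "c < x" "x \<le> c + int n - int m" for x
  proof
    assume s: "sib v x i"
    have xg: "i + int m < x" using cmax[of x] x s by force
    have gx: "sib v (i + int m) (x + int m)" using inv s sib_sym by blast
    have "x + int m \<noteq> c + int n"
    proof
      assume "x + int m = c + int n"
      hence "sib v (i + int m) (c + int n)" using gx by simp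
      hence "sib v (i + int m) i" using c(3) sib_trans by (metis sib_add_n(2))
      thus False using i sib_sym by blast
    qed
    hence "sib v c (i + int m)"
      using x xg ig m_bounds s c(3) gx
      by (intro noncrossing[OF dw, of c "i + int m" x "x + int m"]) (auto intro: sib_trans sib_sym)
    thus False using c(3) i sib_trans sib_sym by blast
  qed
  define f where "f = Min {x. c - int m < x \<and> x \<le> c \<and> sib v x i}"
  have fin2: "finite {x. c - int m < x \<and> x \<le> c \<and> sib v x i}"
    by (rule finite_subset[of _ "{c - int m..c}"]) auto
  have "f \<in> {x. c - int m < x \<and> x \<le> c \<and> sib v x i}"
    unfolding f_def by (rule Min_in[OF fin2]) (use c m_bounds in \<open>auto intro!: exI[of _ c]\<close>)
  hence f: "c - int m < f" "f \<le> c" "sib v f i" by auto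
  have fmin: "f \<le> x" if "c - int m < x" "x \<le> c" "sib v x i" for x
    unfolding f_def using that by (intro Min_le[OF fin2]) auto
  have "arc v f c"
    unfolding arc_def
  proof (intro conjI allI impI)
    show "f \<le> c" "c < f + int m" using f by auto
    show "sib v f c" using f c sib_trans sib_sym by blast
    fix x assume x: "c < x \<and> x < f + int n"
    show "\<not> sib v x f"
    proof
      assume "sib v x f"
      hence s: "sib v x i" using f(3) sib_trans by blast
      hence "c + int n - int m < x" using gap x by force
      moreover have "sib v (x - int n) i" using s sib_add_n(1)[of v "x - int n" i] by simp
      ultimately have "f \<le> x - int n" using x f by (intro fmin) auto
      thus False using x by simp
    qed
  qed
  thus ?thesis using f(3) by blast
qed

lemma arc_shift:
  assumes "\<And>x y. sib v (x + int m) (y + int m) = sib v x y" "arc v f l"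
  shows "arc v (f + int m) (l + int m)"
proof -
  have "\<not> sib v x (f + int m)" if "l + int m < x" "x < f + int m + int n" for x
    using assms(1)[of "x - int m" f] assms(2) that by (auto simp: arc_def)
  thus ?thesis using assms by (auto simp: arc_def)
qed

lemma arc_shift_n:
  assumes "arc v f l" shows "arc v (f + z * int n) (l + z * int n)"
proof -
  have s: "sib v (x + z * int n) (y + z * int n) = sib v x y" for x y by (simp add: sib_def lab_add_mult)
  have "\<not> sib v x (f + z * int n)" if "l + z * int n < x" "x < f + z * int n + int n" for x
    using s[of "x - z * int n" f] assms that by (auto simp: arc_def)
  thus ?thesis using assms s by (auto simp: arc_def)
qed

lemma arc_around:
  assumes "arc v f l" "sib v f x"
  obtains f' l' where "arc v f' l'" "l' - f' = l - f" "f' \<le> x" "x \<le> l'" "sib v f' x"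
proof -
  define z where "z = (x - f) div int n"
  have r: "0 \<le> (x - f) mod int n" "(x - f) mod int n < int n" using n_pos by auto
  have x: "x = f + z * int n + (x - f) mod int n" using div_mult_mod_eq[of "x - f" "int n"] by (simp add: z_def)
  have s: "sib v (f + z * int n) x" using assms(2) by (simp add: sib_def lab_add_mult)
  have a: "arc v (f + z * int n) (l + z * int n)" by (rule arc_shift_n[OF assms(1)])
  have "x \<le> l + z * int n"
  proof (rule ccontr)
    assume "\<not> x \<le> l + z * int n"
    hence "\<not> sib v x (f + z * int n)" using a x r by (auto simp: arc_def)
    thus False using s sib_sym by blast
  qed
  thus ?thesis using that[OF a] s x r by auto
qed

text \<open>A longest arc ends at the border of a window of length \<open>m\<close> that no block leaves.\<close>

lemma longest_arc_cut:
  assumes dw: "dyck_word v" and inv: "\<And>x y. sib v (x + int m) (y + int m) = sib v x y"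
    and no: "\<And>i. \<not> sib v i (i + int m)"
  shows "\<exists>l. \<forall>x y. l - int m < x \<and> x \<le> l \<and> l < y \<and> y \<le> l - int m + int n \<longrightarrow> \<not> sib v x y"
proof -
  let ?P = "\<lambda>(f, l). arc v f l"
  have "\<exists>p. ?P p" using ex_arc[OF dw inv no, of 1] by auto
  then obtain p0 where "?P p0" by blast
  moreover have "\<forall>p. ?P p \<longrightarrow> nat (snd p - fst p) < m" by (auto simp: arc_def)
  ultimately obtain p where p: "?P p" "\<And>q. ?P q \<Longrightarrow> nat (snd q - fst q) \<le> nat (snd p - fst p)"
    using ex_has_greatest_nat[of ?P p0 "\<lambda>p. nat (snd p - fst p)" m] by blast
  obtain f l where fl: "p = (f, l)" by fastforce
  have a: "arc v f l" using p(1) fl by simp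
  have max: "l' - f' \<le> l - f" if "arc v f' l'" for f' l'
    using p(2)[of "(f', l')"] that a fl by (auto simp: arc_def)
  \<comment> \<open>By maximality an arc passing over \<open>l\<close> starts after
    \<open>f\<close>, so it would cross the longest arc.\<close>
  have cross: False if a': "arc v f' l'" and c: "f' \<le> l" "l < l'" for f' l'
  proof -
    have b1: "l' < f + int n" using a a' c m_bounds by (auto simp: arc_def)
    have nl: "\<not> sib v l' f" using a c b1 by (auto simp: arc_def)
    have s': "sib v f' l'" and s: "sib v f l" using a a' by (auto simp: arc_def)
    have "f \<le> f'" using max[OF a'] c by linarith
    moreover have "f \<noteq> f'" using nl s' sib_sym by blast
    moreover have "f' \<noteq> l" using nl s s' sib_sym sib_trans by blast
    ultimately have "sib v f f'" using c b1 s s' by (intro noncrossing[OF dw, of f f' l l']) auto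
    thus False using nl s' sib_sym sib_trans by blast
  qed
  have "\<not> sib v x y" if xy: "l - int m < x" "x \<le> l" "l < y" "y \<le> l - int m + int n" for x y
  proof
    assume s: "sib v x y"
    obtain f1 l1 where "arc v f1 l1" "sib v f1 x" using ex_arc[OF dw inv no] by blast
    then obtain f' l' where f': "arc v f' l'" "f' \<le> x" "x \<le> l'" "sib v f' x" by (rule arc_around)
    show False
    proof (cases "y \<le> l'")
      case True
      then show False using cross[OF f'(1)] f' xy by auto
    next
      case False
      \<comment> \<open>Here \<open>y\<close> lies in a later copy of the block of \<open>x\<close>,
        so \<open>f' + m\<close> is at most \<open>l\<close> and the translate of the arc by
        \<open>m\<close> passes over \<open>l\<close>.\<close>
      have "sib v y f'" using s f'(4) sib_sym sib_trans by blast
      hence "f' + int n \<le> y" using f'(1) False by (auto simp: arc_def not_less[symmetric])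
      thus False using cross[OF arc_shift[OF inv f'(1)]] f' xy by auto
    qed
  qed
  thus ?thesis by blast
qed

text \<open>Two different blocks invariant under the shift would cross: with \<open>i\<close>
  reduced to \<open>r\<close> below \<open>m\<close>, the labels \<open>1\<close>,
  \<open>1 + r\<close>, \<open>1 + m\<close>, \<open>1 + r + m\<close> alternate between
  them.\<close>

lemma central_unique:
  assumes dw: "dyck_word v" and inv: "\<And>x y. sib v (x + int m) (y + int m) = sib v x y"
    and 1: "sib v 1 (1 + int m)" and i: "sib v (1 + int i) (1 + int i + int m)"
  shows "sib v 1 (1 + int i)"
proof -
  define r where "r = i mod m"
  define k where "k = i div m"
  have ik: "int i = int r + int k * int m" unfolding r_def k_def
    by (metis of_nat_add of_nat_mult mod_mult_div_eq mult.commute)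
  have "sib v (1 + int r + int k * int m) (1 + int r + int m + int k * int m)"
    using i by (simp add: ik algebra_simps)
  hence r: "sib v (1 + int r) (1 + int r + int m)" using sib_shift_mult[OF inv] by blast
  have chain: "sib v (1 + int r) (1 + int r + int k * int m)" for k
  proof (induction k)
    case (Suc k)
    have "sib v (1 + int r + int k * int m) (1 + int r + int m + int k * int m)"
      using r sib_shift_mult[OF inv] by blast
    hence "sib v (1 + int r) (1 + int r + int m + int k * int m)" using Suc sib_trans by blast
    then show ?case by (simp add: algebra_simps)
  qed (simp add: sib_refl)
  have "sib v 1 (1 + int r)"
  proof (cases "r = 0")
    case True
    then show ?thesis by (simp add: sib_refl)
  next
    case False
    have "r < m" using m_bounds by (simp add: r_def)
    thus ?thesis using False m_bounds 1 r
      by (intro noncrossing[OF dw, of 1 "1 + int r" "1 + int m" "1 + int r + int m"]) auto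
  qed
  thus ?thesis using chain[of k] sib_trans by (simp add: ik add.assoc)
qed

section \<open>Periodic words read around the centre\<close>

definition cyc :: "nat list \<Rightarrow> nat \<Rightarrow> nat \<Rightarrow> nat" where
  "cyc u j i = u ! ((i + j) mod m)"

lemma cyc_period: "cyc u j (i + m) = cyc u j i"
  by (simp add: cyc_def) (metis add.assoc add.commute mod_add_self2)

lemma cyc_period_n: "cyc u j (i + n) = cyc u j i"
  unfolding n_eq by (rule periodic_mult) (rule cyc_period)

lemma cyc_shift: "(\<lambda>i. cyc u j (i + k)) = cyc u (j + k)"
  by (auto simp: cyc_def add_ac)

lemma cyc_add_mult: "cyc u (j + k * n) = cyc u j"
proof
  fix i
  have "(i + (j + k * n)) mod m = (i + j + (k * d) * m) mod m" by (simp add: n_eq algebra_simps)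
  thus "cyc u (j + k * n) i = cyc u j i" by (simp add: cyc_def)
qed

lemma cyc_rotate: "length u = m \<Longrightarrow> cyc (rotate k u) j = cyc u (j + k)"
proof
  fix i assume "length u = m"
  hence "cyc (rotate k u) j i = u ! ((k + (i + j) mod m) mod m)"
    using m_bounds by (simp add: cyc_def nth_rotate)
  thus "cyc (rotate k u) j i = cyc u (j + k) i" by (simp add: cyc_def mod_add_right_eq add_ac)
qed

lemma cyc_inject:
  assumes "length u = m" "length w = m" "cyc u j = cyc w j" shows "u = w"
proof (rule nth_equalityI)
  fix i assume i: "i < length u"
  have "cyc u (m * j) i = cyc w (m * j) i"
  proof -
    have "j \<le> m * j" using m_bounds by simp
    hence "i + (m * j - j) + j = i + m * j" by linarith
    hence "cyc x (m * j) i = cyc x j (i + (m * j - j))" for x by (simp only: cyc_def)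
    thus ?thesis using assms(3) by simp
  qed
  thus "u ! i = w ! i" using i assms by (simp add: cyc_def)
qed (use assms in simp)

lemma mset_cyc:
  assumes "length u = m" shows "mset (map (cyc u j) [0..<n]) = repeat_mset d (mset u)"
proof -
  have "cyc u j = cyc (rotate j u) 0" using cyc_rotate[OF assms, of j 0] by simp
  hence "map (cyc u j) [0..<n] = map (\<lambda>i. rotate j u ! (i mod m)) [0..<d * m]"
    by (auto simp: cyc_def n_eq)
  thus ?thesis using mset_map_periodic[of "rotate j u" m d] assms by (simp add: mset_rotate_list)
qed

text \<open>As \<open>n = b - 1\<close>, the drift \<open>b (a - c) - a n\<close> is
  \<open>a - b c\<close>: negative for a central block, positive for a gap.\<close>

lemma walk_cyc:
  assumes "length u = m" "d * sum_list u + c = a"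
  shows "walk (cyc u j) n = int a - int b * int c"
proof -
  have "sum_mset (repeat_mset k X) = k * sum_mset X" for k and X :: "nat multiset"
    by (induction k) auto
  hence "sum_list (map (cyc u j) [0..<n]) = d * sum_list u"
    using arg_cong[OF mset_cyc[OF assms(1), of j], of sum_mset] by (metis sum_mset_sum_list)
  moreover have "(\<Sum>i<n. cyc u j i) = sum_list (map (cyc u j) [0..<n])"
    by (simp add: interv_sum_list_conv_sum_set_nat lessThan_atLeast0)
  ultimately have "int (\<Sum>i<n. cyc u j i) = int a - int c" using assms(2) by linarith
  hence "walk (cyc u j) n = int b * (int a - int c) - int a * int n" unfolding walk_sum by (simp only:)
  moreover have "int b = int n + 1" using b_eq by simp
  ultimately show ?thesis by (simp add: algebra_simps)
qed

lemma invariant_sib: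
  assumes "dyck_word v" "(turn ^^ m) v = v" shows "sib v (x + int m) (y + int m) = sib v x y"
  using sib_turn_pow[OF assms(1), of m x y] assms(2) by simp

text \<open>Rotating a fixed word until it starts at its centre makes the letters outside the centre
  periodic, by \<open>turn_pow_central\<close> or \<open>turn_pow_cut\<close> with
  \<open>j = m\<close>. The centre is the block containing some \<open>i\<close> and
  \<open>i + m\<close>, or else the cut supplied by a longest arc.\<close>

lemma ex_cyc_turn:
  assumes dw: "dyck_word v" and fix_v: "(turn ^^ m) v = v"
  shows "\<exists>j u c. length u = m \<and> (turn ^^ j) v = insert_letter c (cyc u 0) \<and>
    mset v = repeat_mset d (mset u) + {#c#}"
proof -
  note inv = invariant_sib[OF dw fix_v]
  have fixj: "(turn ^^ m) ((turn ^^ j) v) = (turn ^^ j) v" for j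
    using fix_v by (metis comp_apply funpow_add add.commute)
  have fin: ?thesis if w: "(turn ^^ j) v = insert_letter c w" and per: "\<And>p. p < n \<Longrightarrow> w p = w ((p + m) mod n)"
    and c: "0 < c \<Longrightarrow> w 0 = 0" for j c and w :: "nat \<Rightarrow> nat"
  proof -
    define u where "u = map w [0..<m]"
    have lu: "length u = m" by (simp add: u_def)
    have wm: "w (r + k * m) = w r" if "r < m" "r + k * m < n" for r k
      using that(2)
    proof (induction k)
      case (Suc k)
      have "w (r + k * m) = w ((r + k * m + m) mod n)" using Suc.prems by (intro per) simp
      also have "(r + k * m + m) mod n = r + Suc k * m" using Suc.prems by (simp add: algebra_simps)
      finally show ?case using Suc by simp
    qed simp
    have wc: "w p = cyc u 0 p" if "p < n" for p
      using wm[of "p mod m" "p div m"] that m_bounds by (simp add: cyc_def u_def)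
    have "insert_letter c w = insert_letter c (cyc u 0)"
      unfolding insert_letter_def using wc b_eq by (intro map_cong) auto
    hence e: "(turn ^^ j) v = insert_letter c (cyc u 0)" using w by simp
    have "mset v = mset (insert_letter c (cyc u 0))" using mset_turn_pow[OF dw, of j] e by simp
    also have "\<dots> = mset (map (cyc u 0) [0..<n]) + {#c#}"
      using c wc[OF n_pos] by (intro mset_insert_letter) auto
    finally show ?thesis using e lu mset_cyc[OF lu] by auto
  qed
  have as_insert: "u = insert_letter c w" if u: "dyck_word u" "\<And>p. p < n \<Longrightarrow> u ! p = (if p = 0 \<and> 0 < c then c else w p)"
    for u c w
  proof (rule nth_equalityI)
    fix p assume "p < length u"
    hence "p < b" using u by (simp add: dyck_word_def)
    hence "p < n \<or> p = n" using b_eq by linarith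
    thus "u ! p = insert_letter c w ! p" using u last_zero[OF u(1)] by (auto simp: nth_insert_letter)
  qed (use u in \<open>simp add: dyck_word_def\<close>)
  show ?thesis
  proof (cases "\<exists>i. sib v i (i + int m)")
    case True
    then obtain i where i: "sib v i (i + int m)" by blast
    define j where "j = nat ((i - 1) mod int n)"
    define z where "z = (i - 1) div int n"
    have "int j = (i - 1) mod int n" using n_pos by (simp add: j_def)
    hence ij: "i = (1 + int j) + z * int n"
      using div_mult_mod_eq[of "i - 1" "int n"] by (simp add: z_def)
    define u where "u = (turn ^^ j) v"
    have du: "dyck_word u" and fu: "(turn ^^ m) u = u" unfolding u_def by (rule dyck_turn_pow[OF dw], rule fixj)
    have "i + int m = (1 + int j + int m) + z * int n" using ij by simp
    hence "lab i = lab (1 + int j)" "lab (i + int m) = lab (1 + int j + int m)"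
      by (metis ij lab_add_mult, metis lab_add_mult)
    hence "sib v (1 + int j) (1 + int m + int j)" using i by (simp add: sib_def add_ac)
    hence s: "sib u 1 (1 + int m)" unfolding u_def sib_turn_pow[OF dw] .
    \<comment> \<open>Label \<open>m + 1\<close> lies in the block of 1 and is not its first
      element. This matches the blanked letter \<open>w 0\<close>, so \<open>w\<close> is periodic
      also at position 0.\<close>
    have um: "u ! m = 0"
      using nth_eq_rk[OF du m_bounds(3)] s m_bounds by (auto simp: add.commute split: if_splits)
    define w where "w p = (if p = 0 then 0 else u ! p)" for p
    have "1 < b" using n_pos b_eq by simp
    hence "0 < u ! 0" using level_pos[OF du, of 1] level_Suc_less_iff[of u 0] by simp
    hence A: "u = insert_letter (u ! 0) w" using du by (intro as_insert) (auto simp: w_def)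
    have B: "w p = w ((p + m) mod n)" if p: "p < n" for p
    proof (cases "p = 0")
      case True
      then show ?thesis using um m_bounds by (simp add: w_def)
    next
      case False
      then show ?thesis using turn_pow_central[OF du m_bounds(3) s p] fu by (simp add: w_def)
    qed
    show ?thesis
    proof (rule fin)
      show "(turn ^^ j) v = insert_letter (u ! 0) w" using A by (simp only: u_def[symmetric])
      show "w p = w ((p + m) mod n)" if "p < n" for p by (rule B[OF that])
      show "w 0 = 0" by (simp add: w_def)
    qed
  next
    case False
    hence no: "\<not> sib v i (i + int m)" for i by blast
    obtain l where l: "\<And>x y. l - int m < x \<Longrightarrow> x \<le> l \<Longrightarrow> l < y \<Longrightarrow> y \<le> l - int m + int n \<Longrightarrow> \<not> sib v x y"
      using longest_arc_cut[OF dw inv no] by blast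
    \<comment> \<open>After \<open>j\<close> turns the closed window ending at \<open>l\<close>
      consists of the labels 1 to \<open>m\<close>.\<close>
    define j where "j = nat ((l - int m) mod int n)"
    define z where "z = (l - int m) div int n"
    have "int j = (l - int m) mod int n" using n_pos by (simp add: j_def)
    hence lj: "l - int m = int j + z * int n"
      using div_mult_mod_eq[of "l - int m" "int n"] by (simp add: z_def)
    define u where "u = (turn ^^ j) v"
    have du: "dyck_word u" and fu: "(turn ^^ m) u = u" unfolding u_def by (rule dyck_turn_pow[OF dw], rule fixj)
    have s: "\<not> sib u x y" if "1 \<le> x" "x \<le> int m" "int m < y" "y \<le> int n" for x y
    proof -
      have "\<not> sib v (x + int j + z * int n) (y + int j + z * int n)" using that lj by (intro l) auto
      hence "\<not> sib v (x + int j) (y + int j)" by (simp add: sib_def lab_add_mult)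
      thus ?thesis by (simp add: u_def sib_turn_pow[OF dw])
    qed
    have A: "u = insert_letter 0 (\<lambda>p. u ! p)" using du by (intro as_insert) auto
    have B: "u ! p = u ! ((p + m) mod n)" if p: "p < n" for p
      using turn_pow_cut[OF du m_bounds(3) p s] fu by simp
    show ?thesis
    proof (rule fin)
      show "(turn ^^ j) v = insert_letter 0 (\<lambda>p. u ! p)" using A by (simp only: u_def[symmetric])
      show "u ! p = u ! ((p + m) mod n)" if "p < n" for p by (rule B[OF that])
    qed simp
  qed
qed

text \<open>If a rotation of a word read from its centre is again of this form, it starts at the
  same centre: at another element of the unique central block, or at another cut. So it is read off
  the same periodic sequence, even though it is presented through \<open>w\<close>.\<close>

lemma cyc_turn_unique:
  assumes u: "length u = m" "d * sum_list u + c = a" and w: "length w = m" "d * sum_list w + c = a"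
    and dw: "dyck_word (insert_letter c (cyc u j))" and i: "i < n"
    and eq: "(turn ^^ i) (insert_letter c (cyc u j)) = insert_letter c (cyc w k)"
  shows "(turn ^^ i) (insert_letter c (cyc u j)) = insert_letter c (cyc u (j + i))"
proof -
  let ?S = "insert_letter c (cyc u j)" and ?S' = "insert_letter c (cyc w k)"
  have dw': "dyck_word ?S'" using dyck_turn_pow[OF dw, of i] eq by simp
  have same: "(\<lambda>i. cyc x j (i + l * m)) = cyc x j" for x j l by (rule ext, rule periodic_mult, rule cyc_period)
  have same1: "(\<lambda>i. cyc x j (i + m)) = cyc x j" for x j by (rule ext, rule cyc_period)
  note per = cyc_period_n[of u j] and per' = cyc_period_n[of w k]
  note tot = walk_cyc[OF u, of j] and tot' = walk_cyc[OF w, of k]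
  have fix_S: "(turn ^^ m) ?S = ?S"
    using turn_insert_letter[of "cyc u j" c m, OF per tot dw] dw by (simp add: same1)
  note inv = invariant_sib[OF dw fix_S]
  have "(turn ^^ i) ?S = insert_letter c (\<lambda>p. cyc u j (p + i))"
  proof (cases "0 < c")
    case True
    have "sib ?S 1 (1 + int m)"
      using dw m_bounds by (intro insert_letter_central[OF per tot True]) (auto simp: same1)
    moreover have "sib ?S' 1 (1 + int m)"
      using dw' m_bounds by (intro insert_letter_central[OF per' tot' True]) (auto simp: same1)
    hence "sib ?S (1 + int i) (1 + int i + int m)"
      using sib_turn_pow[OF dw, of i 1 "1 + int m"] eq by (simp add: add_ac)
    ultimately have "sib ?S 1 (1 + int i)" using central_unique[OF dw inv] by blast
    thus ?thesis by (intro turn_insert_letter_central[OF per tot True dw i])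
  next
    case False
    hence c: "c = 0" by simp
    \<comment> \<open>Every multiple of \<open>m\<close> below \<open>n\<close> is a cut of such a
      word, and one of them separates labels at distance \<open>m\<close> or more.\<close>
    have close: "y - x < int m" if v: "dyck_word (insert_letter 0 (cyc z l))" and xy: "1 \<le> x" "x < y" "y \<le> int n"
      "sib (insert_letter 0 (cyc z l)) x y" for z l x y
    proof (rule ccontr)
      assume far: "\<not> y - x < int m"
      define q where "q = nat ((y - 1) div int m)"
      have "0 \<le> (y - 1) div int m" using xy m_bounds by (simp add: pos_imp_zdiv_nonneg_iff)
      hence q: "int q = (y - 1) div int m" by (simp add: q_def)
      have "y - 1 = int q * int m + (y - 1) mod int m" by (simp add: q)
      moreover have "0 \<le> (y - 1) mod int m" "(y - 1) mod int m < int m" using m_bounds by auto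
      ultimately have r: "x \<le> int (q * m)" "int (q * m) < y" using far by auto
      moreover have "q * m < n" using r(2) xy(3) by linarith
      ultimately have "\<not> sib (insert_letter 0 (cyc z l)) x y"
        using v xy by (intro insert_letter_cut[where j = "q * m"]) (auto simp: same)
      thus False using xy by blast
    qed
    show ?thesis unfolding c
    proof (rule turn_insert_letter_cut)
      fix x y assume xy: "1 \<le> x" "x \<le> int i" "int i < y" "y \<le> int n"
      show "\<not> sib (insert_letter 0 (cyc u j)) x y"
      proof
        assume s: "sib (insert_letter 0 (cyc u j)) x y"
        have 1: "y - x < int m" using close[of u j x y] dw s xy c by auto
        \<comment> \<open>Seen from \<open>i\<close>, the pair has distance
          \<open>n - (y - x)\<close>, which would also be below \<open>m\<close>; this contradicts
          \<open>2 m \<le> n\<close>.\<close>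
        have "sib ?S' (y - int i) (x + int n - int i)"
          using sib_turn_pow[OF dw, of i "y - int i" "x + int n - int i"] eq s c sib_sym by simp
        hence "(x + int n - int i) - (y - int i) < int m"
          using xy i dw' c by (intro close[of w k]) auto
        thus False using 1 m_bounds by linarith
      qed
    qed (use dw c i cyc_period_n in auto)
  qed
  thus ?thesis by (simp add: cyc_shift)
qed

text \<open>The relation requires the same \<open>j\<close> for the number of turns of
  \<open>v\<close> and for the offset in \<open>u\<close>. Changing the starting point moves both
  together, so \<open>u\<close> does not depend on which element of the centre or which cut is
  used.\<close>

theorem card_fixed_words:
  assumes M: "M = repeat_mset d N + {#c#}" and N: "size N = m" and sum_M: "sum_mset M = a"
  shows "card {v \<in> dyck_words M. (turn ^^ m) v = v} = card (permutations_of_multiset N)"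
proof (rule card_eq_by_relation[symmetric,
      where Q = "\<lambda>v u. \<exists>j. dyck_word (insert_letter c (cyc u j)) \<and> (turn ^^ j) v = insert_letter c (cyc u j)", THEN sym])
  have props: "length u = m \<and> d * sum_list u + c = a" if "u \<in> permutations_of_multiset N" for u
  proof -
    have "sum_mset (repeat_mset k X) = k * sum_mset X" for k and X :: "nat multiset"
      by (induction k) auto
    moreover have "mset u = N" using that by (simp add: permutations_of_multiset_def)
    ultimately show ?thesis using M N sum_M by (metis size_mset sum_mset.union sum_mset.singleton sum_mset_sum_list)
  qed
  have go: "(turn ^^ k) (insert_letter c (cyc u j)) = insert_letter c (cyc u (j + k))"
    if "u \<in> permutations_of_multiset N" "dyck_word (insert_letter c (cyc u j))" "dyck_word (insert_letter c (cyc u (j + k)))" for u j k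
    using turn_insert_letter[of "cyc u j" c k, OF cyc_period_n walk_cyc] props[OF that(1)] that(2,3)
    by (simp add: cyc_shift)
  \<comment> \<open>\<open>(n - 1) j\<close> further turns undo the first \<open>j\<close>, so this
    passes from start \<open>j\<close> to start \<open>j'\<close> without negative
    exponents.\<close>
  have reach: "(turn ^^ (j' + (n - 1) * j)) ((turn ^^ j) v) = (turn ^^ j') v" if "dyck_word v" for v j j'
  proof -
    have "j' + (n - 1) * j + j = j' + n * j" using n_pos by (cases n) auto
    hence "(turn ^^ (j' + (n - 1) * j)) ((turn ^^ j) v) = (turn ^^ (j' + n * j)) v"
      by (metis comp_apply funpow_add)
    thus ?thesis using turn_pow_nmult[OF that] by (simp add: funpow_add)
  qed
  have cyc_reach: "cyc u (j + (j' + (n - 1) * j)) = cyc u j'" for u j j'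
  proof -
    have "j + (j' + (n - 1) * j) = j' + j * n" using n_pos by (cases n) auto
    thus ?thesis by (simp only: cyc_add_mult)
  qed
  show "finite (permutations_of_multiset N)" by simp
  show "\<exists>u\<in>permutations_of_multiset N. \<exists>j. dyck_word (insert_letter c (cyc u j)) \<and> (turn ^^ j) v = insert_letter c (cyc u j)"
    if v: "v \<in> {v \<in> dyck_words M. (turn ^^ m) v = v}" for v
  proof -
    have dw: "dyck_word v" "mset v = M" "(turn ^^ m) v = v" using v by (auto simp: dyck_words_def)
    obtain j u c' where u: "length u = m" "(turn ^^ j) v = insert_letter c' (cyc u 0)"
      "mset v = repeat_mset d (mset u) + {#c'#}" using ex_cyc_turn[OF dw(1,3)] by blast
    have cc: "mset u = N" "c' = c"
      using repeat_mset_add_single_eqD[of d "mset u" c' N c] u(3) dw(2) M d_ge by auto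
    \<comment> \<open>\<open>j + k\<close> is a multiple of \<open>m\<close>, so
      \<open>rotate k u\<close> read from \<open>j\<close> is \<open>u\<close> read from 0.\<close>
    define k where "k = m * j - j"
    have "j \<le> m * j" using m_bounds by simp
    hence "j + k = m * j" by (simp add: k_def)
    hence "cyc (rotate k u) j = cyc u 0" using cyc_rotate[OF u(1), of k j] by (auto simp: cyc_def)
    moreover have "rotate k u \<in> permutations_of_multiset N"
      using cc by (intro permutations_of_multisetI) (simp add: mset_rotate_list)
    ultimately show ?thesis using u(2) cc dyck_turn_pow[OF dw(1), of j]
      by (intro bexI[of _ "rotate k u"] exI[of _ j]) auto
  qed
  show "\<exists>v\<in>{v \<in> dyck_words M. (turn ^^ m) v = v}. \<exists>j. dyck_word (insert_letter c (cyc u j)) \<and> (turn ^^ j) v = insert_letter c (cyc u j)"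
    if u: "u \<in> permutations_of_multiset N" for u
  proof -
    note p = props[OF u]
    obtain j where j: "dyck_word (insert_letter c (cyc u j))"
      using ex_dyck_insert_letter[of "cyc u 0" c] cyc_period_n walk_cyc p by (auto simp: cyc_shift)
    obtain v where v: "dyck_word v" "mset v = mset (insert_letter c (cyc u j))" "(turn ^^ j) v = insert_letter c (cyc u j)"
      using turn_pow_surj[OF j] by blast
    have "mset (insert_letter c (cyc u j)) = M"
    proof -
      have "mset (insert_letter c (cyc u j)) = mset (map (cyc u j) [0..<n]) + {#c#}"
        by (rule mset_insert_letter) (use insert_letter_first[OF j] walk_cyc p in auto)
      thus ?thesis using p mset_cyc[of u j] u M by (simp add: permutations_of_multiset_def)
    qed
    moreover have "cyc u (j + m) = cyc u j" using cyc_period[of u j] cyc_shift[of u j m] by simp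
    hence "(turn ^^ m) ((turn ^^ j) v) = (turn ^^ j) v" using go[OF u j, of m] j v(3) by simp
    hence "(turn ^^ j) ((turn ^^ m) v) = (turn ^^ j) v" by (metis comp_apply funpow_add add.commute)
    hence "(turn ^^ m) v = v" using turn_pow_inj[OF dyck_turn_pow[OF v(1)] v(1)] by blast
    ultimately show ?thesis using v j by (intro bexI[of _ v] exI[of _ j]) (auto simp: dyck_words_def)
  qed
  show "u = u'" if vuu: "v \<in> {v \<in> dyck_words M. (turn ^^ m) v = v}" "u \<in> permutations_of_multiset N" "u' \<in> permutations_of_multiset N"
    "\<exists>j. dyck_word (insert_letter c (cyc u j)) \<and> (turn ^^ j) v = insert_letter c (cyc u j)"
    "\<exists>j. dyck_word (insert_letter c (cyc u' j)) \<and> (turn ^^ j) v = insert_letter c (cyc u' j)" for v u u'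
  proof -
    have dv: "dyck_word v" using vuu(1) by (simp add: dyck_words_def)
    obtain j where j: "dyck_word (insert_letter c (cyc u j))" "(turn ^^ j) v = insert_letter c (cyc u j)" using vuu(4) by blast
    obtain j' where j': "dyck_word (insert_letter c (cyc u' j'))" "(turn ^^ j') v = insert_letter c (cyc u' j')" using vuu(5) by blast
    note pu = props[OF vuu(2)] and pu' = props[OF vuu(3)]
    define i where "i = (j' + (n - 1) * j) mod n"
    define q where "q = (j' + (n - 1) * j) div n"
    have iq: "j' + (n - 1) * j = i + n * q" by (simp add: i_def q_def)
    have i: "i < n" using n_pos by (simp add: i_def)
    have "(turn ^^ i) (insert_letter c (cyc u j)) = (turn ^^ (i + n * q)) (insert_letter c (cyc u j))"
      using turn_pow_nmult[OF j(1)] by (simp add: funpow_add)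
    also have "\<dots> = insert_letter c (cyc u' j')" unfolding iq[symmetric] using reach[OF dv, of j' j] j(2) j'(2) by simp
    finally have e: "(turn ^^ i) (insert_letter c (cyc u j)) = insert_letter c (cyc u' j')" .
    have "insert_letter c (cyc u' j') = insert_letter c (cyc u (j + i))"
      using cyc_turn_unique[of u c u' j i j'] pu pu' j(1) i e by simp
    also have "cyc u (j + i) = cyc u j'"
    proof -
      have "j + i + q * n = j + (j' + (n - 1) * j)" unfolding iq by simp
      thus ?thesis using cyc_reach[of u j j'] cyc_add_mult[of u "j + i" q] by metis
    qed
    finally have eq: "insert_letter c (cyc u' j') = insert_letter c (cyc u j')" .
    have z: "cyc u j' 0 = cyc u' j' 0"
    proof (cases "0 < c")
      case True
      then show ?thesis
        using insert_letter_first[of c "cyc u j'"] insert_letter_first[of c "cyc u' j'"] j'(1) eq walk_cyc pu pu' by auto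
    next
      case False
      then show ?thesis using nth_insert_letter(1)[OF n_pos, of c] arg_cong[OF eq, of "\<lambda>x. x ! 0"] by simp
    qed
    have "cyc u j' p = cyc u' j' p" if "p < n" for p
    proof (cases "p = 0")
      case True
      then show ?thesis using z by simp
    next
      case False
      then show ?thesis using nth_insert_letter(1)[OF that, of c] arg_cong[OF eq, of "\<lambda>x. x ! p"] by simp
    qed
    moreover have "cyc x j' (p mod n) = cyc x j' p" for x p by (rule periodic_mod) (rule cyc_period_n)
    ultimately have "cyc u j' = cyc u' j'" using n_pos by (metis ext mod_less_divisor)
    thus ?thesis using cyc_inject pu pu' by blast
  qed
  show "v = v'" if vuu: "v \<in> {v \<in> dyck_words M. (turn ^^ m) v = v}" "v' \<in> {v \<in> dyck_words M. (turn ^^ m) v = v}"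
    "u \<in> permutations_of_multiset N"
    "\<exists>j. dyck_word (insert_letter c (cyc u j)) \<and> (turn ^^ j) v = insert_letter c (cyc u j)"
    "\<exists>j. dyck_word (insert_letter c (cyc u j)) \<and> (turn ^^ j) v' = insert_letter c (cyc u j)" for v v' u
  proof -
    have dv: "dyck_word v" "dyck_word v'" using vuu(1,2) by (auto simp: dyck_words_def)
    obtain j where j: "dyck_word (insert_letter c (cyc u j))" "(turn ^^ j) v = insert_letter c (cyc u j)" using vuu(4) by blast
    obtain j' where j': "dyck_word (insert_letter c (cyc u j'))" "(turn ^^ j') v' = insert_letter c (cyc u j')" using vuu(5) by blast
    have "(turn ^^ j') v = (turn ^^ (j' + (n - 1) * j)) (insert_letter c (cyc u j))"
      using reach[OF dv(1), of j' j] j(2) by simp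
    also have "\<dots> = insert_letter c (cyc u j')"
      using go[OF vuu(3) j(1), of "j' + (n - 1) * j"] j'(1) unfolding cyc_reach by simp
    finally show ?thesis using turn_pow_inj[OF dv, of j'] j'(2) by simp
  qed
qed

end

subsection \<open>Lattice paths as words\<close>

definition path_of :: "nat list \<Rightarrow> step list" where
  "path_of v = concat (map (\<lambda>k. replicate k North @ [East]) v)"

definition ht :: "nat list \<Rightarrow> nat \<Rightarrow> real" where
  "ht v i = real (sum_list (take i v))"

lemma path_of_Nil [simp]: "path_of [] = []"
  and path_of_append: "path_of (v @ w) = path_of v @ path_of w"
  and path_of_single: "path_of [k] = replicate k North @ [East]"
  by (simp_all add: path_of_def)

lemma count_list_replicate: "count_list (replicate k x) y = (if x = y then k else 0)"
  by (induction k) auto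

lemma count_path_of: "count_list (path_of v) North = sum_list v" "count_list (path_of v) East = length v"
  by (induction v) (auto simp: path_of_def count_list_replicate)

lemma length_path_of: "length (path_of v) = sum_list v + length v"
  by (induction v) (auto simp: path_of_def)

lemma ex_path_of: "\<exists>v k. D = path_of v @ replicate k North"
proof (induction D rule: rev_induct)
  case Nil
  show ?case by (rule exI[of _ "[]"], rule exI[of _ 0]) simp
next
  case (snoc s D)
  then obtain v k where vk: "D = path_of v @ replicate k North" by blast
  show ?case
  proof (cases s)
    case North
    have "D @ [s] = path_of v @ replicate (Suc k) North"
      using North vk by (simp add: replicate_append_same)
    then show ?thesis by blast
  next
    case East
    have "D @ [s] = path_of (v @ [k]) @ replicate 0 North"
      using East vk by (simp add: path_of_append path_of_single)
    then show ?thesis by blast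
  qed
qed

lemma vertex_append: "m \<le> length D \<Longrightarrow> vertex (D @ E) m = vertex D m"
  by (simp add: vertex_def)

lemma vertex_full: "vertex D (length D) = (real (count_list D East), real (count_list D North))"
  by (simp add: vertex_def)

lemma path_trace_snoc:
  "path_trace (D @ [s]) = path_trace D \<union> closed_segment (vertex D (length D)) (vertex (D @ [s]) (Suc (length D)))"
proof -
  have "(\<Union>m<length D. closed_segment (vertex (D @ [s]) m) (vertex (D @ [s]) (Suc m))) = path_trace D"
    unfolding path_trace_def by (rule SUP_cong) (auto simp: vertex_append)
  thus ?thesis unfolding path_trace_def[of "D @ [s]"] by (auto simp: lessThan_Suc vertex_append)
qed

lemma closed_segment_vertical: "y \<le> y' \<Longrightarrow> closed_segment (x, y) (x, y') = {x} \<times> {y..y'}" for x y y' :: real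
proof -
  assume le: "y \<le> y'"
  have "(1 - u) * x + u * x = x" for u by (simp add: algebra_simps)
  hence "closed_segment (x, y) (x, y') = Pair x ` closed_segment y y'"
    unfolding closed_segment_image_interval image_image by simp
  thus ?thesis using le by (auto simp: closed_segment_eq_real_ivl)
qed

lemma closed_segment_horizontal: "x \<le> x' \<Longrightarrow> closed_segment (x, y) (x', y) = {x..x'} \<times> {y}" for x x' y :: real
proof -
  assume le: "x \<le> x'"
  have "(1 - u) * y + u * y = y" for u by (simp add: algebra_simps)
  hence "closed_segment (x, y) (x', y) = (\<lambda>x. (x, y)) ` closed_segment x x'"
    unfolding closed_segment_image_interval image_image by simp
  thus ?thesis using le by (auto simp: closed_segment_eq_real_ivl)
qed

lemma path_trace_norths:
  assumes "vertex D (length D) = (x, y)"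
  shows "path_trace (D @ replicate k North) = path_trace D \<union> (if k = 0 then {} else {x} \<times> {y..y + real k})"
proof (induction k)
  case (Suc k)
  have xy: "x = real (count_list D East)" "y = real (count_list D North)" using assms by (auto simp: vertex_full)
  have "D @ replicate (Suc k) North = (D @ replicate k North) @ [North]" by (simp add: replicate_append_same)
  hence "path_trace (D @ replicate (Suc k) North) = path_trace (D @ replicate k North) \<union>
     closed_segment (x, y + real k) (x, y + real (Suc k))"
    by (simp only: path_trace_snoc) (simp add: vertex_def xy count_list_replicate algebra_simps)
  also have "closed_segment (x, y + real k) (x, y + real (Suc k)) = {x} \<times> {y + real k..y + real (Suc k)}"
    by (rule closed_segment_vertical) simp
  finally show ?case using Suc by auto
qed simp

lemma path_trace_block:
  assumes "vertex D (length D) = (x, y)"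
  shows "path_trace (D @ replicate k North @ [East]) =
    path_trace D \<union> {x} \<times> {y..y + real k} \<union> {x..x + 1} \<times> {y + real k}"
proof -
  have xy: "x = real (count_list D East)" "y = real (count_list D North)" using assms by (auto simp: vertex_full)
  have "D @ replicate k North @ [East] = (D @ replicate k North) @ [East]" by simp
  hence "path_trace (D @ replicate k North @ [East]) = path_trace (D @ replicate k North) \<union>
     closed_segment (x, y + real k) (x + 1, y + real k)"
    by (simp only: path_trace_snoc) (simp add: vertex_def xy count_list_replicate algebra_simps)
  also have "closed_segment (x, y + real k) (x + 1, y + real k) = {x..x + 1} \<times> {y + real k}"
    by (rule closed_segment_horizontal) simp
  finally show ?thesis unfolding path_trace_norths[OF assms] by auto
qed

lemma path_trace_path_of:
  "path_trace (path_of v) = (\<Union>i<length v. {real i} \<times> {ht v i..ht v (Suc i)} \<union> {real i..real i + 1} \<times> {ht v (Suc i)})"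
proof (induction v rule: rev_induct)
  case Nil
  show ?case by (simp add: path_trace_def)
next
  case (snoc k v)
  have "vertex (path_of v) (length (path_of v)) = (real (length v), real (sum_list v))"
    by (simp add: vertex_full count_path_of)
  from path_trace_block[OF this, of k]
  have "path_trace (path_of (v @ [k])) = path_trace (path_of v) \<union> {real (length v)} \<times> {real (sum_list v)..real (sum_list v) + real k}
      \<union> {real (length v)..real (length v) + 1} \<times> {real (sum_list v) + real k}"
    by (simp add: path_of_append path_of_single)
  moreover have "(\<Union>i<length v. {real i} \<times> {ht (v @ [k]) i..ht (v @ [k]) (Suc i)} \<union> {real i..real i + 1} \<times> {ht (v @ [k]) (Suc i)})
      = path_trace (path_of v)"
    unfolding snoc by (rule SUP_cong) (auto simp: ht_def)
  moreover have "ht (v @ [k]) (length v) = real (sum_list v)" "ht (v @ [k]) (Suc (length v)) = real (sum_list v) + real k"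
    by (simp_all add: ht_def)
  ultimately show ?case by (auto simp: lessThan_Suc)
qed

lemma in_path_iff:
  "(x, y) \<in> path_trace (path_of v) \<longleftrightarrow>
    (\<exists>i<length v. x = real i \<and> ht v i \<le> y \<and> y \<le> ht v (Suc i) \<or> real i \<le> x \<and> x \<le> real i + 1 \<and> y = ht v (Suc i))"
  by (auto simp: path_trace_path_of)

lemma east_steps:
  "filter (\<lambda>m. path_of v ! m = East) [0..<length (path_of v)] = map (\<lambda>i. length (path_of (take (Suc i) v)) - 1) [0..<length v]"
proof (induction v rule: rev_induct)
  case (snoc k v)
  let ?P = "path_of v" and ?Q = "path_of (v @ [k])"
  have Q: "?Q = ?P @ replicate k North @ [East]" by (simp add: path_of_append path_of_single)
  have "[0..<length ?Q] = [0..<length ?P] @ [length ?P..<length ?P + k] @ [length ?P + k]"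
    by (simp add: Q upt_add_eq_append[of 0 "length ?P" "k + 1", simplified])
  moreover have "filter (\<lambda>m. ?Q ! m = East) [0..<length ?P] = filter (\<lambda>m. ?P ! m = East) [0..<length ?P]"
    by (rule filter_cong) (auto simp: Q nth_append)
  moreover have "filter (\<lambda>m. ?Q ! m = East) [length ?P..<length ?P + k] = []"
    by (auto simp: filter_empty_conv Q nth_append)
  moreover have "?Q ! (length ?P + k) = East" by (simp add: Q nth_append)
  ultimately have "filter (\<lambda>m. ?Q ! m = East) [0..<length ?Q] = map (\<lambda>i. length (path_of (take (Suc i) v)) - 1) [0..<length v] @ [length ?P + k]"
    using snoc by simp
  moreover have "length ?P + k = length (path_of (take (Suc (length v)) (v @ [k]))) - 1" by (simp add: Q)
  moreover have "map (\<lambda>i. length (path_of (take (Suc i) v)) - 1) [0..<length v] = map (\<lambda>i. length (path_of (take (Suc i) (v @ [k]))) - 1) [0..<length v]"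
    by simp
  ultimately show ?case by simp
qed simp

lemma path_of_split: "path_of v = path_of (take i v) @ path_of (drop i v)"
  by (metis append_take_drop_id path_of_append)

lemma vertex_path_of:
  assumes "i \<le> length v" shows "vertex (path_of v) (length (path_of (take i v))) = (real i, ht v i)"
proof -
  have "take (length (path_of (take i v))) (path_of v) = path_of (take i v)"
    using path_of_split[of v i] by (metis append_eq_conv_conj)
  thus ?thesis using assms by (simp add: vertex_def count_path_of ht_def)
qed

lemma length_path_of_take_pos:
  assumes "i < length v" shows "0 < length (path_of (take (Suc i) v))"
  using assms by (cases v) (auto simp: length_path_of)

lemma east_ends_path_of: "east_ends (path_of v) = map (\<lambda>i. (real (Suc i), ht v (Suc i))) [0..<length v]"
proof -
  have "vertex (path_of v) (Suc (length (path_of (take (Suc i) v)) - 1)) = (real (Suc i), ht v (Suc i))" if "i < length v" for i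
    using vertex_path_of[of "Suc i" v] length_path_of_take_pos[OF that] that by simp
  thus ?thesis unfolding east_ends_def east_steps by simp
qed

lemma next_step_north:
  assumes "i < length v"
  shows "path_of v ! length (path_of (take i v)) = North \<longleftrightarrow> 0 < v ! i"
proof -
  have "path_of v = path_of (take i v) @ replicate (v ! i) North @ [East] @ path_of (drop (Suc i) v)"
    using path_of_split[of v i] Cons_nth_drop_Suc[OF assms, symmetric]
    by (metis append.assoc append_Cons append_Nil path_of_append path_of_single)
  hence "path_of v ! length (path_of (take i v)) = (replicate (v ! i) North @ [East] @ path_of (drop (Suc i) v)) ! 0"
    by (metis nth_append_length_plus add_0_right)
  thus ?thesis by (cases "v ! i") (auto simp: nth_append)
qed

lemma valleys_path_of: "valleys (path_of v) = {(real i, ht v i) | i. 1 \<le> i \<and> i < length v \<and> 0 < v ! i}"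
proof (intro equalityI subsetI)
  let ?D = "path_of v"
  fix P assume "P \<in> valleys ?D"
  then obtain m where m: "P = vertex ?D (Suc m)" "Suc m < length ?D" "?D ! m = East" "?D ! Suc m = North"
    by (auto simp: valleys_def)
  have "m \<in> set (filter (\<lambda>m. ?D ! m = East) [0..<length ?D])" using m by auto
  then obtain i where i: "i < length v" "m = length (path_of (take (Suc i) v)) - 1" unfolding east_steps by auto
  have sm: "Suc m = length (path_of (take (Suc i) v))" using i length_path_of_take_pos[OF i(1)] by simp
  have "Suc i < length v"
  proof (rule ccontr)
    assume "\<not> Suc i < length v"
    hence "take (Suc i) v = v" by simp
    thus False using m(2) sm by simp
  qed
  moreover from this have "0 < v ! Suc i" using m(4) next_step_north[of "Suc i" v] by (simp add: sm)
  moreover have "P = (real (Suc i), ht v (Suc i))" using m(1) vertex_path_of[of "Suc i" v] i(1) by (simp add: sm)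
  ultimately show "P \<in> {(real i, ht v i) | i. 1 \<le> i \<and> i < length v \<and> 0 < v ! i}" by force
next
  let ?D = "path_of v"
  fix P assume "P \<in> {(real i, ht v i) | i. 1 \<le> i \<and> i < length v \<and> 0 < v ! i}"
  then obtain i where i: "P = (real i, ht v i)" "1 \<le> i" "i < length v" "0 < v ! i" by blast
  define i' where "i' = i - 1"
  have ii: "i = Suc i'" using i by (simp add: i'_def)
  define m where "m = length (path_of (take i v)) - 1"
  have sm: "Suc m = length (path_of (take i v))" using length_path_of_take_pos[of i' v] i ii by (simp add: m_def)
  have "m \<in> set (filter (\<lambda>m. ?D ! m = East) [0..<length ?D])" unfolding east_steps using i ii by (auto simp: m_def)
  hence "?D ! m = East" by auto
  moreover have "?D ! Suc m = North" using next_step_north[OF i(3)] i(4) by (simp add: sm)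
  moreover have "Suc m < length ?D"
  proof -
    have "length ?D = length (path_of (take i v)) + length (path_of (drop i v))" 
      using arg_cong[OF path_of_split[of v i], of length] by simp
    moreover have "0 < length (path_of (drop i v))" using i(3) by (simp add: length_path_of)
    ultimately show ?thesis by (simp add: sm)
  qed
  moreover have "P = vertex ?D (Suc m)" using vertex_path_of[of i v] i by (simp add: sm)
  ultimately show "P \<in> valleys ?D" by (auto simp: valleys_def)
qed

lemma ht_0 [simp]: "ht v 0 = 0" and ht_nonneg: "0 \<le> ht v i"
  by (simp_all add: ht_def)

lemma ht_mono: assumes "i \<le> j" shows "ht v i \<le> ht v j"
proof -
  have "take j v = take i v @ take (j - i) (drop i v)" using assms by (metis le_add_diff_inverse take_add)
  thus ?thesis by (simp add: ht_def)
qed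

section \<open>Dyck paths are the paths of Dyck words\<close>

context coprime_pair
begin

lemma level_ht:
  assumes "s \<le> length v" shows "real_of_int (level v s) = real b * ht v s - real a * real s"
proof -
  have "sum_list (take s v) = (\<Sum>i<s. v ! i)"
    using assms by (simp add: sum_list_sum_nth lessThan_atLeast0)
  hence "(\<Sum>i<s. int (v ! i)) = int (sum_list (take s v))" by simp
  thus ?thesis by (simp add: level_def ht_def)
qed

lemma dyck_path_iff: "dyck_path a b D \<longleftrightarrow> (\<exists>v. D = path_of v \<and> dyck_word v)"
proof
  assume d: "dyck_path a b D"
  obtain v k where vk: "D = path_of v @ replicate k North" using ex_path_of by blast
  have len: "length v = b" and sm: "sum_list v + k = a"
    using d by (auto simp: dyck_path_def vk count_path_of count_list_replicate)
  have "path_trace (path_of v) \<subseteq> path_trace D"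
    unfolding vk by (subst path_trace_norths[OF vertex_full]) auto
  hence above: "real a / real b * x \<le> y" if "(x, y) \<in> path_trace (path_of v)" for x y
    using d that by (auto simp: dyck_path_def)
  have bpos: "0 < b" using a_less by simp
  have ab: "real a * real i \<le> real b * ht v i" if "i \<le> b" for i
  proof (cases i)
    case (Suc i')
    have "(real i, ht v i) \<in> path_trace (path_of v)"
      unfolding in_path_iff using that Suc len by (intro exI[of _ i']) auto
    from above[OF this] show ?thesis using bpos by (simp add: field_simps)
  qed simp
  have "ht v b = real (sum_list v)" using len by (simp add: ht_def)
  \<comment> \<open>On arrival at abscissa \<open>b\<close> the path must already have height
    \<open>a\<close>, which excludes trailing north steps.\<close>
  hence "real a \<le> real (sum_list v)" using ab[of b] bpos by simp
  hence k0: "k = 0" and sv: "sum_list v = a" using sm by auto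
  have "0 \<le> level v s" if "s \<le> b" for s
  proof -
    have "0 \<le> real_of_int (level v s)" using ab[OF that] that len by (simp add: level_ht)
    thus ?thesis by simp
  qed
  thus "\<exists>v. D = path_of v \<and> dyck_word v" using vk k0 len sv by (auto simp: dyck_word_def)
next
  assume "\<exists>v. D = path_of v \<and> dyck_word v"
  then obtain v where v: "D = path_of v" "dyck_word v" by blast
  have len: "length v = b" "sum_list v = a" using v(2) by (auto simp: dyck_word_def)
  have bpos: "0 < b" using a_less by simp
  have ab: "real a * real i \<le> real b * ht v i" if "i \<le> b" for i
  proof -
    have "0 \<le> level v i" using v(2) that by (simp add: dyck_word_def)
    hence "0 \<le> real_of_int (level v i)" by simp
    thus ?thesis using that len by (simp add: level_ht)
  qed
  have "real a / real b * x \<le> y" if xy: "(x, y) \<in> path_trace D" for x y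
  proof -
    obtain i where i: "i < b" "x = real i \<and> ht v i \<le> y \<or> x \<le> real i + 1 \<and> y = ht v (Suc i)"
      using xy len unfolding v(1) in_path_iff by blast
    from i(2) show ?thesis
    proof
      assume *: "x = real i \<and> ht v i \<le> y"
      hence "real b * ht v i \<le> real b * y" by (intro mult_left_mono) auto
      moreover have "real a * x \<le> real b * ht v i" using ab[of i] i(1) * by simp
      ultimately have "real a * x \<le> real b * y" by linarith
      thus ?thesis using bpos by (simp add: field_simps)
    next
      assume *: "x \<le> real i + 1 \<and> y = ht v (Suc i)"
      hence "real a * x \<le> real a * real (Suc i)" by (intro mult_left_mono) auto
      also have "\<dots> \<le> real b * y" using ab[of "Suc i"] i(1) * by simp
      finally show ?thesis using bpos by (simp add: field_simps)
    qed
  qed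
  thus "dyck_path a b D" using len by (auto simp: dyck_path_def v(1) count_path_of)
qed

text \<open>The laser from \<open>p\<close> stays within the strip ending at this abscissa: the last
  east step before it passes from above the laser line to below it.\<close>

definition next_lower :: "nat list \<Rightarrow> nat \<Rightarrow> nat" where
  "next_lower v p = (LEAST t. p < t \<and> level v t < level v p)"

lemma next_lower_props:
  assumes "dyck_word v" "1 \<le> p" "p < b"
  shows next_lower_gt: "p < next_lower v p" and next_lower_le: "next_lower v p \<le> b"
    and level_next_lower: "level v (next_lower v p) < level v p"
    and before_next_lower: "\<And>s. p < s \<Longrightarrow> s < next_lower v p \<Longrightarrow> level v p < level v s"
proof -
  let ?Q = "\<lambda>t. p < t \<and> level v t < level v p"
  have ex: "?Q b" using level_pos[OF assms(1), of p] level_end[OF assms(1)] assms by simp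
  from LeastI[of ?Q, OF ex] show 1: "p < next_lower v p" "level v (next_lower v p) < level v p"
    by (auto simp: next_lower_def)
  show 2: "next_lower v p \<le> b" unfolding next_lower_def using ex by (rule Least_le)
  show "level v p < level v s" if s: "p < s" "s < next_lower v p" for s
  proof -
    have "\<not> ?Q s" using not_less_Least[of s ?Q] s by (auto simp: next_lower_def)
    moreover have "level v p \<noteq> level v s" using s 2 assms by (intro level_inj) auto
    ultimately show ?thesis using s by simp
  qed
qed

end

subsection \<open>The region enclosed by a laser\<close>

locale valley = coprime_pair +
  fixes v :: "nat list" and p :: nat
  assumes dyck: "dyck_word v" and p_ge: "1 \<le> p" and p_less: "p < b" and nonleaf: "0 < v ! p"
begin

abbreviation q :: nat where "q \<equiv> next_lower v p"
abbreviation H :: "nat \<Rightarrow> real" where "H \<equiv> ht v"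
abbreviation tr :: "(real \<times> real) set" where "tr \<equiv> path_trace (path_of v)"
abbreviation lsr :: "(real \<times> real) set" where "lsr \<equiv> laser a b (path_of v) (real p, H p)"

text \<open>The affine extension of \<open>level\<close> to the plane; the laser is part of one of
  its contour lines.\<close>

definition L :: "real \<Rightarrow> real \<Rightarrow> real" where
  "L x y = real b * y - real a * x"

abbreviation e :: real where "e \<equiv> L (real p) (H p)"

lemma len: "length v = b"
  using dyck by (simp add: dyck_word_def)

lemma ab_pos: "0 < real a" "0 < real b"
  using a_pos a_less by auto

lemma L_level: "i \<le> b \<Longrightarrow> L (real i) (H i) = real_of_int (level v i)"
  by (simp add: L_def level_ht len)

lemma q_props: "p + 2 \<le> q" "q \<le> b" "L (real q) (H q) < e"
proof -
  have "q \<noteq> Suc p"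
    using level_next_lower[OF dyck p_ge p_less] level_less_Suc[OF nonleaf] by auto
  thus "p + 2 \<le> q" using next_lower_gt[OF dyck p_ge p_less] by linarith
  show "q \<le> b" by (rule next_lower_le[OF dyck p_ge p_less])
  thus "L (real q) (H q) < e" using level_next_lower[OF dyck p_ge p_less] p_less by (simp add: L_level)
qed

text \<open>Levels are integers, so above the laser there is room of a full unit below the path
  vertices, within which a parallel line can be drawn.\<close>

lemma L_between: "p < s \<Longrightarrow> s < q \<Longrightarrow> e + 1 \<le> L (real s) (H s)"
  using before_next_lower[OF dyck p_ge p_less, of s] q_props(2) p_less by (simp add: L_level)

lemma L_less_iff: "L x y < L x y' \<longleftrightarrow> y < y'" and L_le_iff: "L x y \<le> L x y' \<longleftrightarrow> y \<le> y'"
  using ab_pos by (auto simp: L_def)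

lemma L_anti: "x \<le> x' \<Longrightarrow> L x' y \<le> L x y"
  using ab_pos by (auto simp: L_def)

lemma in_path: "(x, y) \<in> tr \<longleftrightarrow>
    (\<exists>i<b. x = real i \<and> H i \<le> y \<and> y \<le> H (Suc i) \<or> real i \<le> x \<and> x \<le> real i + 1 \<and> y = H (Suc i))"
  by (simp add: in_path_iff len)

lemma path_above: "(real t, y) \<in> tr \<Longrightarrow> H t \<le> y"
  unfolding in_path
proof (elim exE conjE disjE)
  fix i assume "real t = real i" "H i \<le> y"
  thus "H t \<le> y" by simp
next
  fix i assume "real t \<le> real i + 1" "y = H (Suc i)"
  hence "t \<le> Suc i" by linarith
  thus "H t \<le> y" using \<open>y = H (Suc i)\<close> ht_mono by simp
qed

lemma path_nonneg: "(x, y) \<in> tr \<Longrightarrow> 0 \<le> y"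
  unfolding in_path using ht_nonneg by (metis order_trans)

lemma in_laser: "(x, y) \<in> lsr \<longleftrightarrow> (\<exists>t\<ge>0. x = real p + t * real b \<and> y = H p + t * real a \<and>
    (\<forall>s. 0 < s \<and> s < t \<longrightarrow> (real p + s * real b, H p + s * real a) \<notin> tr))"
  by (auto simp: laser_def)

text \<open>The bound on \<open>x\<close> holds because the contour through \<open>p\<close> meets
  the east step that ends at \<open>q\<close>: its start is above the contour, its end
  below.\<close>

lemma laser_props:
  assumes "(x, y) \<in> lsr" shows "L x y = e" "real p \<le> x" "x < real q" "H p \<le> y" "x = real p \<Longrightarrow> y = H p"
proof -
  obtain t where t: "0 \<le> t" "x = real p + t * real b" "y = H p + t * real a"
    "\<And>s. 0 < s \<Longrightarrow> s < t \<Longrightarrow> (real p + s * real b, H p + s * real a) \<notin> tr"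
    using assms unfolding in_laser by blast
  show "L x y = e" by (simp add: L_def t algebra_simps)
  show "real p \<le> x" "H p \<le> y" using t ab_pos by auto
  show "y = H p" if "x = real p" using that t ab_pos by auto
  show "x < real q"
  proof (rule ccontr)
    assume "\<not> x < real q"
    hence xq: "real q \<le> x" by simp
    \<comment> \<open>The parameter at which the ray reaches the height of the east step ending at
      \<open>q\<close>.\<close>
    define s where "s = (H q - H p) / real a"
    define x' where "x' = real p + s * real b"
    have ys: "H p + s * real a = H q" using ab_pos by (simp add: s_def)
    have "L x' (H q) = e" unfolding ys[symmetric] by (simp add: L_def x'_def algebra_simps)
    have 1: "x' < real q"
    proof (rule ccontr)
      assume "\<not> x' < real q"
      hence "L x' (H q) \<le> L (real q) (H q)" by (intro L_anti) simp
      thus False using q_props(3) \<open>L x' (H q) = e\<close> by simp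
    qed
    have 2: "real (q - 1) \<le> x'"
    proof (rule ccontr)
      assume "\<not> real (q - 1) \<le> x'"
      hence "L (real (q - 1)) (H q) \<le> e" using L_anti[of x' "real (q - 1)" "H q"] \<open>L x' (H q) = e\<close> by simp
      moreover have "L (real (q - 1)) (H (q - 1)) \<le> L (real (q - 1)) (H q)" by (simp add: L_le_iff ht_mono)
      moreover have "e + 1 \<le> L (real (q - 1)) (H (q - 1))" using q_props(1) by (intro L_between) auto
      ultimately show False by simp
    qed
    have "real p + 1 \<le> real (q - 1)" using q_props(1) by linarith
    hence "0 < s * real b" using 2 by (simp add: x'_def)
    hence "0 < s" using ab_pos by (simp add: zero_less_mult_iff)
    moreover have "s * real b < t * real b" using 1 xq by (simp add: x'_def t)
    hence "s < t" using ab_pos by simp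
    moreover have "(x', H q) \<in> tr"
      unfolding in_path using 1 2 q_props by (intro exI[of _ "q - 1"]) auto
    ultimately show False using t(4)[of s] by (simp add: ys x'_def)
  qed
qed

text \<open>The assumption on \<open>i\<close> says that the point is not above the path. An earlier
  meeting with the path before \<open>q\<close> would have to lie on the last east step, whose
  height is at least \<open>y\<close>, while the ray is still strictly lower.\<close>

lemma in_laserI:
  assumes "L x y = e" "real p < x" "x < real q" "i \<le> b" "real i - 1 \<le> x" "y \<le> H i"
  shows "(x, y) \<in> lsr"
proof -
  define t where "t = (x - real p) / real b"
  have x: "x = real p + t * real b" using ab_pos by (simp add: t_def)
  have t: "0 \<le> t" using assms ab_pos by (simp add: t_def)
  have "real b * y = real b * (H p + t * real a)" using assms(1) by (simp add: L_def x algebra_simps)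
  hence y: "y = H p + t * real a" using ab_pos by simp
  have "(real p + s * real b, H p + s * real a) \<notin> tr" if s: "0 < s" "s < t" for s
  proof
    define x' y' where "x' = real p + s * real b" and "y' = H p + s * real a"
    have xy': "real p < x'" "x' < x" "y' < y" "L x' y' = e"
      using s ab_pos by (auto simp: x'_def y'_def x y L_def algebra_simps)
    assume "(real p + s * real b, H p + s * real a) \<in> tr"
    then obtain j where j: "j < b" "x' = real j \<and> H j \<le> y' \<or> real j \<le> x' \<and> x' \<le> real j + 1 \<and> y' = H (Suc j)"
      unfolding x'_def[symmetric] y'_def[symmetric] in_path by blast
    from j(2) show False
    proof
      assume *: "x' = real j \<and> H j \<le> y'"
      hence "e + 1 \<le> L (real j) (H j)" using xy' assms by (intro L_between) auto
      moreover have "L (real j) (H j) \<le> e" using * xy'(4) L_le_iff[of "real j" "H j" y'] by simp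
      ultimately show False by simp
    next
      assume *: "real j \<le> x' \<and> x' \<le> real j + 1 \<and> y' = H (Suc j)"
      show False
      proof (cases "Suc j < q")
        case True
        have "e + 1 \<le> L (real (Suc j)) (H (Suc j))" using True * xy' by (intro L_between) auto
        moreover have "L (real (Suc j)) (H (Suc j)) \<le> L x' (H (Suc j))" using * by (intro L_anti) simp
        ultimately show False using * xy'(4) by simp
      next
        case False
        hence "i \<le> Suc j" using assms by linarith
        hence "y \<le> H (Suc j)" using assms(6) ht_mono order_trans by blast
        thus False using * xy' by simp
      qed
    qed
  qed
  thus ?thesis unfolding in_laser using x y t by blast
qed

text \<open>The points strictly above the laser line and strictly below the path. The upper bound is
  a union over the east steps starting strictly to the left of the point, which keeps the set open
  at integer abscissas, where the path jumps.\<close>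

definition region :: "(real \<times> real) set" where
  "region = {z. real p < fst z \<and> fst z < real q \<and> e < L (fst z) (snd z) \<and>
     (\<exists>i\<le>b. real i - 1 < fst z \<and> snd z < H i)}"

lemma open_region: "open region"
proof -
  have "region = (\<Union>i\<le>b. {z. real p < fst z} \<inter> {z. fst z < real q} \<inter> {z. e < L (fst z) (snd z)} \<inter>
      {z. real i - 1 < fst z} \<inter> {z. snd z < H i})"
    by (auto simp: region_def)
  also have "open \<dots>"
    unfolding L_def by (intro open_UN ballI open_Int open_Collect_less continuous_intros)
  finally show ?thesis .
qed

text \<open>Weakening all inequalities gives a closed superset, so a frontier point satisfies one of
  them with equality; each such equality puts it on the path or on the laser.\<close>

lemma frontier_region: "frontier region \<subseteq> tr \<union> lsr"
proof
  let ?C = "\<Union>i\<le>b. {z. real p \<le> fst z} \<inter> {z. fst z \<le> real q} \<inter> {z. e \<le> L (fst z) (snd z)} \<inter>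
      {z. real i - 1 \<le> fst z} \<inter> {z. snd z \<le> H i}"
  have "closed ?C"
    unfolding L_def by (intro closed_UN ballI closed_Int closed_Collect_le continuous_intros) auto
  moreover have "region \<subseteq> ?C" by (auto simp: region_def)
  ultimately have cl: "closure region \<subseteq> ?C" by (simp add: closure_minimal)
  fix z assume "z \<in> frontier region"
  hence z: "z \<in> closure region" "z \<notin> region" using open_region by (auto simp: frontier_def interior_open)
  obtain x y where xy: "z = (x, y)" by fastforce
  obtain i where i: "i \<le> b" "real p \<le> x" "x \<le> real q" "e \<le> L x y" "real i - 1 \<le> x" "y \<le> H i"
    using cl z(1) xy by fastforce
  consider "x = real p" | "x = real q" | "real p < x" "x < real q" "L x y = e" | "real p < x" "x < real q" "e < L x y"
    using i by linarith
  thus "z \<in> tr \<union> lsr"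
  proof cases
    case 1
    have "H p \<le> y" using i(4) by (simp add: 1 L_le_iff)
    moreover have "i \<le> Suc p" using i(5) 1 by linarith
    hence "y \<le> H (Suc p)" using i(6) ht_mono order_trans by blast
    ultimately have "(x, y) \<in> tr" unfolding in_path using 1 p_less by blast
    then show ?thesis by (simp add: xy)
  next
    \<comment> \<open>At abscissa \<open>q\<close> the path arrives below the laser line, so a
      frontier point there lies on the vertical run starting at \<open>q\<close>.\<close>
    case 2
    have "L (real q) (H q) < L (real q) y" using i(4) q_props(3) 2 by simp
    hence gt: "H q < y" by (simp add: L_less_iff)
    moreover have iq: "i \<le> Suc q" using i(5) 2 by linarith
    have "q < b"
    proof (rule ccontr)
      assume "\<not> q < b"
      hence "i \<le> q" using i(1) by simp
      hence "y \<le> H q" using i(6) ht_mono order_trans by blast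
      thus False using gt by simp
    qed
    moreover have "y \<le> H (Suc q)" using i(6) iq ht_mono order_trans by blast
    ultimately have "(x, y) \<in> tr" unfolding in_path using 2 by (auto intro!: exI[of _ q])
    then show ?thesis by (simp add: xy)
  next
    case 3
    then show ?thesis using in_laserI[of x y i] i by (simp add: xy)
  next
    case 4
    have no: "H j \<le> y" if "j \<le> b" "real j - 1 < x" for j
      using z(2) 4 that by (auto simp: region_def xy not_less)
    have "(x, y) \<in> tr"
    proof (cases "real i - 1 = x")
      case True
      have "i \<noteq> 0" using True 4 by (cases i) auto
      then obtain k where k: "i = Suc k" by (cases i) auto
      have "x = real k" using True k by simp
      moreover have "H k \<le> y" using no[of k] k i(1) \<open>x = real k\<close> by simp
      ultimately show ?thesis unfolding in_path using i(1,6) k by (intro exI[of _ k]) auto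
    next
      case False
      \<comment> \<open>The east step over \<open>x\<close> has height \<open>H j\<close>; not being
        in \<open>region\<close> gives one inequality and the closure the other.\<close>
      define j where "j = nat \<lceil>x\<rceil>"
      have xpos: "0 < x" using 4 by linarith
      have j: "real j - 1 < x" "x \<le> real j" using xpos by (auto simp: j_def) linarith+
      have jq: "j \<le> q" using j 4 by linarith
      have "H j \<le> y" using no[of j] j jq q_props(2) by simp
      moreover have "i \<le> j" using False i(5) j by linarith
      hence "y \<le> H j" using i(6) ht_mono order_trans by blast
      ultimately have yj: "y = H j" by simp
      have "0 < j" using j xpos by (cases j) auto
      then obtain k where k: "j = Suc k" by (cases j) auto
      show ?thesis unfolding in_path using j jq q_props(2) yj by (intro exI[of _ k]) (auto simp: k)
    qed
    then show ?thesis by (simp add: xy)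
  qed
qed

section \<open>Connecting labels in the complement\<close>

lemma segment_connected_component:
  fixes x y :: "real \<times> real"
  assumes "closed_segment x y \<subseteq> S" shows "connected_component S x y"
  unfolding connected_component_def using assms by (intro exI[of _ "closed_segment x y"]) (auto simp: connected_segment)

text \<open>Labels outside the strip have neither path nor laser below them, so all of them reach
  the common line of height -1.\<close>

lemma label_down:
  assumes t: "t \<le> p \<or> q \<le> t" and \<epsilon>: "0 < \<epsilon>"
  shows "connected_component (- (tr \<union> lsr)) (real t, H t - \<epsilon>) (real t, - 1)"
proof (rule segment_connected_component, rule subsetI)
  fix z assume "z \<in> closed_segment (real t, H t - \<epsilon>) (real t, - 1)"
  then obtain y where z: "z = (real t, y)" "y \<in> closed_segment (H t - \<epsilon>) (- 1)"
    by (metis closed_segment_PairD closed_segment_idem empty_iff insert_iff prod.exhaust)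
  have yt: "y < H t" using z(2) \<epsilon> ht_nonneg[of v t] by (auto simp: closed_segment_eq_real_ivl split: if_splits)
  have "z \<notin> tr" using path_above[of t y] yt z by auto
  moreover have "z \<notin> lsr"
  proof
    assume "z \<in> lsr"
    note l = laser_props[of "real t" y, OF this[unfolded z(1)]]
    hence "t = p" using t by linarith
    thus False using l(5) yt by simp
  qed
  ultimately show "z \<in> - (tr \<union> lsr)" by simp
qed

lemma below_connected: "connected_component (- (tr \<union> lsr)) (real s, - 1) (real t, - 1)"
proof (rule segment_connected_component, rule subsetI)
  fix z assume "z \<in> closed_segment (real s, - 1) (real t, - 1 :: real)"
  then obtain x where z: "z = (x, - 1)"
    by (metis closed_segment_PairD closed_segment_idem empty_iff insert_iff prod.exhaust)
  show "z \<in> - (tr \<union> lsr)" using path_nonneg[of x "- 1"] laser_props(4)[of x "- 1"] ht_nonneg[of v p] z by auto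
qed

text \<open>Labels inside are joined along the contour of value \<open>e + 1 / 2\<close>, halfway
  between the laser and the minimum possible value \<open>e + 1\<close> of the labels. The bound on
  \<open>\<epsilon>\<close> keeps a lowered label above this contour.\<close>

lemma label_to_line:
  assumes t: "p < t" "t < q" and \<epsilon>: "0 < \<epsilon>" "real b * \<epsilon> < 1 / 2"
  shows "connected_component (- (tr \<union> lsr)) (real t, H t - \<epsilon>) (real t, (e + 1 / 2 + real a * real t) / real b)"
proof (rule segment_connected_component, rule subsetI)
  let ?y = "(e + 1 / 2 + real a * real t) / real b"
  have Ly: "L (real t) ?y = e + 1 / 2" using ab_pos by (simp add: L_def)
  have Lt: "e + 1 \<le> L (real t) (H t)" by (rule L_between[OF t])
  have Le: "e + 1 / 2 < L (real t) (H t - \<epsilon>)" using Lt \<epsilon> by (simp add: L_def algebra_simps)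
  have y_lt: "?y < H t" using Ly Lt L_less_iff[of "real t" ?y "H t"] by simp
  have y_lt': "?y < H t - \<epsilon>" using Ly Le L_less_iff[of "real t" ?y "H t - \<epsilon>"] by simp
  fix z assume "z \<in> closed_segment (real t, H t - \<epsilon>) (real t, ?y)"
  then obtain y where z: "z = (real t, y)" "y \<in> closed_segment (H t - \<epsilon>) ?y"
    by (metis closed_segment_PairD closed_segment_idem empty_iff insert_iff prod.exhaust)
  have y: "?y \<le> y" "y \<le> H t - \<epsilon>" using z(2) y_lt' by (auto simp: closed_segment_eq_real_ivl split: if_splits)
  have "z \<notin> tr" using path_above[of t y] y z \<epsilon> by auto
  moreover have "z \<notin> lsr"
  proof
    assume "z \<in> lsr"
    hence "L (real t) y = e" using laser_props(1) z by blast
    thus False using y(1) Ly L_le_iff[of "real t" ?y y] by simp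
  qed
  ultimately show "z \<in> - (tr \<union> lsr)" by simp
qed

text \<open>Between the first and the last label inside, all path vertices have value at least
  \<open>e + 1\<close>, and moving left along an east step only increases \<open>L\<close>.\<close>

lemma line_connected:
  assumes "p < s" "s < q" "p < t" "t < q"
  shows "connected_component (- (tr \<union> lsr)) (real s, (e + 1 / 2 + real a * real s) / real b)
     (real t, (e + 1 / 2 + real a * real t) / real b)"
proof (rule segment_connected_component, rule subsetI)
  fix z assume "z \<in> closed_segment (real s, (e + 1 / 2 + real a * real s) / real b) (real t, (e + 1 / 2 + real a * real t) / real b)"
  then obtain u where u: "0 \<le> u" "u \<le> 1" "z = (1 - u) *\<^sub>R (real s, (e + 1 / 2 + real a * real s) / real b) + u *\<^sub>R (real t, (e + 1 / 2 + real a * real t) / real b)"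
    by (auto simp: in_segment)
  define x where "x = (1 - u) * real s + u * real t"
  define y where "y = (1 - u) * ((e + 1 / 2 + real a * real s) / real b) + u * ((e + 1 / 2 + real a * real t) / real b)"
  have z: "z = (x, y)" using u(3) by (simp add: x_def y_def)
  have "real b * y = (1 - u) * (e + 1 / 2 + real a * real s) + u * (e + 1 / 2 + real a * real t)"
  proof -
    have "real b * (c / real b) = c" for c using ab_pos by simp
    thus ?thesis unfolding y_def by (simp only: distrib_left[of "real b"] mult.left_commute[of "real b"])
  qed
  hence Lz: "L x y = e + 1 / 2" by (simp add: L_def x_def field_simps)
  have "x \<in> closed_segment (real s) (real t)" using u by (auto simp: in_segment x_def)
  hence x: "real p + 1 \<le> x" "x \<le> real q - 1"
    using assms by (auto simp: closed_segment_eq_real_ivl split: if_splits)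
  have "z \<notin> tr"
  proof
    assume "z \<in> tr"
    then obtain j where j: "j < b" "x = real j \<and> H j \<le> y \<or> real j \<le> x \<and> x \<le> real j + 1 \<and> y = H (Suc j)"
      unfolding z in_path by blast
    from j(2) show False
    proof
      assume *: "x = real j \<and> H j \<le> y"
      have "e + 1 \<le> L (real j) (H j)" using * x by (intro L_between) auto
      moreover have "L (real j) (H j) \<le> L x y" using * by (simp add: L_le_iff)
      ultimately show False using Lz by simp
    next
      assume *: "real j \<le> x \<and> x \<le> real j + 1 \<and> y = H (Suc j)"
      show False
      proof (cases "Suc j < q")
        case True
        have "e + 1 \<le> L (real (Suc j)) (H (Suc j))" using True * x by (intro L_between) auto
        moreover have "L (real (Suc j)) (H (Suc j)) \<le> L x (H (Suc j))" using * by (intro L_anti) simp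
        ultimately show False using * Lz by simp
      next
        case False
        have xj: "x = real j" using False * x by linarith
        have "e + 1 \<le> L (real j) (H j)" using xj x by (intro L_between) auto
        moreover have "L (real j) (H j) \<le> L x y" using * xj ht_mono[of j "Suc j" v] by (simp add: L_le_iff)
        ultimately show False using Lz by simp
      qed
    qed
  qed
  moreover have "z \<notin> lsr" using laser_props(1)[of x y] Lz z by auto
  ultimately show "z \<in> - (tr \<union> lsr)" by simp
qed

lemma label_point_path_of: "1 \<le> i \<Longrightarrow> i \<le> n \<Longrightarrow> label_point (path_of v) i \<epsilon> = (real i, H i - \<epsilon>)"
proof -
  assume i: "1 \<le> i" "i \<le> n"
  hence "i - 1 < b" using b_eq by simp
  hence "east_ends (path_of v) ! (i - 1) = (real i, H i)" using i by (simp add: east_ends_path_of len of_nat_diff)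
  thus ?thesis by (simp add: label_point_def)
qed

lemma separated_iff:
  assumes i: "1 \<le> i" "i \<le> n" and j: "1 \<le> j" "j \<le> n"
  shows "separated a b (path_of v) (real p, H p) i j \<longleftrightarrow> (p < i \<and> i < q) \<noteq> (p < j \<and> j < q)"
proof -
  let ?S = "- (tr \<union> lsr)"
  define \<delta> where "\<delta> = 1 / (2 * real b)"
  have \<delta>: "0 < \<delta>" using ab_pos by (simp add: \<delta>_def)
  have small: "real b * \<epsilon> < 1 / 2" if "\<epsilon> < \<delta>" for \<epsilon> using that ab_pos by (simp add: \<delta>_def field_simps)
  have small_ev: "\<forall>\<^sub>F \<epsilon> in at_right 0. 0 < \<epsilon> \<and> \<epsilon> < \<delta>"
    using \<delta> by (auto simp: eventually_at_right[of 0 1])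
  have sep: "separated a b (path_of v) (real p, H p) i j \<longleftrightarrow>
     (\<forall>\<^sub>F \<epsilon> in at_right 0. \<not> connected_component ?S (real i, H i - \<epsilon>) (real j, H j - \<epsilon>))"
    unfolding separated_def label_point_path_of[OF i] label_point_path_of[OF j] ..
  have inR: "(real t, H t - \<epsilon>) \<in> region" if "p < t" "t < q" "0 < \<epsilon>" "\<epsilon> < \<delta>" for t \<epsilon>
  proof -
    have "e + 1 \<le> L (real t) (H t)" by (rule L_between) (use that in auto)
    hence "e < L (real t) (H t - \<epsilon>)" using small[OF that(4)] by (simp add: L_def algebra_simps)
    thus ?thesis using that q_props(2) by (auto simp: region_def intro!: exI[of _ t])
  qed
  have outR: "(real t, y) \<notin> region" if "\<not> (p < t \<and> t < q)" for t y
    using that by (auto simp: region_def)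
  \<comment> \<open>A connected set leaving \<open>region\<close> meets its frontier, which is not
    contained in the complement.\<close>
  have cross: "\<not> connected_component ?S x y" if xy: "x \<in> region" "y \<notin> region" for x y
  proof
    assume "connected_component ?S x y"
    then obtain T where T: "connected T" "T \<subseteq> ?S" "x \<in> T" "y \<in> T" by (auto simp: connected_component_def)
    hence "T \<inter> frontier region \<noteq> {}" using xy by (intro connected_Int_frontier) auto
    thus False using T(2) frontier_region by blast
  qed
  show ?thesis
  proof (cases "(p < i \<and> i < q) = (p < j \<and> j < q)")
    case True
    have conn: "connected_component ?S (real i, H i - \<epsilon>) (real j, H j - \<epsilon>)" if \<epsilon>: "0 < \<epsilon>" "\<epsilon> < \<delta>" for \<epsilon>
    proof (cases "p < i \<and> i < q")
      case in_i: True
      hence in_j: "p < j \<and> j < q" using True by simp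
      show ?thesis
        using label_to_line[of i \<epsilon>] label_to_line[of j \<epsilon>] line_connected[of i j] in_i in_j \<epsilon> small[OF \<epsilon>(2)]
        by (meson connected_component_sym connected_component_trans)
    next
      case False
      hence "i \<le> p \<or> q \<le> i" "j \<le> p \<or> q \<le> j" using True by auto
      thus ?thesis using label_down[of i \<epsilon>] label_down[of j \<epsilon>] below_connected[of i j] \<epsilon>
        by (meson connected_component_sym connected_component_trans)
    qed
    have "\<not> (\<forall>\<^sub>F \<epsilon> in at_right 0. \<not> connected_component ?S (real i, H i - \<epsilon>) (real j, H j - \<epsilon>))"
    proof
      assume "\<forall>\<^sub>F \<epsilon> in at_right 0. \<not> connected_component ?S (real i, H i - \<epsilon>) (real j, H j - \<epsilon>)"
      hence "\<forall>\<^sub>F \<epsilon> :: real in at_right 0. False" using small_ev by eventually_elim (use conn in blast)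
      thus False by simp
    qed
    thus ?thesis using True sep by simp
  next
    case False
    have "\<forall>\<^sub>F \<epsilon> in at_right 0. \<not> connected_component ?S (real i, H i - \<epsilon>) (real j, H j - \<epsilon>)"
      using small_ev
    proof eventually_elim
      case (elim \<epsilon>)
      show ?case
      proof (cases "p < i \<and> i < q")
        case True
        then show ?thesis using cross inR[of i \<epsilon>] outR[of j] False elim by blast
      next
        case no: False
        hence "p < j \<and> j < q" using False by blast
        then show ?thesis using cross inR[of j \<epsilon>] outR[of i, OF no] elim connected_component_sym by blast
      qed
    qed
    thus ?thesis using False sep by simp
  qed
qed

end

section \<open>The partition of a path in terms of parents\<close>

context coprime_pair
begin

definition word_partition :: "nat list \<Rightarrow> nat set set" where
  "word_partition v = (\<lambda>s. {t \<in> {1..n}. par v t = par v s}) ` {1..n}"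

text \<open>The valleys whose lasers enclose a label are its nonzero ancestors, and the parent is
  the largest of them. So equal sets of enclosing lasers mean equal parents, and conversely all
  ancestors are inherited through the parent.\<close>

lemma same_par_iff:
  assumes dw: "dyck_word v" and i: "1 \<le> i" "i \<le> n" and j: "1 \<le> j" "j \<le> n"
  shows "(\<forall>p. 1 \<le> p \<and> p < b \<and> 0 < v ! p \<longrightarrow> (p < i \<and> i < next_lower v p) = (p < j \<and> j < next_lower v p))
    \<longleftrightarrow> par v i = par v j"
proof -
  have ib: "0 < t" "t < b" if "1 \<le> t" "t \<le> n" for t using that b_eq by auto
  have inI: "p < t \<and> t < next_lower v p \<longleftrightarrow> p < t \<and> (\<forall>s. p < s \<and> s \<le> t \<longrightarrow> level v p < level v s)"
    if "1 \<le> p" "p < b" for p t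
    using next_lower_props[OF dw that] by (metis le_less_trans not_less order_less_asym)
  have anc_le: "p \<le> par v t" if t: "1 \<le> t" "t \<le> n" "p < t" "level v p < level v t" for p t
    using par_between[OF dw ib[OF t(1,2)], of p] t by (meson not_less order_less_asym)
  have anc_par: "level v (par v t) < level v s" if t: "1 \<le> t" "t \<le> n" "par v t < s" "s \<le> t" for t s
    using level_between[OF dw ib[OF t(1,2)] t(3,4)] .
  show ?thesis
  proof
    assume *: "\<forall>p. 1 \<le> p \<and> p < b \<and> 0 < v ! p \<longrightarrow> (p < i \<and> i < next_lower v p) = (p < j \<and> j < next_lower v p)"
    have le: "par v x \<le> par v y" if x: "1 \<le> x" "x \<le> n" and y: "1 \<le> y" "y \<le> n"
      and all: "\<forall>p. 1 \<le> p \<and> p < b \<and> 0 < v ! p \<longrightarrow> (p < x \<and> x < next_lower v p) = (p < y \<and> y < next_lower v p)" for x y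
    proof (cases "par v x = 0")
      case False
      have px: "par v x < x" "0 < v ! par v x" using par_less[OF dw ib[OF x]] nonleaf_par[OF dw ib[OF x]] by auto
      have r: "1 \<le> par v x" "par v x < b" using False px ib(2)[OF x] by auto
      have "par v x < x \<and> x < next_lower v (par v x)" unfolding inI[OF r] using px anc_par[OF x] by blast
      hence "par v x < y \<and> y < next_lower v (par v x)" using all r px by blast
      hence "par v x < y" "level v (par v x) < level v y" unfolding inI[OF r] by auto
      thus ?thesis by (intro anc_le[OF y])
    qed simp
    show "par v i = par v j" using le[OF i j *] le[OF j i] * by (intro antisym) auto
  next
    assume eq: "par v i = par v j"
    have "p < y \<and> y < next_lower v p" if x: "1 \<le> x" "x \<le> n" and y: "1 \<le> y" "y \<le> n" and e: "par v x = par v y"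
      and p: "1 \<le> p" "p < b" and h: "p < x \<and> x < next_lower v p" for x y p
    proof -
      have h': "p < x" "\<And>s. p < s \<Longrightarrow> s \<le> x \<Longrightarrow> level v p < level v s" using h unfolding inI[OF p] by auto
      have pq: "p \<le> par v x" using h'(1) h'(2)[of x] by (intro anc_le[OF x]) auto
      have px: "par v x < x" "par v x < y" using par_less[OF dw ib[OF x]] par_less[OF dw ib[OF y]] e by auto
      have "level v p < level v s" if s: "p < s" "s \<le> y" for s
      proof (cases "s \<le> par v x")
        case True
        then show ?thesis using h'(2)[of s] s px by simp
      next
        case False
        hence "level v (par v y) < level v s" using s e by (intro anc_par[OF y]) auto
        moreover have "level v p \<le> level v (par v x)" using h'(2)[of "par v x"] pq px by (cases "p = par v x") auto
        ultimately show ?thesis using e by simp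
      qed
      thus ?thesis unfolding inI[OF p] using pq px by simp
    qed
    thus "\<forall>p. 1 \<le> p \<and> p < b \<and> 0 < v ! p \<longrightarrow> (p < i \<and> i < next_lower v p) = (p < j \<and> j < next_lower v p)"
      using i j eq by metis
  qed
qed

theorem dyck_partition_path_of:
  assumes dw: "dyck_word v"
  shows "dyck_partition a b (path_of v) = word_partition v"
proof -
  have len: "length v = b" using dw by (simp add: dyck_word_def)
  have "(\<forall>P \<in> valleys (path_of v). \<not> separated a b (path_of v) P i j) \<longleftrightarrow> par v i = par v j"
    if ij: "1 \<le> i" "i \<le> n" "1 \<le> j" "j \<le> n" for i j
  proof -
    have "separated a b (path_of v) (real p, ht v p) i j \<longleftrightarrow> (p < i \<and> i < next_lower v p) \<noteq> (p < j \<and> j < next_lower v p)"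
      if "1 \<le> p" "p < b" "0 < v ! p" for p
    proof -
      interpret valley a b n v p by unfold_locales (use dw that in auto)
      show ?thesis by (rule separated_iff) (use ij in auto)
    qed
    hence "(\<forall>P \<in> valleys (path_of v). \<not> separated a b (path_of v) P i j) \<longleftrightarrow>
      (\<forall>p. 1 \<le> p \<and> p < b \<and> 0 < v ! p \<longrightarrow> (p < i \<and> i < next_lower v p) = (p < j \<and> j < next_lower v p))"
      unfolding valleys_path_of len by blast
    also have "\<dots> \<longleftrightarrow> par v i = par v j" by (rule same_par_iff[OF dw ij])
    finally show ?thesis .
  qed
  hence "{(i, j). i \<in> {1..b - 1} \<and> j \<in> {1..b - 1} \<and> (\<forall>P \<in> valleys (path_of v). \<not> separated a b (path_of v) P i j)}
     = {(i, j). i \<in> {1..n} \<and> j \<in> {1..n} \<and> par v i = par v j}"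
    using b_eq by auto
  moreover have "b - 1 = n" using b_eq by simp
  moreover have "{1..n} // {(i, j). i \<in> {1..n} \<and> j \<in> {1..n} \<and> par v i = par v j} = word_partition v"
    unfolding word_partition_def quotient_def by (force simp: Image_def)
  ultimately show ?thesis unfolding dyck_partition_def by simp
qed

lemma NC_eq: "NC a b = word_partition ` {v. dyck_word v}"
  unfolding NC_def using dyck_path_iff dyck_partition_path_of by auto

subsection \<open>Ranks of the blocks\<close>

definition blk :: "nat list \<Rightarrow> nat \<Rightarrow> nat set" where
  "blk v q = {t \<in> {1..n}. par v t = q}"

definition nodes :: "nat list \<Rightarrow> nat set" where
  "nodes v = {q. q < n \<and> 0 < v ! q}"

lemma finite_nodes [simp]: "finite (nodes v)" and finite_blk [simp]: "finite (blk v q)"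
  by (simp_all add: nodes_def blk_def)

lemma label_range: "t \<in> {1..n} \<Longrightarrow> 0 < t" "t \<in> {1..n} \<Longrightarrow> t < b"
  by (auto simp: b_eq)

lemma Suc_in_blk: "q \<in> nodes v \<Longrightarrow> Suc q \<in> blk v q"
  by (auto simp: nodes_def blk_def par_Suc)

lemma par_in_nodes:
  assumes "dyck_word v" "t \<in> {1..n}" shows "par v t \<in> nodes v"
  using par_less[OF assms(1) label_range[OF assms(2)]] nonleaf_par[OF assms(1) label_range[OF assms(2)]] assms(2)
  by (auto simp: nodes_def)

lemma word_partition_blk:
  assumes "dyck_word v" shows "word_partition v = blk v ` nodes v"
proof (intro equalityI subsetI)
  fix B assume "B \<in> word_partition v"
  then obtain s where "s \<in> {1..n}" "B = blk v (par v s)" by (auto simp: word_partition_def blk_def)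
  thus "B \<in> blk v ` nodes v" using par_in_nodes[OF assms] by blast
next
  fix B assume "B \<in> blk v ` nodes v"
  then obtain q where q: "q \<in> nodes v" "B = blk v q" by blast
  have "Suc q \<in> {1..n}" "par v (Suc q) = q" using Suc_in_blk[OF q(1)] by (auto simp: blk_def)
  thus "B \<in> word_partition v" using q(2) unfolding word_partition_def blk_def by (intro image_eqI[of _ _ "Suc q"]) auto
qed

lemma Min_blk:
  assumes "dyck_word v" "q \<in> nodes v" shows "Min (blk v q) = Suc q"
proof (rule Min_eqI)
  show "Suc q \<le> t" if "t \<in> blk v q" for t
    using that par_less[OF assms(1), of t] label_range[of t] by (auto simp: blk_def)
qed (use Suc_in_blk[OF assms(2)] in auto)

lemma Max_blk:
  assumes "dyck_word v" "q \<in> nodes v"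
  shows "Max (blk v q) \<in> {1..n}" "par v (Max (blk v q)) = q" "q < Max (blk v q)" "\<And>t. t \<in> blk v q \<Longrightarrow> t \<le> Max (blk v q)"
proof -
  have "Max (blk v q) \<in> blk v q" using Suc_in_blk[OF assms(2)] by (intro Max_in) auto
  thus "Max (blk v q) \<in> {1..n}" "par v (Max (blk v q)) = q" by (auto simp: blk_def)
  show le: "t \<le> Max (blk v q)" if "t \<in> blk v q" for t using that by simp
  show "q < Max (blk v q)" using le[OF Suc_in_blk[OF assms(2)]] by simp
qed

lemma inj_on_blk:
  assumes "dyck_word v" shows "inj_on (blk v) (nodes v)"
  by (rule inj_onI) (metis Min_blk[OF assms] nat.inject)

text \<open>By noncrossing, a block whose minimum lies in the interval of another block ends inside
  it; a later end would force contradictory inequalities between the levels of \<open>q'\<close> and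
  the two maxima.\<close>

lemma block_le_blk:
  assumes dw: "dyck_word v" and q: "q \<in> nodes v" "q' \<in> nodes v"
  shows "block_le (blk v q') (blk v q) \<longleftrightarrow> q \<le> q' \<and> q' < Max (blk v q)"
proof -
  note M = Max_blk[OF dw q(1)] and M' = Max_blk[OF dw q(2)]
  have "block_le (blk v q') (blk v q) \<longleftrightarrow> q \<le> q' \<and> Max (blk v q') \<le> Max (blk v q)"
    using M'(3) by (auto simp: block_le_def Min_blk[OF dw] q)
  also have "\<dots> \<longleftrightarrow> q \<le> q' \<and> q' < Max (blk v q)"
  proof
    assume "q \<le> q' \<and> Max (blk v q') \<le> Max (blk v q)"
    thus "q \<le> q' \<and> q' < Max (blk v q)" using M'(3) by simp
  next
    assume *: "q \<le> q' \<and> q' < Max (blk v q)"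
    have "Max (blk v q') \<le> Max (blk v q)"
    proof (rule ccontr)
      assume "\<not> Max (blk v q') \<le> Max (blk v q)"
      hence gt: "Max (blk v q) < Max (blk v q')" by simp
      hence "q \<noteq> q'" by auto
      hence "level v (Max (blk v q)) < level v q'"
        using par_between[OF dw label_range[OF M(1)], of q'] M(2) * by auto
      moreover have "level v (Max (blk v q')) < level v (Max (blk v q))"
        using par_between[OF dw label_range[OF M'(1)], of "Max (blk v q)"] M'(2) * gt by auto
      moreover have "level v q' < level v (Max (blk v q'))"
        using level_par[OF dw label_range[OF M'(1)]] M'(2) by simp
      ultimately show False by simp
    qed
    thus "q \<le> q' \<and> Max (blk v q') \<le> Max (blk v q)" using * by simp
  qed
  finally show ?thesis .
qed

text \<open>After the last child of \<open>q\<close> and its descendants the level drops below that of \<open>q\<close>, and no step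
  lowers it by more than \<open>a < b\<close>.\<close>

lemma level_Max_blk:
  assumes dw: "dyck_word v" and q: "q \<in> nodes v"
  shows "level v q < level v (Max (blk v q))" "level v (Max (blk v q)) < level v q + int b"
proof -
  define M where "M = Max (blk v q)"
  note Mx = Max_blk[OF dw q, folded M_def]
  have M: "1 \<le> M" "M < b" using Mx(1) b_eq by auto
  show "level v q < level v (Max (blk v q))"
    using level_par[OF dw label_range[OF Mx(1)]] Mx(2) by (simp add: M_def)
  define t where "t = next_lower v M"
  note t = next_lower_props[OF dw M, folded t_def]
  \<comment> \<open>Otherwise \<open>t\<close> would be a child of \<open>q\<close> beyond its last
    child.\<close>
  have "level v t \<le> level v q"
  proof (rule ccontr)
    assume "\<not> level v t \<le> level v q"
    hence gt: "level v q < level v t" by simp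
    have "q \<le> b" using q b_eq by (simp add: nodes_def)
    hence qn: "0 \<le> level v q" using dw by (simp add: dyck_word_def)
    have "t \<noteq> b" using gt qn level_end[OF dw] by auto
    hence tn: "t \<in> {1..n}" using t(1,2) b_eq by auto
    have "par v t = q"
    proof (rule par_eqI)
      show "q < t" using Mx(3) t(1) by simp
      show "level v q < level v t" by (rule gt)
      fix s assume s: "q < s" "s < t"
      consider "s < M" | "s = M" | "M < s" by linarith
      thus "level v t \<le> level v s"
      proof cases
        case 1
        then show ?thesis using par_between[OF dw label_range[OF Mx(1)], of s] Mx(2) s t(3) by simp
      next
        case 2
        then show ?thesis using t(3) by simp
      next
        case 3
        then show ?thesis using t(4)[of s] s t(3) by simp
      qed
    qed
    hence "t \<in> blk v q" using tn by (simp add: blk_def)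
    thus False using Mx(4) t(1) by fastforce
  qed
  moreover have "level v M \<le> level v (t - 1)"
  proof (cases "t - 1 = M")
    case False
    hence "M < t - 1" "t - 1 < t" using t(1) by linarith+
    thus ?thesis using t(4) by (simp add: less_imp_le)
  qed simp
  moreover have "level v (t - 1) - int a \<le> level v t"
    using level_Suc[of v "t - 1"] t(1) by simp
  ultimately show "level v (Max (blk v q)) < level v q + int b" using a_less by (simp add: M_def)
qed

text \<open>The level gained from \<open>q\<close> to its last child is
  \<open>b S - a (Max - q)\<close> and lies strictly between 0 and \<open>b\<close>, so
  \<open>S\<close> is the ceiling of \<open>(Max - q) a / b\<close>. The minimum of the block is
  \<open>q + 1\<close>, which accounts for the \<open>+ 1\<close>.\<close>

lemma sum_nodes_below:
  assumes dw: "dyck_word v" and q: "q \<in> nodes v"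
  shows "(\<Sum>q' | q' \<in> nodes v \<and> q \<le> q' \<and> q' < Max (blk v q). int (v ! q'))
     = \<lceil>(real (Max (blk v q)) - real (Min (blk v q)) + 1) * (real a / real b)\<rceil>"
proof -
  define M where "M = Max (blk v q)"
  note Mx = Max_blk[OF dw q, folded M_def]
  define S where "S = (\<Sum>q'=q..<M. int (v ! q'))"
  have "(\<Sum>q' | q' \<in> nodes v \<and> q \<le> q' \<and> q' < M. int (v ! q')) = S"
    unfolding S_def using Mx(1) by (intro sum.mono_neutral_left) (auto simp: nodes_def)
  moreover have "level v M - level v q = int b * S - int a * (int M - int q)"
  proof -
    have "(\<Sum>i<M. int (v ! i)) = (\<Sum>i<q. int (v ! i)) + S"
      using Mx(3) by (simp add: S_def lessThan_atLeast0 sum.atLeastLessThan_concat)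
    thus ?thesis by (simp add: level_def algebra_simps)
  qed
  hence S: "0 < int b * S - int a * (int M - int q)" "int b * S - int a * (int M - int q) < int b"
    using level_Max_blk[OF dw q] by (auto simp: M_def)
  have bpos: "0 < real b" using a_less by simp
  have "\<lceil>(real M - real q) * (real a / real b)\<rceil> = S"
  proof (rule ceiling_unique)
    have "real_of_int (int a * (int M - int q)) < real_of_int (int b * S)" using S(1) by linarith
    thus "(real M - real q) * (real a / real b) \<le> of_int S" using bpos by (simp add: field_simps)
    have "real_of_int (int b * S) < real_of_int (int a * (int M - int q) + int b)" using S(2) by linarith
    thus "of_int S - 1 < (real M - real q) * (real a / real b)" using bpos by (simp add: field_simps)
  qed
  moreover have e: "real M - real (Min (blk v q)) + 1 = real M - real q" by (simp add: Min_blk[OF dw q])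
  ultimately show ?thesis unfolding M_def[symmetric] e by simp
qed

text \<open>The runs satisfy the defining equations by \<open>sum_nodes_below\<close>. The equations
  are triangular with respect to the opening positions, hence have no other extensional
  solution.\<close>

lemma rank_fun_blk:
  assumes dw: "dyck_word v" and q: "q \<in> nodes v"
  shows "rank_fun a b (word_partition v) (blk v q) = int (v ! q)"
proof -
  let ?\<pi> = "word_partition v"
  let ?c = "\<lambda>B. \<lceil>(real (Max B) - real (Min B) + 1) * (real a / real b)\<rceil>"
  define P where "P f \<longleftrightarrow> f \<in> extensional ?\<pi> \<and> (\<forall>B\<in>?\<pi>. (\<Sum>B' | B' \<in> ?\<pi> \<and> block_le B' B. f B') = ?c B)" for f :: "nat set \<Rightarrow> int"
  have pi: "?\<pi> = blk v ` nodes v" by (rule word_partition_blk[OF dw])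
  have sum_eq: "(\<Sum>B' | B' \<in> ?\<pi> \<and> block_le B' (blk v q). f B') = (\<Sum>q' | q' \<in> nodes v \<and> q \<le> q' \<and> q' < Max (blk v q). f (blk v q'))"
    if "q \<in> nodes v" for q and f :: "nat set \<Rightarrow> int"
  proof -
    have "{B'. B' \<in> ?\<pi> \<and> block_le B' (blk v q)} = blk v ` {q'. q' \<in> nodes v \<and> q \<le> q' \<and> q' < Max (blk v q)}"
      unfolding pi using block_le_blk[OF dw that] by auto
    moreover have "inj_on (blk v) {q'. q' \<in> nodes v \<and> q \<le> q' \<and> q' < Max (blk v q)}"
      by (rule inj_on_subset[OF inj_on_blk[OF dw]]) auto
    ultimately show ?thesis by (simp add: sum.reindex)
  qed
  define g where "g = restrict (\<lambda>B. int (v ! (Min B - 1))) ?\<pi>"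
  have g_blk: "g (blk v q) = int (v ! q)" if "q \<in> nodes v" for q
    using that by (simp add: g_def pi Min_blk[OF dw])
  have "P g"
    unfolding P_def
  proof (intro conjI ballI)
    show "g \<in> extensional ?\<pi>" by (simp add: g_def)
    fix B assume "B \<in> ?\<pi>"
    then obtain q where q: "q \<in> nodes v" "B = blk v q" unfolding pi by blast
    have "(\<Sum>B' | B' \<in> ?\<pi> \<and> block_le B' B. g B') = (\<Sum>q' | q' \<in> nodes v \<and> q \<le> q' \<and> q' < Max (blk v q). int (v ! q'))"
      unfolding q(2) sum_eq[OF q(1)] by (intro sum.cong) (auto simp: g_blk)
    thus "(\<Sum>B' | B' \<in> ?\<pi> \<and> block_le B' B. g B') = ?c B" unfolding q(2) by (simp only: sum_nodes_below[OF dw q(1)])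
  qed
  moreover have "f = g" if "P f" for f
  proof (rule extensionalityI[of _ ?\<pi>])
    show "f \<in> extensional ?\<pi>" "g \<in> extensional ?\<pi>" using that \<open>P g\<close> by (auto simp: P_def)
    \<comment> \<open>Downward induction on the opening position \<open>n - k\<close>: all other
      blocks in the sum open later.\<close>
    have "f (blk v (n - k)) = g (blk v (n - k))" if "n - k \<in> nodes v" for k
      using that
    proof (induction k rule: less_induct)
      case (less k)
      define q where "q = n - k"
      have q: "q \<in> nodes v" using less.prems by (simp add: q_def)
      let ?A = "{q'. q' \<in> nodes v \<and> q \<le> q' \<and> q' < Max (blk v q)}"
      have B: "blk v q \<in> ?\<pi>" using q pi by simp
      have "(\<Sum>q'\<in>?A. f (blk v q')) = (\<Sum>q'\<in>?A. g (blk v q'))"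
        using \<open>P f\<close> \<open>P g\<close> B unfolding P_def by (simp flip: sum_eq[OF q])
      moreover have "q \<in> ?A" "finite ?A" using q Max_blk(3)[OF dw q] by auto
      ultimately have "f (blk v q) + (\<Sum>q'\<in>?A - {q}. f (blk v q')) = g (blk v q) + (\<Sum>q'\<in>?A - {q}. g (blk v q'))"
        using sum.remove[of ?A q "\<lambda>q'. f (blk v q')"] sum.remove[of ?A q "\<lambda>q'. g (blk v q')"] by simp
      moreover have "(\<Sum>q'\<in>?A - {q}. f (blk v q')) = (\<Sum>q'\<in>?A - {q}. g (blk v q'))"
      proof (rule sum.cong[OF refl])
        fix q' assume "q' \<in> ?A - {q}"
        hence q': "q' \<in> nodes v" "q < q'" by auto
        hence "q' < n" by (simp add: nodes_def)
        hence "n - (n - q') = q'" "n - q' < k" using q' unfolding q_def by auto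
        thus "f (blk v q') = g (blk v q')" using less.IH[of "n - q'"] q' by simp
      qed
      ultimately show ?case by (simp add: q_def)
    qed
    hence "f (blk v q) = g (blk v q)" if "q \<in> nodes v" for q
    proof -
      have "n - (n - q) = q" using that by (simp add: nodes_def)
      thus ?thesis using \<open>\<And>k. n - k \<in> nodes v \<Longrightarrow> f (blk v (n - k)) = g (blk v (n - k))\<close>[of "n - q"] that by simp
    qed
    thus "f B = g B" if "B \<in> ?\<pi>" for B using that unfolding pi by blast
  qed
  ultimately have "(THE f. P f) = g" by (rule the_equality)
  moreover have "rank_fun a b ?\<pi> = (THE f. P f)" unfolding rank_fun_def P_def ..
  ultimately show ?thesis using g_blk[OF q] by simp
qed

text \<open>Minima of blocks give the positions of the nonzero runs, and ranks give their
  lengths.\<close>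

lemma word_partition_inj:
  assumes dv: "dyck_word v" and du: "dyck_word u" and eq: "word_partition v = word_partition u"
  shows "v = u"
proof (rule nth_equalityI)
  show "length v = length u" using dv du by (simp add: dyck_word_def)
  have sub: "q \<in> nodes y \<and> y ! q = x ! q"
    if x: "dyck_word x" and y: "dyck_word y" and e: "word_partition x = word_partition y" and q: "q \<in> nodes x" for x y q
  proof -
    have "blk x q \<in> blk y ` nodes y" using q e word_partition_blk[OF x] word_partition_blk[OF y] by blast
    then obtain q' where q': "q' \<in> nodes y" "blk x q = blk y q'" by blast
    hence "q = q'" using Min_blk[OF x q] Min_blk[OF y q'(1)] by simp
    thus ?thesis using q' rank_fun_blk[OF x q] rank_fun_blk[OF y q'(1)] e by simp
  qed
  fix i assume "i < length v"
  hence "i < b" using dv by (simp add: dyck_word_def)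
  hence "i < n \<or> i = n" using b_eq by linarith
  thus "v ! i = u ! i"
  proof
    assume i: "i < n"
    show ?thesis
    proof (cases "0 < v ! i")
      case True
      hence "i \<in> nodes v" using i by (simp add: nodes_def)
      from sub[OF dv du eq this] show ?thesis by simp
    next
      case False
      show ?thesis
      proof (rule ccontr)
        assume "v ! i \<noteq> u ! i"
        hence "i \<in> nodes u" using i False by (simp add: nodes_def)
        from sub[OF du dv eq[symmetric] this] show False using \<open>v ! i \<noteq> u ! i\<close> by simp
      qed
    qed
  qed (use last_zero[OF dv] last_zero[OF du] in simp)
qed

lemma card_rank_blocks:
  assumes dw: "dyck_word v" and i: "0 < i"
  shows "card {B \<in> word_partition v. rank_fun a b (word_partition v) B = int i} = count (mset v) i"
proof -
  have "{B \<in> word_partition v. rank_fun a b (word_partition v) B = int i} = blk v ` {q \<in> nodes v. v ! q = i}"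
    using word_partition_blk[OF dw] rank_fun_blk[OF dw] by auto
  moreover have "inj_on (blk v) {q \<in> nodes v. v ! q = i}" by (rule inj_on_subset[OF inj_on_blk[OF dw]]) auto
  ultimately have "card {B \<in> word_partition v. rank_fun a b (word_partition v) B = int i} = card {q \<in> nodes v. v ! q = i}"
    by (simp add: card_image)
  also have "{q \<in> nodes v. v ! q = i} = {q. q < length v \<and> v ! q = i}"
  proof -
    have "q < n \<longleftrightarrow> q < b" if "v ! q = i" for q
    proof -
      have "q \<noteq> n" using that last_zero[OF dw] i by auto
      thus ?thesis using b_eq by linarith
    qed
    moreover have "length v = b" using dw by (simp add: dyck_word_def)
    ultimately show ?thesis using i by (auto simp: nodes_def)
  qed
  also have "card \<dots> = count (mset v) i"
    by (simp add: count_mset count_list_eq_length_filter length_filter_conv_card eq_commute)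
  finally show ?thesis .
qed

section \<open>Rotation of partitions as a power of \<open>turn\<close>\<close>

lemma rot_turn_label: "t \<in> {1..n} \<Longrightarrow> rot n (turn_label t) = t" "t \<in> {1..n} \<Longrightarrow> turn_label t \<in> {1..n}"
  using n_pos by (auto simp: rot_def turn_label_def)

lemma turn_label_rot: "t \<in> {1..n} \<Longrightarrow> turn_label (rot n t) = t" "t \<in> {1..n} \<Longrightarrow> rot n t \<in> {1..n}"
  using n_pos by (auto simp: rot_def turn_label_def)

lemma rot_word_partition_turn:
  assumes dw: "dyck_word v" shows "rot_partition n (word_partition (turn v)) = word_partition v"
proof -
  have par_iff: "par (turn v) (turn_label s) = par (turn v) (turn_label t) \<longleftrightarrow> par v s = par v t"
    if "s \<in> {1..n}" "t \<in> {1..n}" for s t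
    using par_turn[OF dw label_range[OF that(1)]] par_turn[OF dw label_range[OF that(2)]]
      turn_node_inj[OF dw] nonleaf_par[OF dw label_range[OF that(1)]] nonleaf_par[OF dw label_range[OF that(2)]]
    by auto
  have cls: "rot n ` {t \<in> {1..n}. par (turn v) t = par (turn v) (turn_label s)} = {t \<in> {1..n}. par v t = par v s}"
    if s: "s \<in> {1..n}" for s
  proof (intro equalityI subsetI)
    fix x assume "x \<in> rot n ` {t \<in> {1..n}. par (turn v) t = par (turn v) (turn_label s)}"
    then obtain t where t: "t \<in> {1..n}" "par (turn v) t = par (turn v) (turn_label s)" "x = rot n t" by blast
    have "x \<in> {1..n}" "turn_label x = t" using turn_label_rot[OF t(1)] t(3) by auto
    thus "x \<in> {t \<in> {1..n}. par v t = par v s}" using par_iff[of x s] s t(2) by simp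
  next
    fix x assume x: "x \<in> {t \<in> {1..n}. par v t = par v s}"
    hence "turn_label x \<in> {t \<in> {1..n}. par (turn v) t = par (turn v) (turn_label s)}"
      using par_iff[of x s] s rot_turn_label(2)[of x] by simp
    moreover have "x = rot n (turn_label x)" using rot_turn_label(1)[of x] x by simp
    ultimately show "x \<in> rot n ` {t \<in> {1..n}. par (turn v) t = par (turn v) (turn_label s)}" by blast
  qed
  have "turn_label ` {1..n} = {1..n}"
  proof (intro equalityI subsetI)
    fix x assume "x \<in> turn_label ` {1..n}"
    thus "x \<in> {1..n}" using rot_turn_label(2) by blast
  next
    fix x assume x: "x \<in> {1..n}"
    show "x \<in> turn_label ` {1..n}"
      by (rule image_eqI[of _ _ "rot n x"]) (use turn_label_rot[OF x] in auto)
  qed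
  hence "word_partition (turn v) = (\<lambda>s. {t \<in> {1..n}. par (turn v) t = par (turn v) (turn_label s)}) ` {1..n}"
    unfolding word_partition_def using image_image[of "\<lambda>s. {t \<in> {1..n}. par (turn v) t = par (turn v) s}" turn_label "{1..n}"]
    by simp
  hence "rot_partition n (word_partition (turn v)) =
      (\<lambda>s. rot n ` {t \<in> {1..n}. par (turn v) t = par (turn v) (turn_label s)}) ` {1..n}"
    unfolding rot_partition_def by (simp only: image_image)
  also have "\<dots> = word_partition v" unfolding word_partition_def by (intro image_cong refl cls)
  finally show ?thesis .
qed

lemma rot_word_partition:
  assumes "dyck_word v" shows "rot_partition n (word_partition v) = word_partition ((turn ^^ (n - 1)) v)"
proof -
  have "turn ((turn ^^ (n - 1)) v) = v"
    using turn_pow_n[OF assms] n_pos by (metis One_nat_def Suc_pred comp_apply funpow.simps(2))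
  thus ?thesis using rot_word_partition_turn[OF dyck_turn_pow[OF assms, of "n - 1"]] by simp
qed

lemma rot_pow_word_partition:
  assumes "dyck_word v" shows "(rot_partition n ^^ g) (word_partition v) = word_partition ((turn ^^ ((n - 1) * g)) v)"
proof (induction g)
  case (Suc g)
  have "(rot_partition n ^^ Suc g) (word_partition v) = word_partition ((turn ^^ (n - 1)) ((turn ^^ ((n - 1) * g)) v))"
    using Suc rot_word_partition[OF dyck_turn_pow[OF assms]] by simp
  also have "(turn ^^ (n - 1)) ((turn ^^ ((n - 1) * g)) v) = (turn ^^ ((n - 1) * Suc g)) v"
    by (simp add: funpow_add)
  finally show ?case .
qed simp

lemma turn_pow_fixed_iff:
  assumes "dyck_word v"
  shows "(turn ^^ ((n - 1) * g)) v = v \<longleftrightarrow> (turn ^^ g) v = v"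
proof -
  have e: "(turn ^^ g) ((turn ^^ ((n - 1) * g)) v) = v"
  proof -
    have "g + (n - 1) * g = n * g" using n_pos by (cases n) auto
    thus ?thesis using turn_pow_nmult[OF assms, of g] by (metis comp_apply funpow_add)
  qed
  show ?thesis
  proof
    assume "(turn ^^ ((n - 1) * g)) v = v"
    thus "(turn ^^ g) v = v" using e by simp
  next
    assume "(turn ^^ g) v = v"
    thus "(turn ^^ ((n - 1) * g)) v = v"
      using e turn_pow_inj[OF dyck_turn_pow[OF assms, of "(n - 1) * g"] assms, of g] by simp
  qed
qed

end

subsection \<open>Cyclic sieving\<close>

context coprime_pair
begin

text \<open>The letters of all words whose partition has the prescribed ranks. The zeros fill up the
  length \<open>b\<close>, so the multiplicities are exactly the arguments of the factorials in the
  denominator.\<close>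

definition run_mset :: "(nat \<Rightarrow> nat) \<Rightarrow> nat multiset" where
  "run_mset r = (\<Sum>i\<in>{1..a}. replicate_mset (r i) i) + replicate_mset (b - sum r {1..a}) 0"

lemma count_sum_replicate_mset:
  "finite A \<Longrightarrow> count (\<Sum>i\<in>A. replicate_mset (f i) i) j = (if j \<in> A then f j else 0)"
  by (simp add: count_sum)

lemma count_run_mset:
  "count (run_mset r) j = (if j = 0 then b - sum r {1..a} else if j \<le> a then r j else 0)"
  by (auto simp: run_mset_def count_sum_replicate_mset)

lemma size_sum_count:
  assumes "set_mset M \<subseteq> A" "finite A" shows "size M = (\<Sum>j\<in>A. count M j)"
  unfolding size_multiset_overloaded_eq
  by (rule sum.mono_neutral_left) (use assms in \<open>auto simp: not_in_iff\<close>)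

lemma set_run_mset: "set_mset (run_mset r) \<subseteq> {0..a}"
proof
  fix x assume "x \<in> set_mset (run_mset r)"
  hence "count (run_mset r) x \<noteq> 0" by simp
  thus "x \<in> {0..a}" by (auto simp: count_run_mset split: if_splits)
qed

lemma interval_insert_0: "{0..a} = insert 0 {1..a}"
  by auto

lemma sum_runs_le:
  assumes "(\<Sum>i=1..a. i * r i) = a" shows "sum r {1..a} \<le> a"
proof -
  have "sum r {1..a} \<le> (\<Sum>i=1..a. i * r i)" by (rule sum_mono) auto
  thus ?thesis using assms by simp
qed

lemma size_run_mset:
  assumes "(\<Sum>i=1..a. i * r i) = a" shows "size (run_mset r) = b"
proof -
  have "size (run_mset r) = (\<Sum>j\<in>{0..a}. count (run_mset r) j)"
    by (rule size_sum_count[OF set_run_mset]) simp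
  also have "\<dots> = (b - sum r {1..a}) + sum r {1..a}"
    unfolding interval_insert_0 by (simp add: count_run_mset)
  finally show ?thesis using sum_runs_le[OF assms] a_less by simp
qed

lemma sum_run_mset:
  assumes "(\<Sum>i=1..a. i * r i) = a" shows "sum_mset (run_mset r) = a"
proof -
  have "sum_mset (\<Sum>i\<in>A. replicate_mset (r i) i) = (\<Sum>i\<in>A. i * r i)" if "finite A" for A
    using that by (induction A rule: finite_induct) (auto simp: mult.commute)
  thus ?thesis using assms by (simp add: run_mset_def)
qed

lemma mset_eq_run_mset_iff:
  assumes dw: "dyck_word v" and r: "(\<Sum>i=1..a. i * r i) = a"
  shows "mset v = run_mset r \<longleftrightarrow> (\<forall>i\<in>{1..a}. count (mset v) i = r i)"
proof
  assume "mset v = run_mset r"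
  thus "\<forall>i\<in>{1..a}. count (mset v) i = r i" by (simp add: count_run_mset)
next
  assume *: "\<forall>i\<in>{1..a}. count (mset v) i = r i"
  have len: "length v = b" and sm: "sum_list v = a" using dw by (auto simp: dyck_word_def)
  have sub: "set_mset (mset v) \<subseteq> {0..a}" using member_le_sum_list[of _ v] sm by auto
  have "b = (\<Sum>j\<in>{0..a}. count (mset v) j)" using size_sum_count[OF sub] len by simp
  also have "\<dots> = count (mset v) 0 + sum r {1..a}" unfolding interval_insert_0 using * by simp
  finally have z: "count (mset v) 0 = b - sum r {1..a}" by simp
  show "mset v = run_mset r"
  proof (rule multiset_eqI)
    fix j
    have "count (mset v) j = 0" if "a < j" using sub that by (auto simp: not_in_iff[symmetric])
    thus "count (mset v) j = count (run_mset r) j" using * z by (auto simp: count_run_mset)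
  qed
qed

lemma NC_rank_eq:
  assumes "(\<Sum>i=1..a. i * r i) = a"
  shows "NC_rank a b r = word_partition ` dyck_words (run_mset r)"
proof -
  have "(\<forall>i\<in>{1..a}. card {B \<in> word_partition v. rank_fun a b (word_partition v) B = int i} = r i) \<longleftrightarrow> mset v = run_mset r"
    if "dyck_word v" for v
    unfolding mset_eq_run_mset_iff[OF that assms] using card_rank_blocks[OF that] by auto
  thus ?thesis unfolding NC_rank_def NC_eq dyck_words_def by auto
qed

lemma word_partition_inj_on: "inj_on word_partition (dyck_words M)"
  by (rule inj_onI) (auto simp: dyck_words_def intro: word_partition_inj)

lemma turn_pow_mod:
  assumes "dyck_word v" shows "(turn ^^ (k * (g mod n))) v = (turn ^^ (k * g)) v"
proof -
  have "k * g = k * (g mod n) + n * (k * (g div n))"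
    by (metis distrib_left mod_mult_div_eq mult.left_commute)
  hence "(turn ^^ (k * g)) v = (turn ^^ (k * (g mod n))) ((turn ^^ (n * (k * (g div n)))) v)"
    by (simp add: funpow_add)
  thus ?thesis using turn_pow_nmult[OF assms] by simp
qed

lemma rot_pow_mod:
  assumes "dyck_word v" shows "(rot_partition n ^^ (g mod n)) (word_partition v) = (rot_partition n ^^ g) (word_partition v)"
  by (simp only: rot_pow_word_partition[OF assms] turn_pow_mod[OF assms])

lemma turn_pow_in: "v \<in> dyck_words M \<Longrightarrow> (turn ^^ g) v \<in> dyck_words M"
  by (auto simp: dyck_words_def turn_pow)

lemma rot_action_group_action:
  "group_action (integer_mod_group n) (word_partition ` dyck_words M) (rot_action n (word_partition ` dyck_words M))"
proof -
  let ?X = "word_partition ` dyck_words M" and ?C = "integer_mod_group n"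
  let ?\<phi> = "rot_action n ?X"
  have fin: "finite ?X" using finite_dyck_words by simp
  have maps: "(rot_partition n ^^ g) x \<in> ?X" if x: "x \<in> ?X" for g x
  proof -
    obtain v where v: "v \<in> dyck_words M" "x = word_partition v" using x by blast
    have "dyck_word v" using v by (simp add: dyck_words_def)
    thus ?thesis using turn_pow_in[OF v(1)] unfolding v(2) by (simp add: rot_pow_word_partition)
  qed
  have bij: "?\<phi> x \<in> Bij ?X" for x
  proof -
    let ?f = "rot_partition n ^^ nat x"
    have "inj_on ?f ?X"
    proof (rule inj_onI)
      fix x y assume "x \<in> ?X" "y \<in> ?X" and eq: "?f x = ?f y"
      then obtain u v where uv: "dyck_word u" "dyck_word v" "x = word_partition u" "y = word_partition v"
        by (auto simp: dyck_words_def)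
      show "x = y" using eq uv(3,4) word_partition_inj[OF dyck_turn_pow[OF uv(1)] dyck_turn_pow[OF uv(2)]]
        turn_pow_inj[OF uv(1,2)] unfolding uv(3,4) rot_pow_word_partition[OF uv(1)] rot_pow_word_partition[OF uv(2)]
        by metis
    qed
    moreover have "?f ` ?X \<subseteq> ?X" using maps by blast
    ultimately have "bij_betw ?f ?X ?X" using endo_inj_surj[OF fin] by (simp add: bij_betw_def)
    thus ?thesis by (simp add: Bij_def rot_action_def bij_betw_restrict_eq)
  qed
  have "?\<phi> ((x + y) mod int n) = compose ?X (?\<phi> x) (?\<phi> y)" if "0 \<le> x" "0 \<le> y" for x y
  proof (rule extensionalityI[of _ ?X])
    show "?\<phi> ((x + y) mod int n) \<in> extensional ?X" "compose ?X (?\<phi> x) (?\<phi> y) \<in> extensional ?X"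
      by (simp_all add: rot_action_def)
    fix z assume z: "z \<in> ?X"
    then obtain v where v: "dyck_word v" "z = word_partition v" by (auto simp: dyck_words_def)
    have "nat ((x + y) mod int n) = (nat x + nat y) mod n" using that by (simp add: nat_mod_distrib nat_add_distrib)
    hence "(rot_partition n ^^ nat ((x + y) mod int n)) z = (rot_partition n ^^ (nat x + nat y)) z"
      unfolding v(2) using rot_pow_mod[OF v(1)] by simp
    also have "\<dots> = (rot_partition n ^^ nat x) ((rot_partition n ^^ nat y) z)" by (simp add: funpow_add)
    finally show "?\<phi> ((x + y) mod int n) z = compose ?X (?\<phi> x) (?\<phi> y) z"
      using z maps by (simp add: rot_action_def compose_def)
  qed
  moreover have "carrier ?C = {0..<int n}" using n_pos by (simp add: carrier_integer_mod_group)
  ultimately have "?\<phi> \<in> hom ?C (BijGroup ?X)"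
    using bij by (auto simp: hom_def BijGroup_def)
  thus ?thesis
    by (simp add: group_action_def group_hom_def group_hom_axioms_def group_BijGroup)
qed

lemma turn_pow_mult_fixed: "(turn ^^ g) v = v \<Longrightarrow> (turn ^^ (g * k)) v = v"
  by (induction k) (simp_all add: funpow_add)

text \<open>Bezout: modulo the trivial \<open>n\<close>-th power, the powers \<open>g\<close> and
  \<open>gcd g n\<close> generate the same group.\<close>

lemma turn_pow_gcd_fixed_iff:
  assumes "dyck_word v" shows "(turn ^^ g) v = v \<longleftrightarrow> (turn ^^ gcd g n) v = v"
proof
  assume f: "(turn ^^ g) v = v"
  show "(turn ^^ gcd g n) v = v"
  proof (cases "g = 0")
    case True
    then show ?thesis using turn_pow_n[OF assms] by simp
  next
    case False
    obtain x y where "g * x = n * y + gcd g n" using bezout_nat[OF False, of n] by blast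
    hence "(turn ^^ (g * x)) v = (turn ^^ gcd g n) ((turn ^^ (n * y)) v)"
      by (simp add: funpow_add add.commute[of "n * y"])
    thus ?thesis using turn_pow_mult_fixed[OF f, of x] turn_pow_nmult[OF assms, of y] by simp
  qed
next
  assume "(turn ^^ gcd g n) v = v"
  thus "(turn ^^ g) v = v" using turn_pow_mult_fixed[of "gcd g n" v "g div gcd g n"] by simp
qed

lemma card_invariants:
  "card (invariants (word_partition ` dyck_words M) (rot_action n (word_partition ` dyck_words M)) (int (g mod n)))
     = card {v \<in> dyck_words M. (turn ^^ gcd g n) v = v}"
proof -
  let ?X = "word_partition ` dyck_words M"
  have "rot_action n ?X (int (g mod n)) (word_partition v) = word_partition v \<longleftrightarrow> (turn ^^ gcd g n) v = v"
    if v: "v \<in> dyck_words M" for v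
  proof -
    have dw: "dyck_word v" using v by (simp add: dyck_words_def)
    have "rot_action n ?X (int (g mod n)) (word_partition v) = word_partition ((turn ^^ ((n - 1) * g)) v)"
      using v rot_pow_mod[OF dw, of g] rot_pow_word_partition[OF dw, of g] by (simp add: rot_action_def)
    also have "\<dots> = word_partition v \<longleftrightarrow> (turn ^^ ((n - 1) * g)) v = v"
      using word_partition_inj[OF dyck_turn_pow[OF dw, of "(n - 1) * g"] dw] by auto
    also have "\<dots> \<longleftrightarrow> (turn ^^ gcd g n) v = v"
      unfolding turn_pow_fixed_iff[OF dw] by (rule turn_pow_gcd_fixed_iff[OF dw])
    finally show ?thesis .
  qed
  hence "invariants ?X (rot_action n ?X) (int (g mod n)) = word_partition ` {v \<in> dyck_words M. (turn ^^ gcd g n) v = v}"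
    by (auto simp: invariants_def)
  moreover have "inj_on word_partition {v \<in> dyck_words M. (turn ^^ gcd g n) v = v}"
    by (rule inj_on_subset[OF word_partition_inj_on]) auto
  ultimately show ?thesis by (simp add: card_image)
qed

lemma prod_fact_count:
  assumes "set_mset M \<subseteq> A" "finite A"
  shows "card (permutations_of_multiset M) * (\<Prod>i\<in>A. fact (count M i)) = fact (size M)"
proof -
  have "(\<Prod>i\<in>A. fact (count M i) :: nat) = (\<Prod>i\<in>set_mset M. fact (count M i))"
    by (rule prod.mono_neutral_right) (use assms in \<open>auto simp: not_in_iff\<close>)
  thus ?thesis using card_permutations_of_multiset_aux[of M] by simp
qed

text \<open>For \<open>d = 1\<close> this is the cycle lemma. For \<open>d \<ge> 2\<close> both
  sides depend on whether the multiplicities have the residues 1, 0, ..., 0 modulo \<open>d\<close>: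
  if so, both are the multinomial coefficient of one period, and otherwise both are 0.\<close>

lemma ev_eq_card_fixed:
  assumes M: "size M = b" "sum_mset M = a" "set_mset M \<subseteq> A" "finite A"
    and p: "p * (\<Prod>i\<in>A. q_fact (count M i)) = q_fact n"
    and m: "n = d * m" and w: "primitive_root_of_unity d w"
  shows "ev w p = of_nat (card {v \<in> dyck_words M. (turn ^^ m) v = v})"
proof (cases "d = 1")
  case True
  hence "w = 1" using w by (simp add: primitive_root_of_unity_def)
  have nz: "(\<Prod>i\<in>A. fact (count M i)) \<noteq> (0 :: complex)" using M(4) by simp
  have "m = n" using m True by simp
  have "{v \<in> dyck_words M. (turn ^^ m) v = v} = dyck_words M"
    using turn_pow_n unfolding \<open>m = n\<close> by (auto simp: dyck_words_def)
  moreover have "of_nat (card (dyck_words M)) * (\<Prod>i\<in>A. fact (count M i)) = (fact n :: complex)"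
  proof -
    have "card (dyck_words M) * b * (\<Prod>i\<in>A. fact (count M i)) = fact b"
      using prod_fact_count[OF M(3,4)] card_dyck_words[OF M(1,2)] M(1) by simp
    hence "b * (card (dyck_words M) * (\<Prod>i\<in>A. fact (count M i))) = b * fact n"
    proof -
      have "fact b = b * fact n" unfolding b_eq by simp
      thus ?thesis using \<open>card (dyck_words M) * b * (\<Prod>i\<in>A. fact (count M i)) = fact b\<close> by (simp only: mult_ac)
    qed
    hence "card (dyck_words M) * (\<Prod>i\<in>A. fact (count M i)) = fact n" using a_less by simp
    from arg_cong[OF this, of "of_nat :: nat \<Rightarrow> complex"] show ?thesis by (simp add: of_nat_prod)
  qed
  moreover have "ev 1 p * (\<Prod>i\<in>A. fact (count M i)) = (fact n :: complex)"
    using arg_cong[OF p, of "ev 1"] by (simp add: ev_prod ev_q_fact_1)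
  ultimately show ?thesis
    using nz \<open>w = 1\<close> mult_right_cancel[of "\<Prod>i\<in>A. fact (count M i) :: complex" "ev w p"
        "of_nat (card (dyck_words M))"] by simp
next
  case False
  have "d \<noteq> 0" using m n_pos by auto
  hence d: "2 \<le> d" using False by linarith
  interpret periodic_words a b n m d by unfold_locales (use m d in auto)
  have sum_c: "(\<Sum>i\<in>A. count M i) = Suc n" using size_sum_count[OF M(3,4)] M(1) b_eq by simp
  note E = q_quotient_root_of_unity[OF d w m M(4) sum_c p]
  show ?thesis
  proof (cases "\<exists>c\<in>A. count M c mod d = 1 \<and> (\<forall>i\<in>A - {c}. count M i mod d = 0)")
    case True
    then obtain c where c: "c \<in> A" "count M c mod d = 1" "\<And>i. i \<in> A - {c} \<Longrightarrow> count M i mod d = 0" by blast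
    \<comment> \<open>The letters of one period, once the central letter \<open>c\<close> has been
      removed.\<close>
    define N where "N = (\<Sum>i\<in>A. replicate_mset (count M i div d) i)"
    have cN: "count N i = (if i \<in> A then count M i div d else 0)" for i
      unfolding N_def by (rule count_sum_replicate_mset[OF M(4)])
    have MN: "M = repeat_mset d N + {#c#}"
    proof (rule multiset_eqI)
      fix i
      consider "i = c" | "i \<in> A - {c}" | "i \<notin> A" "i \<noteq> c" using c(1) by blast
      thus "count M i = count (repeat_mset d N + {#c#}) i"
      proof cases
        case 1
        then show ?thesis using c div_mult_mod_eq[of "count M c" d] by (simp add: cN mult.commute)
      next
        case 2
        then show ?thesis using c(3)[OF 2] by (auto simp: cN)
      next
        case 3
        then show ?thesis using M(3) by (auto simp: cN not_in_iff[symmetric])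
      qed
    qed
    have "size (repeat_mset k N) = k * size N" for k by (induction k) auto
    hence "size M = Suc (d * size N)" unfolding MN by simp
    hence "d * size N = d * m" using M(1) m b_eq by linarith
    hence sN: "size N = m" using d by simp
    have setN: "set_mset N \<subseteq> A" by (auto simp: cN simp flip: count_greater_zero_iff split: if_splits)
    have "card {v \<in> dyck_words M. (turn ^^ m) v = v} * (\<Prod>i\<in>A. fact (count N i)) = fact m"
      using prod_fact_count[OF setN M(4)] card_fixed_words[OF MN sN M(2)] sN by simp
    moreover have "(\<Prod>i\<in>A. fact (count N i) :: nat) = (\<Prod>i\<in>A. fact (count M i div d))"
      by (rule prod.cong) (auto simp: cN)
    ultimately have "card {v \<in> dyck_words M. (turn ^^ m) v = v} * (\<Prod>i\<in>A. fact (count M i div d)) = fact m" by simp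
    from arg_cong[OF this, of "of_nat :: nat \<Rightarrow> complex"]
    have "of_nat (card {v \<in> dyck_words M. (turn ^^ m) v = v}) * (\<Prod>i\<in>A. fact (count M i div d)) = (fact m :: complex)"
      by (simp add: of_nat_prod)
    moreover have "ev w p * (\<Prod>i\<in>A. fact (count M i div d)) = fact m" using E True by simp
    moreover have "(\<Prod>i\<in>A. fact (count M i div d)) \<noteq> (0 :: complex)" using M(4) by simp
    ultimately show ?thesis
      using mult_right_cancel[of "\<Prod>i\<in>A. fact (count M i div d) :: complex" "ev w p"
          "of_nat (card {v \<in> dyck_words M. (turn ^^ m) v = v})"] by simp
  next
    case no: False
    have "\<not> (turn ^^ m) v = v" if v: "v \<in> dyck_words M" for v
    proof
      assume f: "(turn ^^ m) v = v"
      have dw: "dyck_word v" "mset v = M" using v by (auto simp: dyck_words_def)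
      obtain u c where uc: "M = repeat_mset d (mset u) + {#c#}" using ex_cyc_turn[OF dw(1) f] dw(2) by blast
      have "c \<in> A" using uc M(3) by auto
      moreover have "count M c = 1 + d * count (mset u) c" by (simp add: uc)
      hence "count M c mod d = 1" using d by (simp only: mod_mult_self2) simp
      moreover have "count M i mod d = 0" if "i \<in> A - {c}" for i using that by (simp add: uc)
      ultimately show False using no by blast
    qed
    hence none: "{v \<in> dyck_words M. (turn ^^ m) v = v} = {}" by blast
    show ?thesis unfolding none using E no by simp
  qed
qed

end

section \<open>Powers of primitive roots of unity\<close>

lemma primitive_root_power_eq_1_iff:
  assumes "primitive_root_of_unity n z" "0 < n" shows "z ^ j = 1 \<longleftrightarrow> n dvd j"
proof -
  have "z ^ j = z ^ (n * (j div n) + j mod n)" by simp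
  also have "\<dots> = z ^ (j mod n)" using assms unfolding power_add power_mult by (simp add: primitive_root_of_unity_def)
  finally have e: "z ^ j = z ^ (j mod n)" .
  have "z ^ (j mod n) = 1 \<longleftrightarrow> j mod n = 0"
    using assms mod_less_divisor[of n j] unfolding primitive_root_of_unity_def by (metis gr0I power_0)
  thus ?thesis using e by (simp add: dvd_eq_mod_eq_0)
qed

lemma primitive_root_power:
  assumes z: "primitive_root_of_unity n z" and n: "0 < n"
  shows "primitive_root_of_unity (n div gcd k n) (z ^ k)"
proof -
  define g where "g = gcd k n"
  have g: "0 < g" "g dvd n" "g dvd k" using n by (auto simp: g_def)
  have "(z ^ k) ^ j = 1 \<longleftrightarrow> n div g dvd j" for j
  proof -
    have "(z ^ k) ^ j = 1 \<longleftrightarrow> n dvd k * j"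
      unfolding power_mult[symmetric] by (rule primitive_root_power_eq_1_iff[OF z n])
    also have "\<dots> \<longleftrightarrow> g * (n div g) dvd g * ((k div g) * j)" using g by (simp flip: mult.assoc)
    also have "\<dots> \<longleftrightarrow> n div g dvd (k div g) * j" using g(1) by (simp del: mult.assoc)
    also have "\<dots> \<longleftrightarrow> n div g dvd j"
    proof (rule coprime_dvd_mult_right_iff)
      show "coprime (n div g) (k div g)"
        using div_gcd_coprime[of k n] n by (simp add: g_def coprime_commute)
    qed
    finally show ?thesis .
  qed
  thus ?thesis unfolding primitive_root_of_unity_def g_def[symmetric]
    by (metis dvd_imp_le dvd_refl not_less)
qed

lemma to_fract_prod: "to_fract (\<Prod>x\<in>A. f x) = (\<Prod>x\<in>A. to_fract (f x))"
  by (induction A rule: infinite_finite_induct) auto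

theorem theorem5p1:
  fixes a b :: nat and r :: "nat \<Rightarrow> nat"
  assumes "0 < a" and "a < b" and "coprime a b"
    and "(\<Sum>i=1..a. i * r i) = a"
  shows "\<exists>p :: int poly. to_fract p = Krew_q a b r \<and>
    cyclic_sieving (NC_rank a b r) (integer_mod_group (b - 1)) (1 mod int (b - 1))
      (rot_action (b - 1) (NC_rank a b r)) p"
proof -
  define n where "n = b - 1"
  interpret coprime_pair a b n by unfold_locales (use assms in \<open>auto simp: n_def\<close>)
  let ?k = "sum r {1..a}" and ?M = "run_mset r" and ?C = "integer_mod_group n"
  define X where "X = word_partition ` dyck_words ?M"
  have X: "NC_rank a b r = X" unfolding X_def by (rule NC_rank_eq[OF assms(4)])
  let ?Den = "(\<Prod>i\<in>{1..a}. q_fact (r i)) * q_fact (b - ?k)"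
  have kb: "?k \<le> b" using sum_runs_le[OF assms(4)] assms(2) by simp
  obtain p where p: "p * ?Den = q_fact n" and nonneg: "\<And>i. 0 \<le> coeff p i"
    using q_kreweras_polynomial[of "{1..a}" r b "\<lambda>i. i"] kb assms n_def by auto
  have den: "?Den = (\<Prod>i\<in>{0..a}. q_fact (count ?M i))"
    unfolding interval_insert_0 by (simp add: count_run_mset mult.commute)
  have "to_fract p = Krew_q a b r"
  proof -
    have nz: "to_fract ?Den \<noteq> 0" by (simp add: q_fact_neq_0)
    have "to_fract p * to_fract ?Den = to_fract (q_fact n)" using p by (metis to_fract_mult)
    hence "to_fract p = to_fract (q_fact n) / to_fract ?Den" using nz by (metis nonzero_mult_div_cancel_right)
    thus ?thesis by (simp add: Krew_q_def n_def to_fract_prod)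
  qed
  moreover have "cyclic_sieving X ?C (1 mod int n) (rot_action n X) p"
    unfolding cyclic_sieving_def
  proof (intro conjI allI impI)
    have car: "carrier ?C = {0..<int n}" using n_pos by (simp add: carrier_integer_mod_group)
    show "finite X" by (simp add: X_def finite_dyck_words)
    show "finite (carrier ?C)" by (simp add: car)
    show one: "1 mod int n \<in> carrier ?C" using n_pos by (simp add: car)
    show "generate ?C {1 mod int n} = carrier ?C"
    proof -
      have "generate ?C {1 mod int n} = {(1 mod int n) [^]\<^bsub>?C\<^esub> (k :: int) | k. k \<in> UNIV}"
        by (rule group.generate_pow[OF group_integer_mod_group one])
      also have "\<dots> = range (\<lambda>k. k mod int n)"
        by (auto simp: int_pow_integer_mod_group mod_mult_right_eq)
      also have "\<dots> = carrier ?C"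
      proof (intro equalityI subsetI)
        fix x assume "x \<in> carrier ?C"
        hence "x = x mod int n" by (simp add: car)
        thus "x \<in> range (\<lambda>k. k mod int n)" by blast
      qed (use n_pos in \<open>auto simp: car\<close>)
      finally show ?thesis .
    qed
    show "group_action ?C X (rot_action n X)" unfolding X_def by (rule rot_action_group_action)
    show "0 \<le> coeff p i" for i by (rule nonneg)
    fix z g assume "primitive_root_of_unity (Coset.order ?C) z"
    hence z: "primitive_root_of_unity n z" by (simp add: Coset.order_def car)
    \<comment> \<open>The \<open>g\<close>-th power of rotation has the same fixed points as the
      \<open>m\<close>-th, and \<open>z ^ g\<close> is a primitive root of order
      \<open>n div m\<close>, the \<open>d\<close> of the counting argument.\<close>
    define m where "m = gcd g n"
    have nm: "n = (n div m) * m" by (simp add: m_def)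
    have w: "primitive_root_of_unity (n div m) (z ^ g)" unfolding m_def by (rule primitive_root_power[OF z n_pos])
    have "ev (z ^ g) p = of_nat (card {v \<in> dyck_words ?M. (turn ^^ m) v = v})"
      using p den nm w
      by (intro ev_eq_card_fixed[where A = "{0..a}" and d = "n div m"])
        (auto simp: size_run_mset[OF assms(4)] sum_run_mset[OF assms(4)] set_run_mset)
    moreover have "(1 mod int n) [^]\<^bsub>?C\<^esub> g = int (g mod n)"
      by (simp add: mod_mult_right_eq of_nat_mod)
    ultimately show "poly (map_poly of_int p) (z ^ g) = of_nat (card (invariants X (rot_action n X) ((1 mod int n) [^]\<^bsub>?C\<^esub> g)))"
      unfolding X_def m_def using card_invariants[of ?M g] by (simp add: ev_def)
  qed
  ultimately show ?thesis unfolding X n_def[symmetric] by blast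
qed

end
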